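(* Let $x \in \{0,1\}^n$ and $y \in \{0,1\}^m$ be binary strings that are given in run-length encoded form, and suppose the total number of runs in $x$ and $y$ together is $\ell$. Then $\operatorname{DTW}(x,y)$ can be computed in time $O(\ell \log \ell)$.
   Context: Strings are treated as time series over the alphabet $\{0,1\}$ with metric $d(a,b)=|a-b|$. The runs of a string are its maximal substrings consisting of a single repeated letter. Run-length encoding of $x$ means $x$ is given as a sequence of pairs $(i_1,a_1),(i_2,a_2),\ldots$ indicating that the $j$-th run of $x$ consists of $i_j$ copies of the letter $a_j$. A run is extended by further duplicating its letter; any string obtained from $x$ by extending runs of $x$ is an expansion of $x$. A correspondence between $x$ and $y$ is a pair $(\overline{x},\overline{y})$ of equal-length expansions of $x$ and $y$; its value is $\sum_i d(\overline{x}_i,\overline{y}_i)$. The dynamic time warping distance $\operatorname{DTW}(x,y)$ is the minimum value over all correspondences. Running time is measured in the standard RAM model. *)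

theory Defs
  imports Complex_Main "HOL-Library.Landau_Symbols"
begin

section \<open>Runs, expansions and dynamic time warping\<close>

text \<open>The pair \<open>(i, a)\<close> stands for a run of \<open>i\<close> copies of the letter \<open>a\<close>.\<close>

fun rle :: "nat list \<Rightarrow> (nat \<times> nat) list" where
  "rle [] = []"
| "rle (a # x) =
     (case rle x of
        [] \<Rightarrow> [(1, a)]
      | (i, b) # r \<Rightarrow> if a = b then (Suc i, b) # r else (1, a) # (i, b) # r)"

text \<open>The three facts below characterise \<open>rle x\<close>: it decodes to \<open>x\<close>, its runs are nonempty, and
  neighbouring runs carry different letters, so that every run is maximal.\<close>

lemma concat_rle: "concat (map (\<lambda>(i, a). replicate i a) (rle x)) = x"
  by (induction x) (auto split: list.splits)

lemma rle_pos: "(i, a) \<in> set (rle x) \<Longrightarrow> 0 < i"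
  by (induction x arbitrary: i a) (auto split: list.splits if_splits)

lemma rle_maximal:
  "Suc j < length (rle x) \<Longrightarrow> snd (rle x ! j) \<noteq> snd (rle x ! Suc j)"
  by (induction x arbitrary: j)
    (fastforce split: list.splits if_splits simp: nth_Cons split: nat.splits)+

definition expansion :: "nat list \<Rightarrow> nat list \<Rightarrow> bool" where
  "expansion x x' \<longleftrightarrow> list_all2 (\<lambda>(i, a) (j, b). i \<le> j \<and> a = b) (rle x) (rle x')"

definition correspondence :: "nat list \<Rightarrow> nat list \<Rightarrow> nat list \<Rightarrow> nat list \<Rightarrow> bool" where
  "correspondence x y x' y' \<longleftrightarrow> expansion x x' \<and> expansion y y' \<and> length x' = length y'"

definition letter_dist :: "nat \<Rightarrow> nat \<Rightarrow> nat" where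
  "letter_dist a b = nat \<bar>int a - int b\<bar>"

definition corr_value :: "nat list \<Rightarrow> nat list \<Rightarrow> nat" where
  "corr_value x' y' = (\<Sum>i<length x'. letter_dist (x' ! i) (y' ! i))"

text \<open>On natural numbers the infimum of a nonempty set is its least element; for nonempty strings
  the set is nonempty by \<open>correspondence_exists\<close>.\<close>

definition dtw :: "nat list \<Rightarrow> nat list \<Rightarrow> nat" where
  "dtw x y = Inf {corr_value x' y' | x' y'. correspondence x y x' y'}"

lemma rle_replicate_append:
  "\<exists>i r. rle (a # x) = (i, a) # r \<and> rle (replicate k a @ a # x) = (i + k, a) # r"
  by (induction k) (auto split: list.splits)

lemma expansion_replicate: "x \<noteq> [] \<Longrightarrow> expansion x (replicate k (hd x) @ x)"
proof -
  assume "x \<noteq> []"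
  then obtain a z where x: "x = a # z" by (cases x) auto
  obtain i r where "rle x = (i, a) # r" "rle (replicate k a @ x) = (i + k, a) # r"
    using rle_replicate_append[of a z k] x by metis
  then show ?thesis
    by (auto simp: x expansion_def intro!: list.rel_refl)
qed

lemma correspondence_exists:
  assumes "x \<noteq> []" "y \<noteq> []"
  shows "\<exists>x' y'. correspondence x y x' y'"
proof -
  have "correspondence x y (replicate (length y) (hd x) @ x) (replicate (length x) (hd y) @ y)"
    using assms by (simp add: correspondence_def expansion_replicate)
  then show ?thesis by blast
qed


section \<open>The word RAM\<close>

text \<open>The machine has registers \<open>R\<close> and a random-access memory \<open>M\<close>, both holding natural
  numbers. Every instruction costs one time unit. The semantics does not truncate numbers; the
  word length is a separate resource, bounded in \<open>computes_within\<close>. Since addresses are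
  register contents, this bounds the accessible part of the memory as well.\<close>

datatype arith = Add | Sub | Mul | Div

datatype instr =
    Const nat nat             (* Const i c:        R i := c *)
  | Arith arith nat nat nat   (* Arith f i j k:    R i := f (R j) (R k) *)
  | Load nat nat              (* Load i j:         R i := M (R j) *)
  | Store nat nat             (* Store i j:        M (R i) := R j *)
  | Goto nat
  | IfLess nat nat nat        (* IfLess i j p:     if R i < R j then goto p *)

type_synonym program = "instr list"

record config =
  pc :: nat
  reg :: "nat \<Rightarrow> nat"
  mem :: "nat \<Rightarrow> nat"

fun arith_op :: "arith \<Rightarrow> nat \<Rightarrow> nat \<Rightarrow> nat" where
  "arith_op Add a b = a + b"
| "arith_op Sub a b = a - b"
| "arith_op Mul a b = a * b"
| "arith_op Div a b = a div b"

fun exec :: "instr \<Rightarrow> config \<Rightarrow> config" where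
  "exec (Const i c) s = s\<lparr>pc := Suc (pc s), reg := (reg s)(i := c)\<rparr>"
| "exec (Arith f i j k) s =
     s\<lparr>pc := Suc (pc s), reg := (reg s)(i := arith_op f (reg s j) (reg s k))\<rparr>"
| "exec (Load i j) s = s\<lparr>pc := Suc (pc s), reg := (reg s)(i := mem s (reg s j))\<rparr>"
| "exec (Store i j) s = s\<lparr>pc := Suc (pc s), mem := (mem s)(reg s i := reg s j)\<rparr>"
| "exec (Goto p) s = s\<lparr>pc := p\<rparr>"
| "exec (IfLess i j p) s = s\<lparr>pc := (if reg s i < reg s j then p else Suc (pc s))\<rparr>"

definition halted :: "program \<Rightarrow> config \<Rightarrow> bool" where
  "halted P s \<longleftrightarrow> length P \<le> pc s"

definition step :: "program \<Rightarrow> config \<Rightarrow> config" where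
  "step P s = (if halted P s then s else exec (P ! pc s) s)"

definition words_fit :: "nat \<Rightarrow> config \<Rightarrow> bool" where
  "words_fit w s \<longleftrightarrow> (\<forall>i. reg s i < 2 ^ w) \<and> (\<forall>a. mem s a < 2 ^ w)"

text \<open>Halted configurations are fixed points of \<open>step\<close>, so the first conjunct says that the
  program halts after at most \<open>t\<close> steps. The result is left in register 0.\<close>

definition computes_within :: "program \<Rightarrow> config \<Rightarrow> nat \<Rightarrow> nat \<Rightarrow> nat \<Rightarrow> bool" where
  "computes_within P s v t w \<longleftrightarrow>
     halted P ((step P ^^ t) s) \<and> reg ((step P ^^ t) s) 0 = v \<and>
     (\<forall>u\<le>t. words_fit w ((step P ^^ u) s))"

text \<open>The two run counts are in registers 0 and 1. The pairs of the first encoding, followed by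
  those of the second, occupy consecutive memory cells from address 0 on.\<close>

definition rle_input :: "(nat \<times> nat) list \<Rightarrow> (nat \<times> nat) list \<Rightarrow> config" where
  "rle_input r s =
     (let cells = concat (map (\<lambda>(i, a). [i, a]) (r @ s)) in
      \<lparr>pc = 0,
       reg = (\<lambda>_. 0)(0 := length r, 1 := length s),
       mem = (\<lambda>a. if a < length cells then cells ! a else 0)\<rparr>)"

end

theory Submission
  imports Defs
begin

text \<open>
  Matching an inner run of \<open>x\<close> against the wrong letter merges its two neighbours. For equal
  first and last letters, a correspondence therefore amounts to removing runs until both strings
  have the same number of runs, at the cost of their total length, and only the string with more
  runs has to lose some: one selects \<open>k\<close> pairwise non-adjacent inner runs of least total length.
  Differing first or last letters only change the weights of the end runs.

  The maximal weight of an independent set of at most \<open>k\<close> positions of a path is concave in \<open>k\<close>.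
  Hence divide and conquer works: at the middle of a block, one of the two adjacent positions is
  unused, and for either choice the optimum is the sup-convolution of two concave sequences,
  obtained by merging their decreasing increments. All levels together take time \<open>O(l log l)\<close> on
  a RAM, to which a small structured language with a cost-aware big-step semantics is compiled.
\<close>

section \<open>Runs and warping costs\<close>

text \<open>Two obstacles shape the proof. The number \<open>k\<close> of runs to remove is
  prescribed, but a set of exactly \<open>k\<close> non-adjacent runs need not exist, while the
  recursion wants selections of at most \<open>k\<close> items. The weights
  \<open>W - xs ! i\<close> reconcile the two: with \<open>W\<close> the total length of both
  strings, a selection that falls short wastes at least one \<open>W\<close>, and \<open>W\<close>
  already bounds the distance. Secondly, whether an item at the seam of two blocks may be chosen
  depends on the other block, so every block is solved in four variants, according to which of its
  two end items are excluded; these variants are closed under joining blocks. When the numbers of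
  runs tie, either string may be the one that loses inner runs, so both orders have to be tried. Two
  single runs with different letters cost the maximum of their lengths, which is not a sum of
  removed runs; this case is kept apart throughout.\<close>

fun alt :: "nat \<Rightarrow> nat list \<Rightarrow> nat list" where
  "alt a [] = []"
| "alt a (k # ks) = replicate k a @ alt (1 - a) ks"

fun alt_runs :: "nat \<Rightarrow> nat list \<Rightarrow> (nat \<times> nat) list" where
  "alt_runs a [] = []"
| "alt_runs a (k # ks) = (k, a) # alt_runs (1 - a) ks"

abbreviation run_lengths :: "nat list \<Rightarrow> nat list" where
  "run_lengths x \<equiv> map fst (rle x)"

lemma map_fst_alt_runs [simp]: "map fst (alt_runs a ks) = ks"
  by (induction ks arbitrary: a) auto

lemma length_alt_runs [simp]: "length (alt_runs a ks) = length ks"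
  by (induction ks arbitrary: a) auto

lemma concat_alt_runs: "concat (map (\<lambda>(i, a). replicate i a) (alt_runs a ks)) = alt a ks"
  by (induction ks arbitrary: a) auto

lemma set_alt: "a \<le> 1 \<Longrightarrow> set (alt a ks) \<subseteq> {0, 1}"
  by (induction ks arbitrary: a) auto

lemma length_alt: "length (alt a ks) = sum_list ks"
  by (induction ks arbitrary: a) auto

lemma rle_Cons_replicate:
  assumes "rle x = [] \<or> snd (hd (rle x)) \<noteq> a"
  shows "rle (replicate (Suc k) a @ x) = (Suc k, a) # rle x"
  using assms by (induction k) (auto split: list.splits)

lemma rle_alt:
  assumes "a \<le> 1" "\<forall>k\<in>set ks. 0 < k"
  shows "rle (alt a ks) = alt_runs a ks"
  using assms
proof (induction ks arbitrary: a)
  case (Cons k ks)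
  then obtain k' where k': "k = Suc k'" by (cases k) auto
  have IH: "rle (alt (1 - a) ks) = alt_runs (1 - a) ks" using Cons by auto
  have "1 - a \<noteq> a" using Cons.prems(1) by arith
  then have "alt_runs (1 - a) ks = [] \<or> snd (hd (alt_runs (1 - a) ks)) \<noteq> a"
    by (cases ks) auto
  then show ?case
    using rle_Cons_replicate[of "alt (1 - a) ks" a k'] IH k' by simp
qed simp

lemma rle_binary:
  assumes "set x \<subseteq> {0, 1}"
  shows "rle x = alt_runs (hd x) (run_lengths x)"
  using assms
proof (induction x)
  case (Cons a x)
  show ?case
  proof (cases x)
    case (Cons b z)
    with Cons.IH Cons.prems obtain ks where ks: "rle x = alt_runs b ks" by auto
    moreover have "ks \<noteq> []" using ks Cons by (auto split: list.splits if_splits prod.splits)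
    ultimately obtain k ks' where "rle x = (k, b) # alt_runs (1 - b) ks'" by (cases ks) auto
    then show ?thesis
      using Cons.prems Cons by auto
  qed simp
qed simp

lemma alt_run_lengths:
  assumes "set x \<subseteq> {0, 1}"
  shows "alt (hd x) (run_lengths x) = x"
  by (metis assms rle_binary concat_alt_runs concat_rle)

lemma run_lengths_pos: "\<forall>k\<in>set (run_lengths x). 0 < k"
  using rle_pos by fastforce

lemma rle_eq_Nil_iff [simp]: "rle x = [] \<longleftrightarrow> x = []"
  by (cases x) (auto split: list.splits)

lemma run_lengths_Cons:
  assumes "u \<noteq> []" "run_lengths u = k # ks"
  shows "run_lengths (a # u) = (if a = hd u then Suc k # ks else 1 # k # ks)"
proof -
  obtain b v where u: "u = b # v" using assms by (cases u) auto
  then have "snd (hd (rle u)) = b" by (auto split: list.splits)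
  then show ?thesis using assms u by (auto split: list.splits simp del: rle.simps simp:
      rle.simps(2)[of a])
qed

lemma list_all2_alt_runs:
  "list_all2 (\<lambda>(i, a) (j, b). i \<le> j \<and> a = b) (alt_runs a ks) r \<longleftrightarrow>
     (\<exists>ks'. r = alt_runs a ks' \<and> list_all2 (\<le>) ks ks')"
proof (induction ks arbitrary: a r)
  case (Cons k ks)
  have "list_all2 (\<lambda>(i, a) (j, b). i \<le> j \<and> a = b) (alt_runs a (k # ks)) r \<longleftrightarrow>
      (\<exists>k' ks'. r = (k', a) # alt_runs (1 - a) ks' \<and> k \<le> k' \<and> list_all2 (\<le>) ks ks')"
    by (auto simp: list_all2_Cons1 Cons.IH)
  also have "\<dots> \<longleftrightarrow> (\<exists>ks'. r = alt_runs a ks' \<and> list_all2 (\<le>) (k # ks) ks')"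
    by (metis alt_runs.simps(2) list_all2_Cons1)
  finally show ?case .
qed auto

lemma list_all2_le_pos:
  assumes "list_all2 (\<le>) ks (ks' :: nat list)" "\<forall>k\<in>set ks. 0 < k"
  shows "\<forall>k\<in>set ks'. 0 < k"
  using assms by (induction rule: list_all2_induct) auto

text \<open>An expansion keeps the letters and their alternation, so only the run lengths vary.
  Positivity of the lengths matters: an empty run would let its neighbours merge.\<close>

lemma expansion_iff_alt:
  assumes "set x \<subseteq> {0, 1}" "x \<noteq> []"
  shows "expansion x x' \<longleftrightarrow> (\<exists>ks. list_all2 (\<le>) (run_lengths x) ks \<and> x' = alt (hd x) ks)"
proof -
  obtain ls where ls: "rle x = alt_runs (hd x) ls" "run_lengths x = ls"
    using rle_binary[OF assms(1)] by simp
  have "hd x \<le> 1" using assms by (cases x) auto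
  moreover have "\<forall>k\<in>set ls. 0 < k" using run_lengths_pos ls(2) by blast
  ultimately have "x' = alt (hd x) ks \<longleftrightarrow> rle x' = alt_runs (hd x) ks" if "list_all2 (\<le>) ls ks" for ks
    using rle_alt[of "hd x" ks] list_all2_le_pos[OF that] concat_alt_runs concat_rle by metis
  then show ?thesis
    unfolding expansion_def ls(2) unfolding ls(1) list_all2_alt_runs by blast
qed

lemma corr_value_Cons: "corr_value (a # u) (b # v) = letter_dist a b + corr_value u v"
  by (simp add: corr_value_def sum.lessThan_Suc_shift del: sum.lessThan_Suc)

lemma corr_value_append:
  "length u = length v \<Longrightarrow> corr_value (u @ u') (v @ v') = corr_value u v + corr_value u' v'"
  by (induction u v rule: list_induct2) (auto simp: corr_value_Cons, simp add: corr_value_def)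

lemma corr_value_replicate:
  "corr_value (replicate k a) (replicate k b) = k * letter_dist a b"
  by (simp add: corr_value_def)

lemma letter_dist_binary: "a \<le> 1 \<Longrightarrow> b \<le> 1 \<Longrightarrow> letter_dist a b = of_bool (a \<noteq> b)"
  by (auto simp: letter_dist_def le_Suc_eq)

text \<open>\<open>warp d xs ys c\<close>: strings with run lengths \<open>xs\<close> and \<open>ys\<close>, whose first letters differ iff
  \<open>d\<close>, can be aligned at cost \<open>c\<close> by matching some whole runs against the wrong letter. Such a
  run is \<open>z\<close> in \<open>last1\<close>, \<open>last2\<close>, \<open>skip1\<close> and \<open>skip2\<close>, where in the skip rules its two
  neighbours are matched to one run of the other string; in \<open>first1\<close> and \<open>first2\<close> it is the
  first run.\<close>

inductive warp :: "bool \<Rightarrow> nat list \<Rightarrow> nat list \<Rightarrow> nat \<Rightarrow> bool" where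
  stop: "warp False [x] [y] 0"
| last1: "warp False [x, z] [y] z"
| last2: "warp False [x] [y, z] z"
| both: "warp False xs ys c \<Longrightarrow> warp False (x # xs) (y # ys) c"
| skip1: "warp False (x' # xs) ys c \<Longrightarrow> warp False (x # z # x' # xs) ys (c + z)"
| skip2: "warp False xs (y' # ys) c \<Longrightarrow> warp False xs (y # z # y' # ys) (c + z)"
| first1: "warp False xs ys c \<Longrightarrow> warp True (x # xs) ys (c + x)"
| first2: "warp False xs ys c \<Longrightarrow> warp True xs (y # ys) (c + y)"
| clash: "warp True [x] [y] (max x y)"

lemma warp_nonempty: "warp d xs ys c \<Longrightarrow> xs \<noteq> [] \<and> ys \<noteq> []"
  by (induction rule: warp.induct) auto

lemma warp_sym: "warp d xs ys c \<Longrightarrow> warp d ys xs c"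
proof (induction rule: warp.induct)
  case (clash x y) then show ?case using warp.clash[of y x] by (simp add: max.commute)
qed (auto intro: warp.intros)

text \<open>No rule for agreeing first letters charges for a first run: both can be stretched to any
  common length for free.\<close>

lemma warp_first_irrelevant:
  "warp False (x # xs) (y # ys) c \<Longrightarrow> warp False (x' # xs) (y' # ys) c"
  by (induction False "x # xs" "y # ys" c arbitrary: x xs y ys x' y' rule: warp.induct)
    (auto intro: warp.intros)

text \<open>The rules charge run lengths or their maximum, so shorter runs admit the same derivation
  at no greater cost. This carries a derivation for expansions back to the original strings.\<close>

lemma warp_mono:
  assumes "warp d xs ys c" "list_all2 (\<le>) xs' xs" "list_all2 (\<le>) ys' ys"
  shows "\<exists>c'\<le>c. warp d xs' ys' c'"
  using assms
proof (induction arbitrary: xs' ys' rule: warp.induct)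
  case (skip1 a xs ys c x z)
  then obtain x1 z1 a1 xs1 where *: "xs' = x1 # z1 # a1 # xs1" "z1 \<le> z"
      "list_all2 (\<le>) (a1 # xs1) (a # xs)"
    by (auto simp: list_all2_Cons2)
  with skip1 obtain c' where "c' \<le> c" "warp False (a1 # xs1) ys' c'" by blast
  then show ?case using * warp.skip1[of a1 xs1 ys' c' x1 z1] by (auto intro!: exI[of _ "c' + z1"])
next
  case (skip2 xs a ys c x z)
  then obtain x1 z1 a1 xs1 where *: "ys' = x1 # z1 # a1 # xs1" "z1 \<le> z"
      "list_all2 (\<le>) (a1 # xs1) (a # ys)"
    by (auto simp: list_all2_Cons2)
  with skip2 obtain c' where "c' \<le> c" "warp False xs' (a1 # xs1) c'" by blast
  then show ?case using * warp.skip2[of xs' a1 xs1 c' x1 z1] by (auto intro!: exI[of _ "c' + z1"])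
next
  case (clash x y)
  then obtain x1 y1 where "xs' = [x1]" "ys' = [y1]" "x1 \<le> x" "y1 \<le> y"
    by (auto simp: list_all2_Cons2)
  then show ?case using warp.clash[of x1 y1] by (intro exI[of _ "max x1 y1"]) auto
next
  case (first1 xs ys c x)
  then obtain x1 xs1 where *: "xs' = x1 # xs1" "x1 \<le> x" "list_all2 (\<le>) xs1 xs"
    by (auto simp: list_all2_Cons2)
  with first1 obtain c' where "c' \<le> c" "warp False xs1 ys' c'" by blast
  then show ?case using * warp.first1[of xs1 ys' c' x1] by (auto intro!: exI[of _ "c' + x1"])
next
  case (first2 xs ys c x)
  then obtain x1 xs1 where *: "ys' = x1 # xs1" "x1 \<le> x" "list_all2 (\<le>) xs1 ys"
    by (auto simp: list_all2_Cons2)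
  with first2 obtain c' where "c' \<le> c" "warp False xs' xs1 c'" by blast
  then show ?case using * warp.first2[of xs' xs1 c' x1] by (auto intro!: exI[of _ "c' + x1"])
next
  case (both xs ys c x y)
  then show ?case by (fastforce simp: list_all2_Cons2 intro: warp.both)
qed (auto simp: list_all2_Cons2 intro: warp.intros)

text \<open>The new run has the first letter of \<open>ys\<close>. If the first run of
  \<open>xs\<close> was charged, it becomes a skipped run at the same price; if that of
  \<open>ys\<close> was charged, the charge disappears.\<close>

lemma warp_new_run:
  assumes "warp True xs ys c"
  shows "\<exists>c'\<le>c. warp False (x # xs) ys c'"
  using assms
proof (cases rule: warp.cases)
  case (first1 xs' c' x')
  then show ?thesis using warp_nonempty[of False _ _ c'] warp.skip1[of _ _ ys c' x x']
      by (cases xs') auto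
next
  case (first2 ys' c' y)
  then show ?thesis using warp.both by (intro exI[of _ c']) auto
next
  case (clash x' y)
  then show ?thesis using warp.last1 by (intro exI[of _ x']) auto
qed auto

text \<open>Peeling off the first column of a correspondence either extends the first runs or starts
  new ones.\<close>

lemma warp_le_corr_value:
  assumes "length u = length v" "u \<noteq> []" "set u \<subseteq> {0, 1}" "set v \<subseteq> {0, 1}"
  shows "\<exists>c \<le> corr_value u v. warp (hd u \<noteq> hd v) (run_lengths u) (run_lengths v) c"
  using assms
proof (induction u v rule: list_induct2)
  case (Cons a u b v)
  have d: "corr_value (a # u) (b # v) = of_bool (a \<noteq> b) + corr_value u v"
    using Cons.prems by (auto simp: corr_value_Cons letter_dist_def)
  show ?case
  proof (cases "u = []")
    case True
    with Cons have "v = []" by auto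
    with True show ?thesis
      unfolding d using warp.stop[of 1 1] warp.clash[of 1 1] by (cases "a = b") auto
  next
    case False
    then have "v \<noteq> []" using Cons by auto
    obtain k ks where ks: "run_lengths u = k # ks" using False by (cases "run_lengths u") auto
    obtain l ls where ls: "run_lengths v = l # ls" using \<open>v \<noteq> []\<close> by (cases "run_lengths v") auto
    obtain c where c: "c \<le> corr_value u v" "warp (hd u \<noteq> hd v) (k # ks) (l # ls) c"
      using Cons False ks ls by auto
    have bin: "a \<in> {0,1}" "b \<in> {0,1}" "hd u \<in> {0,1}" "hd v \<in> {0,1}"
      using Cons.prems False \<open>v \<noteq> []\<close> by (auto dest: hd_in_set)
    note ra = run_lengths_Cons[OF False ks, of a] and rb = run_lengths_Cons[OF \<open>v \<noteq> []\<close> ls, of b]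
    have "\<exists>c' \<le> of_bool (a \<noteq> b) + c. warp (a \<noteq> b) (run_lengths (a # u)) (run_lengths (b # v)) c'"
    proof (cases "a = b")
      case True
      \<comment> \<open>Each letter either extends the first run of its string or opens a new run of
        length 1.\<close>
      consider "a = hd u" "b = hd v" | "a = hd u" "b \<noteq> hd v" | "a \<noteq> hd u" "b = hd v"
        | "a \<noteq> hd u" "b \<noteq> hd v" by blast
      then show ?thesis
      proof cases
        case 1
        with True c(2) have "warp False (Suc k # ks) (Suc l # ls) c"
          using warp_first_irrelevant by auto
        then show ?thesis using 1 True ra rb by auto
      next
        case 2
        with True c(2) have "warp True (l # ls) (k # ks) c" using warp_sym by auto
        from warp_new_run[OF this, of 1] obtain c' where "c' \<le> c"
            "warp False (k # ks) (1 # l # ls) c'"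
          using warp_sym by blast
        then show ?thesis using 2 True ra rb warp_first_irrelevant[of k ks] by auto
      next
        case 3
        with True c(2) have "warp True (k # ks) (l # ls) c" by auto
        from warp_new_run[OF this, of 1] obtain c' where "c' \<le> c"
            "warp False (1 # k # ks) (l # ls) c'"
          by blast
        then show ?thesis using 3 True ra rb warp_first_irrelevant[of _ _ l ls] by auto
      next
        case 4
        with True bin c(2) have "warp False (k # ks) (l # ls) c" by auto
        then show ?thesis using 4 True ra rb warp.both by auto
      qed
    next
      case ab: False
      consider "a = hd u" "b = hd v" | "a = hd u" "b \<noteq> hd v" | "a \<noteq> hd u" "b = hd v"
        | "a \<noteq> hd u" "b \<noteq> hd v" by blast
      then show ?thesis
      proof cases
        case 1
        with ab c(2) have "warp True (k # ks) (l # ls) c" by auto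
        \<comment> \<open>The cost 1 of the column pays for the growth of the charged first run, or
          of the maximum in \<open>clash\<close>.\<close>
        then have "\<exists>c'\<le>c + 1. warp True (Suc k # ks) (Suc l # ls) c'"
        proof (cases rule: warp.cases)
          case (first1 c')
          then have "warp False ks (Suc l # ls) c'"
            using warp_nonempty[of False _ _ c'] warp_first_irrelevant by (cases ks) auto
          then show ?thesis using warp.first1[of _ _ c' "Suc k"] first1 by auto
        next
          case (first2 c')
          then have "warp False (Suc k # ks) ls c'"
            using warp_nonempty[of False _ _ c'] warp_first_irrelevant by (cases ls) auto
          then show ?thesis using warp.first2[of _ _ c' "Suc l"] first2 by auto
        next
          case clash
          then show ?thesis using warp.clash[of "Suc k" "Suc l"] by auto
        qed auto
        then show ?thesis using 1 ab ra rb by auto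
      next
        case 2
        with ab bin c(2) have "warp False (Suc k # ks) (l # ls) c"
          using warp_first_irrelevant by auto
        from warp.first2[OF this, of 1] show ?thesis using 2 ab ra rb by auto
      next
        case 3
        with ab bin c(2) have "warp False (k # ks) (Suc l # ls) c"
          using warp_first_irrelevant by auto
        from warp.first1[OF this, of 1] show ?thesis using 3 ab ra rb by auto
      next
        case 4
        \<comment> \<open>Here \<open>hd u = b\<close> and \<open>hd v = a\<close>. The new run of
          \<open>v\<close> faces the old \<open>u\<close> with agreeing letters, and the new run of
          \<open>u\<close> is charged 1 for the column.\<close>
        with ab bin c(2) have "warp True (l # ls) (k # ks) c" using warp_sym by auto
        from warp_new_run[OF this, of 1] obtain c' where c': "c' \<le> c"
            "warp False (k # ks) (1 # l # ls) c'"
          using warp_sym by blast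
        from warp.first1[OF c'(2), of 1] show ?thesis using 4 ab ra rb c'(1) by auto
      qed
    qed
    then show ?thesis using c(1) unfolding d by (metis add_left_mono le_trans list.sel(1))
  qed
qed simp

text \<open>Each rule dictates an expansion: runs matched to each other are stretched to a common
  length, and a run matched against the wrong letter lies opposite an extension of one run of the
  other string.\<close>

lemma corr_value_le_warp:
  assumes "warp d xs ys c" "a \<le> 1" "b \<le> 1" "d \<longleftrightarrow> a \<noteq> b"
  shows "\<exists>ks ls. list_all2 (\<le>) xs ks \<and> list_all2 (\<le>) ys ls \<and> sum_list ks = sum_list ls \<and>
    corr_value (alt a ks) (alt b ls) \<le> c"
  using assms
proof (induction arbitrary: a b rule: warp.induct)
  case (stop x y)
  then show ?case
    by - (rule exI[of _ "[max x y]"], rule exI[of _ "[max x y]"],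
      simp add: corr_value_replicate letter_dist_binary)
next
  case (last1 x z y)
  have "replicate (x + y + z) a = replicate (x + y) a @ replicate z a" by (simp add: replicate_add)
  with last1 show ?case
    by - (rule exI[of _ "[x + y, z]"], rule exI[of _ "[x + y + z]"],
      simp add: corr_value_append corr_value_replicate letter_dist_binary)
next
  case (last2 x y z)
  have "replicate (x + y + z) a = replicate (x + y) a @ replicate z a" by (simp add: replicate_add)
  with last2 show ?case
    by - (rule exI[of _ "[x + y + z]"], rule exI[of _ "[x + y, z]"],
      simp add: corr_value_append corr_value_replicate letter_dist_binary)
next
  case (both xs ys c x y)
  have "1 - a \<le> 1" "1 - b \<le> 1" "False = (1 - a \<noteq> 1 - b)" using both by auto
  from both.IH[OF this] obtain ks ls where
    "list_all2 (\<le>) xs ks" "list_all2 (\<le>) ys ls" "sum_list ks = sum_list ls"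
    "corr_value (alt (1 - a) ks) (alt (1 - b) ls) \<le> c" by blast
  then show ?case using both.prems
    by - (rule exI[of _ "max x y # ks"], rule exI[of _ "max x y # ls"],
      simp add: corr_value_append corr_value_replicate letter_dist_binary)
next
  case (skip1 x' xs ys c x z)
  from skip1.IH[OF skip1.prems] obtain ks ls where
    *: "list_all2 (\<le>) (x' # xs) ks" "list_all2 (\<le>) ys ls" "sum_list ks = sum_list ls"
    "corr_value (alt a ks) (alt b ls) \<le> c" by blast
  obtain y ys' where "ys = y # ys'" using warp_nonempty[OF skip1.hyps] by (cases ys) auto
  with * obtain l ls' where l: "ls = l # ls'" "y \<le> l" "list_all2 (\<le>) ys' ls'"
    by (auto simp: list_all2_Cons1)
  \<comment> \<open>The first run of \<open>ys\<close> grows by \<open>x + z\<close>: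
    \<open>x\<close> cells agree with the first run, \<open>z\<close> cells pay for the skipped one,
    and the remaining \<open>l\<close> serve the merged neighbour.\<close>
  have "alt b ((x + z + l) # ls') = replicate x b @ replicate z b @ alt b ls"
    by (simp add: l replicate_add)
  moreover have "Suc 0 - b \<noteq> b" "Suc 0 - a \<noteq> a" using skip1.prems by arith+
  ultimately show ?case using * l skip1.prems \<open>ys = y # ys'\<close>
    by - (rule exI[of _ "x # z # ks"], rule exI[of _ "(x + z + l) # ls'"],
      simp add: corr_value_append corr_value_replicate letter_dist_binary)
next
  case (skip2 ys x' xs c x z)
  from skip2.IH[OF skip2.prems] obtain ks ls where
    *: "list_all2 (\<le>) (x' # xs) ks" "list_all2 (\<le>) ys ls" "sum_list ls = sum_list ks"
    "corr_value (alt a ls) (alt b ks) \<le> c" by blast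
  obtain y ys' where "ys = y # ys'" using warp_nonempty[OF skip2.hyps] by (cases ys) auto
  with * obtain l ls' where l: "ls = l # ls'" "y \<le> l" "list_all2 (\<le>) ys' ls'"
    by (auto simp: list_all2_Cons1)
  have "alt a ((x + z + l) # ls') = replicate x a @ replicate z a @ alt a ls"
    by (simp add: l replicate_add)
  moreover have "Suc 0 - a \<noteq> a" "Suc 0 - b \<noteq> b" using skip2.prems by arith+
  ultimately show ?case using * l skip2.prems \<open>ys = y # ys'\<close>
    by - (rule exI[of _ "(x + z + l) # ls'"], rule exI[of _ "x # z # ks"],
      simp add: corr_value_append corr_value_replicate letter_dist_binary)
next
  case (first1 xs ys c x)
  have "1 - a \<le> 1" "b \<le> 1" "False = (1 - a \<noteq> b)" using first1 by auto
  from first1.IH[OF this] obtain ks ls where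
    *: "list_all2 (\<le>) xs ks" "list_all2 (\<le>) ys ls" "sum_list ks = sum_list ls"
    "corr_value (alt (1 - a) ks) (alt b ls) \<le> c" by blast
  obtain y ys' where "ys = y # ys'" using warp_nonempty[OF first1.hyps] by (cases ys) auto
  with * obtain l ls' where l: "ls = l # ls'" "y \<le> l" "list_all2 (\<le>) ys' ls'"
    by (auto simp: list_all2_Cons1)
  have "alt b ((x + l) # ls') = replicate x b @ alt b ls"
    by (simp add: l replicate_add)
  then show ?case using * l first1.prems \<open>ys = y # ys'\<close>
    by - (rule exI[of _ "x # ks"], rule exI[of _ "(x + l) # ls'"],
      simp add: corr_value_append corr_value_replicate letter_dist_binary)
next
  case (first2 ys xs c x)
  have "a \<le> 1" "1 - b \<le> 1" "False = (a \<noteq> 1 - b)" using first2 by auto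
  from first2.IH[OF this] obtain ks ls where
    *: "list_all2 (\<le>) xs ks" "list_all2 (\<le>) ys ls" "sum_list ls = sum_list ks"
    "corr_value (alt a ls) (alt (1 - b) ks) \<le> c" by blast
  obtain y ys' where "ys = y # ys'" using warp_nonempty[OF first2.hyps] by (cases ys) auto
  with * obtain l ls' where l: "ls = l # ls'" "y \<le> l" "list_all2 (\<le>) ys' ls'"
    by (auto simp: list_all2_Cons1)
  have "alt a ((x + l) # ls') = replicate x a @ alt a ls"
    by (simp add: l replicate_add)
  then show ?case using * l first2.prems \<open>ys = y # ys'\<close>
    by - (rule exI[of _ "(x + l) # ls'"], rule exI[of _ "x # ks"],
      simp add: corr_value_append corr_value_replicate letter_dist_binary)
next
  case (clash x y)
  then show ?case
    by - (rule exI[of _ "[max x y]"], rule exI[of _ "[max x y]"],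
      simp add: corr_value_replicate letter_dist_binary)
qed

section \<open>The distance as the least warping cost\<close>

context
  fixes x y :: "nat list"
  assumes x: "set x \<subseteq> {0, 1}" "x \<noteq> []" and y: "set y \<subseteq> {0, 1}" "y \<noteq> []"
begin

lemma dtw_le_warp:
  assumes "warp (hd x \<noteq> hd y) (run_lengths x) (run_lengths y) c"
  shows "dtw x y \<le> c"
proof -
  have "hd x \<le> 1" "hd y \<le> 1" using x y by (auto dest!: hd_in_set)
  from corr_value_le_warp[OF assms this refl] obtain ks ls where
    *: "list_all2 (\<le>) (run_lengths x) ks" "list_all2 (\<le>) (run_lengths y) ls"
    "sum_list ks = sum_list ls" "corr_value (alt (hd x) ks) (alt (hd y) ls) \<le> c" by blast
  then have "correspondence x y (alt (hd x) ks) (alt (hd y) ls)"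
    unfolding correspondence_def using x y by (auto simp: expansion_iff_alt length_alt)
  then have "dtw x y \<le> corr_value (alt (hd x) ks) (alt (hd y) ls)"
    unfolding dtw_def by (intro cInf_lower) auto
  then show ?thesis using * by simp
qed

text \<open>An optimal correspondence yields a derivation for the run lengths of its two expansions;
  monotonicity brings it back to those of \<open>x\<close> and \<open>y\<close>.\<close>

lemma warp_le_dtw: "\<exists>c\<le>dtw x y. warp (hd x \<noteq> hd y) (run_lengths x) (run_lengths y) c"
proof -
  have "dtw x y \<in> {corr_value x' y' | x' y'. correspondence x y x' y'}"
    unfolding dtw_def using correspondence_exists[OF x(2) y(2)] by (intro Inf_nat_def1) auto
  then obtain x' y' where *: "dtw x y = corr_value x' y'" "correspondence x y x' y'" by blast
  from *(2) obtain ks ls where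
    ks: "list_all2 (\<le>) (run_lengths x) ks" "x' = alt (hd x) ks" and
    ls: "list_all2 (\<le>) (run_lengths y) ls" "y' = alt (hd y) ls" and len: "length x' = length y'"
    unfolding correspondence_def using x y by (auto simp: expansion_iff_alt)
  have h: "hd x \<le> 1" "hd y \<le> 1" using x y by (auto dest!: hd_in_set)
  have pos: "\<forall>k\<in>set ks. 0 < k" "\<forall>k\<in>set ls. 0 < k"
    using list_all2_le_pos[OF ks(1)] list_all2_le_pos[OF ls(1)] run_lengths_pos by blast+
  have rl: "run_lengths x' = ks" "run_lengths y' = ls"
    using rle_alt[OF h(1) pos(1)] rle_alt[OF h(2) pos(2)] ks(2) ls(2) by simp_all
  obtain k ks' where k: "ks = k # ks'" "0 < k"
    using ks(1) x(2) pos(1) by (cases ks) auto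
  obtain l ls' where l: "ls = l # ls'" "0 < l"
    using ls(1) y(2) pos(2) by (cases ls) auto
  have hd': "hd x' = hd x" "hd y' = hd y" "x' \<noteq> []"
    using k l ks ls by (auto simp: hd_append)
  have "set x' \<subseteq> {0,1}" "set y' \<subseteq> {0,1}" using h ks ls set_alt by auto
  from warp_le_corr_value[OF len hd'(3) this] obtain c where
    "c \<le> dtw x y" "warp (hd x \<noteq> hd y) ks ls c"
    using * rl hd' by auto
  then show ?thesis using warp_mono[OF _ ks(1) ls(1)] by (meson le_trans)
qed

text \<open>This bound lets \<open>length x + length y\<close> serve both as the penalty
  \<open>W\<close> and as the initial value of the minimum in the program.\<close>

lemma dtw_le_length: "dtw x y \<le> length x + length y"
proof -
  let ?x' = "replicate (length y) (hd x) @ x" and ?y' = "replicate (length x) (hd y) @ y"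
  have "correspondence x y ?x' ?y'" using x y by (simp add: correspondence_def expansion_replicate)
  then have "dtw x y \<le> corr_value ?x' ?y'" unfolding dtw_def by (intro cInf_lower) auto
  also have "\<dots> \<le> (\<Sum>i<length ?x'. 1)"
    unfolding corr_value_def
  proof (rule sum_mono)
    fix i assume "i \<in> {..<length ?x'}"
    then have "?x' ! i \<in> set ?x'" "?y' ! i \<in> set ?y'" by (simp_all only: nth_mem lessThan_iff
        length_append length_replicate add.commute)
    moreover have "set ?x' \<subseteq> {0,1}" "set ?y' \<subseteq> {0,1}" using x y by (auto dest!: hd_in_set)
    ultimately have "?x' ! i \<le> 1" "?y' ! i \<le> 1" by force+
    then show "letter_dist (?x' ! i) (?y' ! i) \<le> 1" by (simp add: letter_dist_binary)
  qed
  finally show ?thesis by simp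
qed

end

section \<open>Heaviest independent sets of a path\<close>

definition indep :: "nat set \<Rightarrow> bool" where
  "indep S \<longleftrightarrow> (\<forall>i\<in>S. Suc i \<notin> S)"

lemma indep_subset: "indep S \<Longrightarrow> T \<subseteq> S \<Longrightarrow> indep T"
  unfolding indep_def by blast

text \<open>\<open>S\<close> and its shift by one are disjoint subsets of
  \<open>{a..b}\<close>.\<close>

lemma indep_card:
  assumes "indep S" "S \<subseteq> {a..<b}"
  shows "2 * card S \<le> b - a + 1"
proof -
  have fin: "finite S" using assms(2) finite_subset by blast
  have "card (S \<union> Suc ` S) = card S + card (Suc ` S)"
    using assms(1) fin unfolding indep_def by (intro card_Un_disjoint) auto
  also have "\<dots> = 2 * card S" by (simp add: card_image)
  finally have "2 * card S = card (S \<union> Suc ` S)" by simp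
  also have "\<dots> \<le> card {a..b}"
    using assms(2) by (intro card_mono) auto
  finally have *: "2 * card S \<le> Suc b - a" by simp
  show ?thesis
  proof (cases "a < b")
    case False
    then have "S = {}" using assms(2) by auto
    then show ?thesis by simp
  qed (use * in auto)
qed

text \<open>Bounding the cardinality instead of fixing it keeps the maximum defined for every
  \<open>k\<close>, even when no independent set of size \<open>k\<close> exists.\<close>

definition best_sum :: "(nat \<Rightarrow> nat) \<Rightarrow> nat \<Rightarrow> nat \<Rightarrow> nat \<Rightarrow> nat" where
  "best_sum c lo hi k = Max (sum c ` {S. S \<subseteq> {lo..<hi} \<and> indep S \<and> card S \<le> k})"

lemma finite_selections: "finite {S. S \<subseteq> {lo..<hi::nat} \<and> indep S \<and> card S \<le> k}"
  by (rule finite_subset[of _ "Pow {lo..<hi}"]) auto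

lemma best_sum_ge:
  assumes "S \<subseteq> {lo..<hi}" "indep S" "card S \<le> k"
  shows "sum c S \<le> best_sum c lo hi k"
  unfolding best_sum_def using assms by (intro Max_ge finite_imageI finite_selections) auto

lemma best_sum_attained:
  obtains S where "S \<subseteq> {lo..<hi}" "indep S" "card S \<le> k" "best_sum c lo hi k = sum c S"
proof -
  have "{} \<in> {S. S \<subseteq> {lo..<hi} \<and> indep S \<and> card S \<le> k}" by (simp add: indep_def)
  then have "best_sum c lo hi k \<in> sum c ` {S. S \<subseteq> {lo..<hi} \<and> indep S \<and> card S \<le> k}"
    unfolding best_sum_def by (intro Max_in finite_imageI finite_selections) blast
  then show ?thesis using that by auto
qed

lemma best_sum_leI:
  assumes "\<And>S. S \<subseteq> {lo..<hi} \<Longrightarrow> indep S \<Longrightarrow> card S \<le> k \<Longrightarrow> sum c S \<le> m"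
  shows "best_sum c lo hi k \<le> m"
  using best_sum_attained assms by metis

lemma best_sum_0 [simp]: "best_sum c lo hi 0 = 0"
proof -
  have "best_sum c lo hi 0 \<le> 0"
  proof (rule best_sum_leI)
    fix S :: "nat set" assume "S \<subseteq> {lo..<hi}" "card S \<le> 0"
    then have "S = {}" using finite_subset by fastforce
    then show "sum c S \<le> 0" by simp
  qed
  then show ?thesis by simp
qed

lemma best_sum_mono: "k \<le> k' \<Longrightarrow> best_sum c lo hi k \<le> best_sum c lo hi k'"
  by (rule best_sum_leI) (auto intro: best_sum_ge)

lemma best_sum_le_sum: "best_sum c lo hi k \<le> sum c {lo..<hi}"
  by (rule best_sum_leI) (auto intro: sum_mono2)

lemma best_sum_saturated:
  assumes "hi - lo \<le> k"
  shows "best_sum c lo hi (Suc k) = best_sum c lo hi k"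
proof (rule antisym)
  show "best_sum c lo hi (Suc k) \<le> best_sum c lo hi k"
  proof (rule best_sum_leI)
    fix S assume S: "S \<subseteq> {lo..<hi}" "indep S"
    then have "card S \<le> k" using card_mono[OF _ S(1)] assms by simp
    then show "sum c S \<le> best_sum c lo hi k" using S by (intro best_sum_ge)
  qed
qed (simp add: best_sum_mono)

lemma card_split: "finite S \<Longrightarrow> card S = card (S \<inter> {..<p}) + card (S \<inter> {p..})" for p :: nat
  by (subst card_Un_disjoint[symmetric]) (auto intro!: arg_cong[of _ _ card])

lemma sum_split: "finite S \<Longrightarrow> sum c S = sum c (S \<inter> {..<p}) + sum c (S \<inter> {p..})"
  for p :: nat and c :: "nat \<Rightarrow> nat"
  by (subst sum.union_disjoint[symmetric]) (auto intro!: arg_cong[of _ _ "sum c"])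

lemma card_Int_lessThan_Suc: "finite S \<Longrightarrow> card (S \<inter> {..<Suc p}) = card (S \<inter> {..<p}) + of_bool (p \<in>
    S)"
proof -
  assume "finite S"
  moreover have "S \<inter> {..<Suc p} = (if p \<in> S then insert p (S \<inter> {..<p}) else S \<inter> {..<p})"
    by (auto simp: less_Suc_eq)
  ultimately show ?thesis by auto
qed

text \<open>Cutting both sets where \<open>T\<close> first gets ahead of \<open>S\<close> by two and exchanging their tails
  balances the cardinalities.\<close>

lemma exchange_tails:
  assumes "indep S" "indep T" "S \<subseteq> {lo..<hi}" "T \<subseteq> {lo..<hi}" "card S \<le> k" "card T = k + 2"
  obtains S' T' where "indep S'" "indep T'" "S' \<subseteq> {lo..<hi}" "T' \<subseteq> {lo..<hi}"
    "card S' \<le> k + 1" "card T' \<le> k + 1" "sum c S + sum c T = sum c S' + sum (c :: nat \<Rightarrow> nat) T'"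
proof -
  have fin: "finite S" "finite T" using assms finite_subset by blast+
  define d where "d p = int (card (S \<inter> {..<p})) - int (card (T \<inter> {..<p}))" for p
  have d_Suc: "d (Suc p) = d p + of_bool (p \<in> S) - of_bool (p \<in> T)" for p
    unfolding d_def using fin by (simp add: card_Int_lessThan_Suc)
  have "S \<inter> {..<hi} = S" "T \<inter> {..<hi} = T" using assms by auto
  then have "d hi \<le> - 2" unfolding d_def using assms by simp
  then have ex: "\<exists>p. d p \<le> - 2" by blast
  \<comment> \<open>The balance \<open>d\<close> changes by at most 1 per position. So the first
    place where it is at most \<open>-2\<close> comes right after a position \<open>p\<close> with
    balance \<open>-1\<close> that belongs to \<open>T\<close> only.\<close>
  define q where "q = (LEAST p. d p \<le> - 2)"
  have q: "d q \<le> - 2" unfolding q_def by (rule LeastI_ex[OF ex])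
  have less: "d p > - 2" if "p < q" for p using not_less_Least that unfolding q_def by fastforce
  have "q \<noteq> 0" using q by (cases q) (auto simp: d_def)
  then obtain p where p: "q = Suc p" by (cases q) auto
  have dp: "d p = - 1" "p \<in> T" "p \<notin> S"
    using d_Suc[of p] less[of p] q p by (auto simp: of_bool_def split: if_splits)
  \<comment> \<open>Independence keeps \<open>p - 1\<close> out of \<open>T\<close>; if it were in
    \<open>S\<close>, the balance would have been \<open>-2\<close> already before
    \<open>p - 1\<close>.\<close>
  have prev: "\<not> (p' \<in> S \<and> p = Suc p')" for p'
    using d_Suc[of p'] less[of p'] p dp assms(2) unfolding indep_def by auto
  \<comment> \<open>The cut is before \<open>p\<close>, where \<open>T\<close> is ahead by exactly
    one. Hence \<open>card S' = card T - 1\<close> and \<open>card T' = card S + 1\<close>.\<close>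
  define S' where "S' = S \<inter> {..<p} \<union> T \<inter> {p..}"
  define T' where "T' = T \<inter> {..<p} \<union> S \<inter> {p..}"
  have mem: "i \<in> S' \<longleftrightarrow> (if i < p then i \<in> S else i \<in> T)" "i \<in> T' \<longleftrightarrow> (if i < p then i \<in> T else i \<in> S)"
      for i
    unfolding S'_def T'_def by auto
  have "Suc i \<notin> S'" if "i \<in> S'" for i
  proof (cases "Suc i = p")
    case True then show ?thesis using that prev[of i] by (simp add: mem)
  next
    case False
    then have "i < p \<longleftrightarrow> Suc i < p" by linarith
    then show ?thesis using that assms(1,2) by (simp add: mem indep_def split: if_splits)
  qed
  then have "indep S'" unfolding indep_def by blast
  moreover have "Suc i \<notin> T'" if "i \<in> T'" for i
  proof (cases "Suc i = p")
    case True then show ?thesis using that dp by (auto simp: mem)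
  next
    case False
    then have "i < p \<longleftrightarrow> Suc i < p" by linarith
    then show ?thesis using that assms(1,2) by (simp add: mem indep_def split: if_splits)
  qed
  then have "indep T'" unfolding indep_def by blast
  moreover have "S' \<subseteq> {lo..<hi}" "T' \<subseteq> {lo..<hi}" unfolding S'_def T'_def using assms by auto
  moreover have "card S' \<le> k + 1" "card T' \<le> k + 1"
  proof -
    have "card S' = card (S \<inter> {..<p}) + card (T \<inter> {p..})"
        "card T' = card (T \<inter> {..<p}) + card (S \<inter> {p..})"
      unfolding S'_def T'_def using fin by (auto intro!: card_Un_disjoint)
    then show "card S' \<le> k + 1" "card T' \<le> k + 1"
      using dp(1) card_split[OF fin(1), of p] card_split[OF fin(2), of p] assms(5,6)
      unfolding d_def by linarith+
  qed
  moreover have "sum c S + sum c T = sum c S' + sum c T'"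
  proof -
    have "sum c S' = sum c (S \<inter> {..<p}) + sum c (T \<inter> {p..})"
        "sum c T' = sum c (T \<inter> {..<p}) + sum c (S \<inter> {p..})"
      unfolding S'_def T'_def using fin by (auto intro!: sum.union_disjoint)
    then show ?thesis using sum_split[OF fin(1), of c p] sum_split[OF fin(2), of c p] by simp
  qed
  ultimately show ?thesis using that by blast
qed

text \<open>An optimal set for \<open>k + 2\<close> with fewer elements is already admissible for
  the middle term; only one of full size calls for the exchange.\<close>

lemma best_sum_concave:
  "best_sum c lo hi (k + 2) + best_sum c lo hi k \<le> 2 * best_sum c lo hi (k + 1)"
proof -
  obtain S where S: "S \<subseteq> {lo..<hi}" "indep S" "card S \<le> k" "best_sum c lo hi k = sum c S"
    by (rule best_sum_attained)
  obtain T where T: "T \<subseteq> {lo..<hi}" "indep T" "card T \<le> k + 2" "best_sum c lo hi (k + 2) = sum c T"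
    by (rule best_sum_attained)
  show ?thesis
  proof (cases "card T \<le> k + 1")
    case True
    then have "sum c T \<le> best_sum c lo hi (k + 1)" "sum c S \<le> best_sum c lo hi (k + 1)"
      using S T by (auto intro!: best_sum_ge)
    then show ?thesis using S T by simp
  next
    case False
    then have "card T = k + 2" using T by simp
    from exchange_tails[OF S(2) T(2) S(1) T(1) S(3) this, of c] obtain S' T' where
      "indep S'" "indep T'" "S' \<subseteq> {lo..<hi}" "T' \<subseteq> {lo..<hi}"
      "card S' \<le> k + 1" "card T' \<le> k + 1" "sum c S + sum c T = sum c S' + sum c T'" .
    moreover from this have "sum c S' \<le> best_sum c lo hi (k + 1)"
        "sum c T' \<le> best_sum c lo hi (k + 1)"
      by (auto intro!: best_sum_ge)
    ultimately show ?thesis using S T by simp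
  qed
qed

section \<open>Gains and balanced splits\<close>

definition gain :: "(nat \<Rightarrow> nat) \<Rightarrow> nat \<Rightarrow> nat \<Rightarrow> nat \<Rightarrow> nat" where
  "gain c lo hi t = best_sum c lo hi (Suc t) - best_sum c lo hi t"

lemma best_sum_Suc: "best_sum c lo hi (Suc t) = best_sum c lo hi t + gain c lo hi t"
  unfolding gain_def using best_sum_mono[of t "Suc t"] by simp

lemma best_sum_eq_gains: "best_sum c lo hi k = (\<Sum>t<k. gain c lo hi t)"
  by (induction k) (simp_all add: best_sum_Suc)

lemma gain_antimono: "antimono (gain c lo hi)"
proof (rule decseq_SucI)
  fix t show "gain c lo hi (Suc t) \<le> gain c lo hi t"
    using best_sum_concave[of c lo hi t] by (simp add: best_sum_Suc)
qed

lemma gain_eq_0: "hi - lo \<le> t \<Longrightarrow> gain c lo hi t = 0"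
  by (simp add: gain_def best_sum_saturated)

text \<open>The condition under which the \<open>i\<close> largest gains \<open>f\<close> and the \<open>j\<close> largest gains \<open>g\<close> are
  together the \<open>i + j\<close> largest ones.\<close>

definition balanced :: "(nat \<Rightarrow> nat) \<Rightarrow> (nat \<Rightarrow> nat) \<Rightarrow> nat \<Rightarrow> nat \<Rightarrow> bool" where
  "balanced f g i j \<longleftrightarrow> (\<forall>i'. i = Suc i' \<longrightarrow> g j \<le> f i') \<and> (\<forall>j'. j = Suc j' \<longrightarrow> f i \<le> g j')"

lemma balanced_0: "balanced f g 0 0"
  by (simp add: balanced_def)

text \<open>The comparison gives the condition for the entry just taken; monotonicity preserves the
  condition for the last entry taken from the other sequence.\<close>

lemma balanced_step:
  assumes "antimono f" "antimono g" "balanced f g i j"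
  shows "f i < g j \<Longrightarrow> balanced f g i (Suc j)" "\<not> f i < g j \<Longrightarrow> balanced f g (Suc i) j"
  using assms antimonoD[OF assms(1), of i "Suc i"] antimonoD[OF assms(2), of j "Suc j"]
  unfolding balanced_def by (auto intro: order_trans)

lemma balanced_sym: "balanced f g i j \<longleftrightarrow> balanced g f j i"
  unfolding balanced_def by blast

lemma sum_lessThan_add: "(\<Sum>t<i + d. f t) = (\<Sum>t<i. f t) + (\<Sum>t<d. f (i + t))"
  for f :: "nat \<Rightarrow> nat"
  by (induction d) auto

text \<open>The \<open>d\<close> entries of \<open>f\<close> gained by the other split are at most
  \<open>f i\<close>, the \<open>d\<close> entries of \<open>g\<close> it gives up are at least
  \<open>g (j + d - 1)\<close>, and balance compares these two.\<close>

lemma balanced_optimal_aux: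
  fixes f g :: "nat \<Rightarrow> nat"
  assumes "antimono f" "antimono g" "balanced f g i (j + d)"
  shows "(\<Sum>t<i + d. f t) + (\<Sum>t<j. g t) \<le> (\<Sum>t<i. f t) + (\<Sum>t<j + d. g t)"
proof -
  have "f (i + t) \<le> g (j + t)" if td: "t < d" for t
  proof -
    obtain d' where "d = Suc d'" using td by (cases d) auto
    then have "f i \<le> g (j + d')" using assms(3) unfolding balanced_def by simp
    moreover have "f (i + t) \<le> f i" using assms(1) by (simp add: antimonoD)
    moreover have "g (j + d') \<le> g (j + t)" using assms(2) td \<open>d = Suc d'\<close> by (simp add: antimonoD)
    ultimately show ?thesis by linarith
  qed
  then have "(\<Sum>t<d. f (i + t)) \<le> (\<Sum>t<d. g (j + t))" by (intro sum_mono) auto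
  then show ?thesis by (simp add: sum_lessThan_add)
qed

lemma balanced_optimal:
  fixes f g :: "nat \<Rightarrow> nat"
  assumes "antimono f" "antimono g" "balanced f g i j" "i + j = i' + j'"
  shows "(\<Sum>t<i'. f t) + (\<Sum>t<j'. g t) \<le> (\<Sum>t<i. f t) + (\<Sum>t<j. g t)"
proof (cases "i \<le> i'")
  case True
  then obtain d where "i' = i + d" using le_Suc_ex by blast
  moreover from this have "j = j' + d" using assms(4) by simp
  ultimately show ?thesis using balanced_optimal_aux[OF assms(1,2), of i j' d] assms(3) by simp
next
  case False
  then obtain d where "i = i' + d" using le_Suc_ex[of i' i] by auto
  moreover from this have "j' = j + d" using assms(4) by simp
  ultimately show ?thesis using balanced_optimal_aux[OF assms(2,1), of j i' d] assms(3)
    by (simp add: balanced_sym[of f])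
qed

text \<open>In both alternatives at least one position separates the two sets (\<open>m\<close> in
  the first, \<open>m - 1\<close> in the second), so their union is independent.\<close>

lemma best_sum_split_ge:
  assumes "lo \<le> m" "m \<le> hi" "mid \<le> m" "indep S \<and> indep T \<and> card S \<le> i \<and> card T \<le> j"
    "S \<subseteq> {lo..<mid}" "T \<subseteq> {Suc m..<hi} \<or> (mid < m \<and> T \<subseteq> {m..<hi})"
  shows "sum c S + sum c T \<le> best_sum c lo hi (i + j)"
proof -
  have fin: "finite S" "finite T" using assms(5,6) finite_subset by blast+
  have "indep (S \<union> T)" unfolding indep_def
  proof
    fix s assume "s \<in> S \<union> T"
    then show "Suc s \<notin> S \<union> T" using assms(3-6) unfolding indep_def by force
  qed
  moreover have "card (S \<union> T) \<le> i + j" using card_Un_le[of S T] assms(4) by linarith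
  moreover have "S \<union> T \<subseteq> {lo..<hi}" using assms by force
  ultimately have "sum c (S \<union> T) \<le> best_sum c lo hi (i + j)" by (intro best_sum_ge)
  moreover have "S \<inter> T = {}" using assms by force
  ultimately show ?thesis using fin by (simp add: sum.union_disjoint)
qed

text \<open>A selection avoids \<open>m\<close>, or contains \<open>m\<close> and therefore avoids
  \<open>m - 1\<close>. In either case the parts are independent of each other, and a balanced split
  is optimal among all ways to divide the budget \<open>k\<close>.\<close>

lemma best_sum_split:
  assumes "lo \<le> m" "m \<le> hi" "0 < m"
    and b1: "balanced (gain c lo m) (gain c (Suc m) hi) i1 j1"
        and b2: "balanced (gain c lo (m - 1)) (gain c m hi) i2 j2"
    and k: "i1 + j1 = k" "i2 + j2 = k"
  shows "best_sum c lo hi k = max (best_sum c lo m i1 + best_sum c (Suc m) hi j1)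
    (best_sum c lo (m - 1) i2 + best_sum c m hi j2)"
proof (rule antisym)
  have o1: "best_sum c lo m i + best_sum c (Suc m) hi j \<le> best_sum c lo m i1 + best_sum c (Suc m) hi
      j1"
    if "i + j = k" for i j
    using balanced_optimal[OF gain_antimono gain_antimono b1, of i j] that k
        by (simp add: best_sum_eq_gains)
  have o2: "best_sum c lo (m - 1) i + best_sum c m hi j \<le> best_sum c lo (m - 1) i2 + best_sum c m hi
      j2"
    if "i + j = k" for i j
    using balanced_optimal[OF gain_antimono gain_antimono b2, of i j] that k
        by (simp add: best_sum_eq_gains)
  show "best_sum c lo hi k \<le> max (best_sum c lo m i1 + best_sum c (Suc m) hi j1)
    (best_sum c lo (m - 1) i2 + best_sum c m hi j2)"
  proof (rule best_sum_leI)
    fix S assume S: "S \<subseteq> {lo..<hi}" "indep S" "card S \<le> k"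
    then have fin: "finite S" using finite_subset by blast
    let ?L = "S \<inter> {..<m}" and ?R = "S \<inter> {m..}"
    have card: "card ?L + card ?R \<le> k" using card_split[OF fin, of m] S(3) by simp
    \<comment> \<open>The right part receives the whole remaining budget, so that the two budgets
      add up to exactly \<open>k\<close>, as the optimality of balanced splits demands.\<close>
    define j where "j = k - card ?L"
    have j: "card ?L + j = k" "card ?R \<le> j" using card unfolding j_def by simp_all
    have ind: "indep ?L" "indep ?R" using S(2) indep_subset by blast+
    have eq: "sum c S = sum c ?L + sum c ?R" by (rule sum_split[OF fin])
    show "sum c S \<le> max (best_sum c lo m i1 + best_sum c (Suc m) hi j1)
      (best_sum c lo (m - 1) i2 + best_sum c m hi j2)"
    proof (cases "m \<in> S")
      case False
      have "sum c ?L \<le> best_sum c lo m (card ?L)" using S ind by (intro best_sum_ge) auto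
      moreover have "sum c ?R \<le> best_sum c (Suc m) hi j"
        using S ind j False by (intro best_sum_ge) (auto simp: Suc_le_eq order_less_le)
      ultimately show ?thesis using o1[OF j(1)] eq by linarith
    next
      case True
      then have "m - 1 \<notin> S" using S(2) \<open>0 < m\<close> unfolding indep_def by (metis Suc_pred')
      have "?L \<subseteq> {lo..<m - 1}"
      proof
        fix s assume "s \<in> ?L"
        with \<open>m - 1 \<notin> S\<close> have "s \<noteq> m - 1" "s < m" "lo \<le> s" using S(1) by auto
        then show "s \<in> {lo..<m - 1}" by auto
      qed
      then have "sum c ?L \<le> best_sum c lo (m - 1) (card ?L)" using ind by (intro best_sum_ge) auto
      moreover have "sum c ?R \<le> best_sum c m hi j"
        using S ind j by (intro best_sum_ge) auto
      ultimately show ?thesis using o2[OF j(1)] eq by linarith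
    qed
  qed
  have "best_sum c lo m i1 + best_sum c (Suc m) hi j1 \<le> best_sum c lo hi k"
  proof -
    obtain S where S: "S \<subseteq> {lo..<m}" "indep S" "card S \<le> i1" "best_sum c lo m i1 = sum c S"
      by (rule best_sum_attained)
    obtain T where T: "T \<subseteq> {Suc m..<hi}" "indep T" "card T \<le> j1"
        "best_sum c (Suc m) hi j1 = sum c T"
      by (rule best_sum_attained)
    show ?thesis
      using best_sum_split_ge[of lo m hi m S T i1 j1 c] S T assms(1,2) k by simp
  qed
  moreover have "best_sum c lo (m - 1) i2 + best_sum c m hi j2 \<le> best_sum c lo hi k"
  proof -
    obtain S where S: "S \<subseteq> {lo..<m - 1}" "indep S" "card S \<le> i2"
        "best_sum c lo (m - 1) i2 = sum c S"
      by (rule best_sum_attained)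
    obtain T where T: "T \<subseteq> {m..<hi}" "indep T" "card T \<le> j2" "best_sum c m hi j2 = sum c T"
      by (rule best_sum_attained)
    show ?thesis
      using best_sum_split_ge[of lo m hi "m - 1" S T i2 j2 c] S T assms(1-3) k by simp
  qed
  ultimately show "max (best_sum c lo m i1 + best_sum c (Suc m) hi j1)
    (best_sum c lo (m - 1) i2 + best_sum c m hi j2) \<le> best_sum c lo hi k" by simp
qed

section \<open>Removal of runs\<close>

lemma sum_vimage_Suc:
  fixes f :: "nat \<Rightarrow> nat"
  assumes fin: "finite S"
  shows "sum f S = of_bool (0 \<in> S) * f 0 + (\<Sum>i\<in>Suc -` S. f (Suc i))"
proof -
  have "S = (if 0 \<in> S then {0} else {}) \<union> Suc ` (Suc -` S)"
  proof (rule set_eqI)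
    fix i show "i \<in> S \<longleftrightarrow> i \<in> (if 0 \<in> S then {0} else {}) \<union> Suc ` (Suc -` S)"
      by (cases i) auto
  qed
  then have "sum f S = sum f ((if 0 \<in> S then {0} else {}) \<union> Suc ` (Suc -` S))" by simp
  also have "\<dots> = sum f (if 0 \<in> S then {0} else {}) + sum f (Suc ` (Suc -` S))"
    using fin by (intro sum.union_disjoint) auto
  also have "sum f (Suc ` (Suc -` S)) = (\<Sum>i\<in>Suc -` S. f (Suc i))"
    by (rule sum.reindex_cong[of Suc]) auto
  finally show ?thesis by auto
qed

lemma card_vimage_Suc: "finite S \<Longrightarrow> card S = of_bool (0 \<in> S) + card (Suc -` S)"
  using sum_vimage_Suc[of S "\<lambda>_. 1"] by simp

lemma indep_vimage_Suc: "indep S \<Longrightarrow> indep (Suc -` S)"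
  unfolding indep_def by auto

text \<open>The equation says that the strings have equally many runs after removal: an inner run of
  \<open>S\<close> takes two, the last run only one, and \<open>t = 1\<close> removes the last run
  of \<open>ys\<close>. The induction works from the front: if run 1 is in \<open>S\<close>, it is
  skipped and its neighbours merge; otherwise the two first runs are paired.\<close>

lemma warp_of_set:
  assumes "indep S" "S \<subseteq> {1..<length xs}" "t \<le> 1" "t = 1 \<Longrightarrow> length xs - 1 \<notin> S" "xs \<noteq> []"
    "length xs + t + of_bool (length xs - 1 \<in> S) = length ys + 2 * card S"
  shows "warp False xs ys ((\<Sum>i\<in>S. xs ! i) + t * last ys)"
  using assms
proof (induction xs arbitrary: S ys rule: length_induct)
  case (1 xs)
  have fin: "finite S" using "1.prems"(2) finite_subset by blast
  \<comment> \<open>With this bound the run-count equation forces \<open>ys\<close> to be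
    nonempty.\<close>
  have card_end: "2 * card S \<le> length xs - 1 + of_bool (length xs - 1 \<in> S)"
  proof (cases "length xs - 1 \<in> S")
    case True
    then have "1 < length xs" using "1.prems"(2) by auto
    then show ?thesis using indep_card[OF "1.prems"(1,2)] True by auto
  next
    case False
    have "S \<subseteq> {1..<length xs - 1}"
    proof
      fix i assume "i \<in> S"
      then have "i \<noteq> length xs - 1" "1 \<le> i" "i < length xs" using False "1.prems"(2) by auto
      then show "i \<in> {1..<length xs - 1}" by auto
    qed
    then show ?thesis using indep_card[OF "1.prems"(1), of 1 "length xs - 1"] False
      by (cases "length xs > 2") auto
  qed
  obtain x xs' where xs: "xs = x # xs'" using "1.prems"(5) by (cases xs) auto
  have "ys \<noteq> []" using card_end "1.prems"(6) xs by auto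
  then obtain y ys' where ys: "ys = y # ys'" by (cases ys) auto
  show ?case
  proof (cases xs')
    case Nil
    then have "S = {}" using "1.prems"(2) xs by auto
    then have "t = 0 \<and> ys' = [] \<or> t = 1 \<and> (\<exists>z. ys' = [z])"
      using "1.prems"(3,6) xs Nil ys by (cases ys') (auto simp: le_Suc_eq)
    then show ?thesis using \<open>S = {}\<close> xs Nil ys by (auto intro: warp.stop warp.last2)
  next
    case (Cons z zs)
    have 0: "0 \<notin> S" using "1.prems"(2) by auto
    let ?S = "Suc -` S"
    have fin': "finite ?S" using fin by (simp add: finite_vimageI)
    have cS: "card S = card ?S" "(\<Sum>i\<in>S. xs ! i) = (\<Sum>i\<in>?S. xs' ! i)"
      using card_vimage_Suc[OF fin] sum_vimage_Suc[OF fin] 0 xs by auto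
    have mem: "length xs - 1 \<in> S \<longleftrightarrow> length zs \<in> ?S" using xs Cons by simp
    show ?thesis
    proof (cases "1 \<in> S")
      case True
      let ?T = "Suc -` ?S"
      have cT: "card ?S = Suc (card ?T)" "(\<Sum>i\<in>?S. xs' ! i) = z + (\<Sum>i\<in>?T. zs ! i)"
        using card_vimage_Suc[OF fin'] sum_vimage_Suc[OF fin'] True Cons by auto
      show ?thesis
      proof (cases zs)
        case Nil
        then have "?T = {}" using "1.prems"(2) xs Cons by auto
        moreover have "t = 0" using "1.prems"(3,4) True Nil Cons xs by (cases "t = 1") auto
        ultimately have "ys' = []" using "1.prems"(6) cS cT mem True Nil ys xs Cons by auto
        then show ?thesis using xs Cons Nil ys cS cT \<open>?T = {}\<close> \<open>t = 0\<close> by (simp add: warp.last1)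
      next
        case (Cons w ws)
        have "2 \<notin> S" using True "1.prems"(1) unfolding indep_def by (metis One_nat_def Suc_1)
        have T: "indep ?T" "?T \<subseteq> {1..<length zs}"
        proof -
          show "indep ?T" using "1.prems"(1) by (intro indep_vimage_Suc)
          show "?T \<subseteq> {1..<length zs}"
          proof
            fix i assume "i \<in> ?T"
            then have "Suc (Suc i) \<in> S" by simp
            moreover from this have "i \<noteq> 0" using \<open>2 \<notin> S\<close> by (cases i) (auto simp: numeral_2_eq_2)
            ultimately show "i \<in> {1..<length zs}" using "1.prems"(2) xs \<open>xs' = z # zs\<close> by auto
          qed
        qed
        have "length zs \<in> ?S \<longleftrightarrow> length zs - 1 \<in> ?T" using Cons by simp
        then have "warp False zs ys ((\<Sum>i\<in>?T. zs ! i) + t * last ys)"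
          using "1.prems" mem xs \<open>xs' = z # zs\<close> cS cT Cons
          by (intro "1.IH"[rule_format] T) auto
        then have "warp False xs ys ((\<Sum>i\<in>?T. zs ! i) + t * last ys + z)"
          using warp.skip1[of w ws ys _ x z] xs \<open>xs' = z # zs\<close> Cons by simp
        then show ?thesis using cS cT by (simp add: ac_simps)
      qed
    next
      case False
      have S: "indep ?S" "?S \<subseteq> {1..<length xs'}"
      proof -
        show "indep ?S" using "1.prems"(1) by (intro indep_vimage_Suc)
        show "?S \<subseteq> {1..<length xs'}"
        proof
          fix i assume "i \<in> ?S"
          then have "Suc i \<in> S" by simp
          moreover from this have "i \<noteq> 0" using False by (cases i) auto
          ultimately show "i \<in> {1..<length xs'}" using "1.prems"(2) xs by auto
        qed
      qed
      \<comment> \<open>As run 1 stays, the equation leaves \<open>ys\<close> at least two runs. So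
        \<open>ys'\<close> is nonempty and has the same last run.\<close>
      have c2: "2 * card S + 2 \<le> length xs + of_bool (length xs - 1 \<in> S)"
      proof -
        let ?b = "length xs - 1 + of_bool (length xs - 1 \<in> S)"
        have sub: "S \<subseteq> {2..<?b}"
        proof
          fix i assume i: "i \<in> S"
          then have "i \<noteq> length xs - 1 \<or> length xs - 1 \<in> S" "1 \<le> i" "i \<noteq> 1" "i < length xs"
            using False "1.prems"(2) by auto
          then show "i \<in> {2..<?b}" by auto
        qed
        have "2 \<le> length xs" using xs Cons by simp
        show ?thesis
        proof (cases "S = {}")
          case False
          then obtain i where "i \<in> S" by blast
          then have "2 < ?b" using sub by fastforce
          then show ?thesis using indep_card[OF "1.prems"(1) sub] \<open>2 \<le> length xs\<close> by linarith
        qed (use \<open>2 \<le> length xs\<close> in simp)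
      qed
      have "ys' \<noteq> []" using c2 "1.prems"(6) ys by auto
      moreover have "warp False xs' ys' ((\<Sum>i\<in>?S. xs' ! i) + t * last ys')"
        using "1.prems" mem xs Cons cS ys by (intro "1.IH"[rule_format] S) auto
      ultimately show ?thesis
        using warp.both[of xs' ys' _ x y] xs ys cS by simp
    qed
  qed
qed

text \<open>\<open>S\<close> and \<open>T\<close> are the runs of the two strings that are matched against the wrong letter; \<open>d\<close>
  and \<open>e\<close> tell whether the first and the last letters of the strings differ. Removing an inner
  run merges its neighbours and thus lowers the number of runs by two.\<close>

definition removal :: "nat \<Rightarrow> nat \<Rightarrow> nat list \<Rightarrow> nat list \<Rightarrow> nat set \<Rightarrow> nat set \<Rightarrow> bool" where
  "removal d e xs ys S T \<longleftrightarrow> indep S \<and> indep T \<and> S \<subseteq> {..<length xs} \<and> T \<subseteq> {..<length ys} \<and>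
     (length xs < 2 \<longrightarrow> S = {}) \<and> (length ys < 2 \<longrightarrow> T = {}) \<and>
     of_bool (0 \<in> S) + of_bool (0 \<in> T) = d \<and>
     of_bool (length xs - 1 \<in> S) + of_bool (length ys - 1 \<in> T) = e \<and>
     length xs + 2 * card T + of_bool (0 \<in> S) + of_bool (length xs - 1 \<in> S) =
       length ys + 2 * card S + of_bool (0 \<in> T) + of_bool (length ys - 1 \<in> T)"

lemma removal_sym: "removal d e xs ys S T \<Longrightarrow> removal d e ys xs T S"
  unfolding removal_def by (auto simp: add.commute)

definition removal_cost :: "nat list \<Rightarrow> nat list \<Rightarrow> nat set \<Rightarrow> nat set \<Rightarrow> nat" where
  "removal_cost xs ys S T = (\<Sum>i\<in>S. xs ! i) + (\<Sum>i\<in>T. ys ! i)"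

lemma removal_cost_sym: "removal_cost xs ys S T = removal_cost ys xs T S"
  unfolding removal_cost_def by simp

lemma removal_finite: "removal d e xs ys S T \<Longrightarrow> finite S \<and> finite T"
  unfolding removal_def using finite_subset by blast

text \<open>Given \<open>d\<close> and the numbers of runs, this determines \<open>e\<close> among 0
  and 1, so the \<open>e\<close> read off a derivation is the one prescribed by the last
  letters.\<close>

lemma removal_parity: "removal d e xs ys S T \<Longrightarrow> even (length xs + length ys + d + e)"
proof -
  assume "removal d e xs ys S T"
  then have "length xs + length ys + d + e + 2 * card T =
      2 * (length ys + card S + of_bool (0 \<in> T) + of_bool (length ys - 1 \<in> T))"
    unfolding removal_def by (elim conjE, hypsubst) simp
  then show ?thesis by (metis dvd_add_left_iff dvd_triv_left)
qed

lemma indep_image_Suc: "indep S \<Longrightarrow> indep (Suc ` S)"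
  unfolding indep_def by auto

lemma removal_both:
  assumes r: "removal 0 e xs ys S T" and ne: "xs \<noteq> []" "ys \<noteq> []"
  shows "removal 0 e (x # xs) (y # ys) (Suc ` S) (Suc ` T) \<and>
    removal_cost (x # xs) (y # ys) (Suc ` S) (Suc ` T) = removal_cost xs ys S T"
proof -
  have m: "length xs \<in> Suc ` S \<longleftrightarrow> length xs - 1 \<in> S" "length ys \<in> Suc ` T \<longleftrightarrow> length ys - 1 \<in> T"
    using ne by (cases xs; cases ys; auto)+
  have "card (Suc ` S) = card S" "card (Suc ` T) = card T" by (simp_all add: card_image)
  then show ?thesis using r ne m
    by (auto simp: removal_def removal_cost_def indep_image_Suc sum.reindex)
qed

text \<open>\<open>d = 0\<close> keeps \<open>0\<close> out of \<open>S\<close>. After the shift by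
  two, position 2 is therefore free, and inserting 1 preserves independence.\<close>

lemma removal_skip:
  assumes r: "removal 0 e (x' # xs) ys S T"
  shows "\<exists>S'. removal 0 e (x # z # x' # xs) ys S' T \<and>
    removal_cost (x # z # x' # xs) ys S' T = removal_cost (x' # xs) ys S T + z"
proof -
  define S' where "S' = insert 1 (Suc ` Suc ` S)"
  have fin: "finite S" using removal_finite[OF r] by simp
  have 0: "0 \<notin> S" using r unfolding removal_def by (auto split: if_splits)
  then have ind: "indep S'" using r unfolding removal_def indep_def S'_def by auto
  have card: "card S' = Suc (card S)"
    unfolding S'_def using fin 0 by (subst card_insert_disjoint) (auto simp: card_image)
  have cost: "(\<Sum>i\<in>S'. (x # z # x' # xs) ! i) = z + (\<Sum>i\<in>S. (x' # xs) ! i)"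
    unfolding S'_def using fin 0 by (subst sum.insert) (auto simp: sum.reindex)
  have mem: "Suc (Suc (length xs)) \<in> S' \<longleftrightarrow> length xs \<in> S" "0 \<notin> S'" unfolding S'_def by auto
  have sub: "S' \<subseteq> {..<Suc (Suc (Suc (length xs)))}"
    using r unfolding removal_def S'_def by auto
  have "removal 0 e (x # z # x' # xs) ys S' T"
    using r ind mem sub card 0 unfolding removal_def by simp
  then show ?thesis using cost unfolding removal_cost_def by auto
qed

lemma warp_False_removal:
  assumes "warp False xs ys c"
  shows "\<exists>e\<le>1. \<exists>S T. removal 0 e xs ys S T \<and> removal_cost xs ys S T = c"
  using assms
proof (induction False xs ys c rule: warp.induct)
  case (stop x y)
  then show ?case by (intro exI[of _ 0] exI[of _ "{}"]) (simp add: removal_def removal_cost_def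
      indep_def)
next
  case (last1 x z y)
  have "removal 0 1 [x, z] [y] {1} {} \<and> removal_cost [x, z] [y] {1} {} = z"
    by (simp add: removal_def removal_cost_def indep_def)
  then show ?case by blast
next
  case (last2 x y z)
  have "removal 0 1 [x] [y, z] {} {1} \<and> removal_cost [x] [y, z] {} {1} = z"
    by (simp add: removal_def removal_cost_def indep_def)
  then show ?case by blast
next
  case (both xs ys c x y)
  then show ?case using removal_both warp_nonempty by metis
next
  case (skip1 x' xs ys c x z)
  then show ?case using removal_skip by metis
next
  case (skip2 xs y' ys c y z)
  then obtain e S T where "e \<le> 1" "removal 0 e xs (y' # ys) S T" "removal_cost xs (y' # ys) S T = c"
      by blast
  then show ?case using removal_skip[OF removal_sym, of e xs y' ys S T y z] removal_sym
      removal_cost_sym by metis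
qed simp_all

lemma removal_first:
  assumes r: "removal 0 e xs ys S T" and ne: "xs \<noteq> []"
  shows "\<exists>S'. removal 1 e (x # xs) ys S' T \<and>
    removal_cost (x # xs) ys S' T = removal_cost xs ys S T + x"
proof -
  define S' where "S' = insert 0 (Suc ` S)"
  have fin: "finite S" using removal_finite[OF r] by simp
  have 0: "0 \<notin> S" "0 \<notin> T" using r unfolding removal_def by (auto split: if_splits)
  then have ind: "indep S'" using r unfolding removal_def indep_def S'_def by auto
  have card: "card S' = Suc (card S)"
    unfolding S'_def using fin 0 by (subst card_insert_disjoint) (auto simp: card_image)
  have cost: "(\<Sum>i\<in>S'. (x # xs) ! i) = x + (\<Sum>i\<in>S. xs ! i)"
    unfolding S'_def using fin 0 by (subst sum.insert) (auto simp: sum.reindex)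
  have mem: "length xs \<in> S' \<longleftrightarrow> length xs - 1 \<in> S" "0 \<in> S'"
    unfolding S'_def using ne by (cases xs; auto)+
  have sub: "S' \<subseteq> {..<Suc (length xs)}"
    using r unfolding removal_def S'_def by auto
  have "removal 1 e (x # xs) ys S' T"
    using r ind mem sub card 0 ne unfolding removal_def by simp
  then show ?thesis using cost unfolding removal_cost_def by auto
qed

text \<open>The excluded case is that of \<open>clash\<close>, whose cost is a maximum and not a sum
  of removed runs.\<close>

lemma warp_removal:
  assumes "warp (d = 1) xs ys c" "d \<le> 1" "\<not> (d = 1 \<and> length xs = 1 \<and> length ys = 1)"
  shows "\<exists>e\<le>1. \<exists>S T. removal d e xs ys S T \<and> removal_cost xs ys S T = c"
proof (cases "d = 1")
  case False
  then show ?thesis using warp_False_removal assms by (metis One_nat_def le_SucE le_zero_eq)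
next
  case True
  with assms(1) have "warp True xs ys c" by simp
  then show ?thesis
  proof (cases rule: warp.cases)
    case (first1 xs' c' x)
    then show ?thesis using warp_False_removal removal_first warp_nonempty True by metis
  next
    case (first2 ys' c' y)
    then obtain e S T where "e \<le> 1" "removal 0 e xs ys' S T" "removal_cost xs ys' S T = c'"
        "ys' \<noteq> []"
      using warp_False_removal warp_nonempty by metis
    then show ?thesis using removal_first[OF removal_sym, of e xs ys' S T y] removal_sym
        removal_cost_sym first2 True
      by metis
  qed (use assms True in auto)
qed

text \<open>The weight \<open>W\<close> is so large that a heaviest selection of at most \<open>k\<close> items has exactly \<open>k\<close>
  elements. If the first letters differ, one of the two first runs is matched against the wrong
  letter: \<open>candidate\<close> charges for that of \<open>ys\<close>, and selecting item \<open>0\<close> means to exchange it for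
  that of \<open>xs\<close>. The last runs are treated in the same way.\<close>

definition item :: "nat \<Rightarrow> nat \<Rightarrow> nat \<Rightarrow> nat list \<Rightarrow> nat list \<Rightarrow> nat \<Rightarrow> nat" where
  "item W d e xs ys i =
     (let v = (if i < length xs then W - xs ! i else 0);
          v' = (if i = 0 then (v + hd ys) * d else v)
      in if i = length xs - 1 then (v' + last ys) * e else v')"

text \<open>If \<open>ys\<close> loses at most end runs, the run-count equation of
  \<open>removal\<close> reduces to \<open>length xs + d + e = length ys + 2 * card S\<close>. So
  the number of selected items is the same whichever string gives up its end runs.\<close>

definition excess :: "nat \<Rightarrow> nat \<Rightarrow> nat list \<Rightarrow> nat list \<Rightarrow> nat" where
  "excess d e xs ys = (length xs - length ys + d + e) div 2"

definition candidate :: "nat \<Rightarrow> nat \<Rightarrow> nat \<Rightarrow> nat list \<Rightarrow> nat list \<Rightarrow> nat" where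
  "candidate W d e xs ys = d * hd ys + e * last ys + excess d e xs ys * W -
     best_sum (item W d e xs ys) 0 (length xs) (excess d e xs ys)"

context
  fixes W d e :: nat and xs ys :: "nat list"
  assumes d: "d \<le> 1" and e: "e \<le> 1" and ne: "xs \<noteq> []" "ys \<noteq> []"
    and W: "\<And>i. i < length xs \<Longrightarrow> xs ! i \<le> W"
    and le: "length ys \<le> length xs" and single: "\<not> (length xs = 1 \<and> d = 1)"
    and parity: "even (length xs + length ys + d + e)"
begin

lemma excess_eq: "length xs + d + e = length ys + 2 * excess d e xs ys"
  unfolding excess_def using le parity by presburger

text \<open>Weight and length of a selected run add up to \<open>W\<close>; at an end where the
  letters differ, the run of \<open>ys\<close> that is now kept is credited on top.\<close>

lemma sum_items:
  assumes "S \<subseteq> {..<length xs}" "0 \<in> S \<Longrightarrow> d = 1" "length xs - 1 \<in> S \<Longrightarrow> e = 1"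
    "length xs < 2 \<Longrightarrow> S = {}"
  shows "sum (item W d e xs ys) S + (\<Sum>i\<in>S. xs ! i) =
    card S * W + of_bool (0 \<in> S) * hd ys + of_bool (length xs - 1 \<in> S) * last ys"
proof -
  have fin: "finite S" using assms(1) finite_subset by blast
  have "sum (item W d e xs ys) S + (\<Sum>i\<in>S. xs ! i) = (\<Sum>i\<in>S. item W d e xs ys i + xs ! i)"
    by (simp add: sum.distrib)
  also have "\<dots> = (\<Sum>i\<in>S. W + (if i = 0 then hd ys else 0) + (if i = length xs - 1 then last ys else
      0))"
  proof (rule sum.cong)
    fix i assume i: "i \<in> S"
    then have "i < length xs" "2 \<le> length xs" using assms by force+
    then show "item W d e xs ys i + xs ! i = W + (if i = 0 then hd ys else 0) + (if i = length xs -
        1 then last ys else 0)"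
      using W[of i] assms(2,3) i by (auto simp: item_def Let_def)
  qed simp
  also have "\<dots> = card S * W + of_bool (0 \<in> S) * hd ys + of_bool (length xs - 1 \<in> S) * last ys"
    using fin by (simp add: sum.distrib sum.delta)
  finally show ?thesis .
qed

text \<open>A heaviest selection either has \<open>excess\<close> many elements and is then realised
  by a derivation, or it falls short and \<open>W\<close> makes it too expensive to matter.\<close>

lemma candidate_ge:
  assumes D: "\<And>c. warp (d = 1) xs ys c \<Longrightarrow> D \<le> c" and DW: "D \<le> W"
  shows "D \<le> candidate W d e xs ys"
proof -
  let ?k = "excess d e xs ys" and ?p = "length xs" and ?item = "item W d e xs ys"
  obtain S where S: "S \<subseteq> {0..<?p}" "indep S" "card S \<le> ?k" "best_sum ?item 0 ?p ?k = sum ?item S"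
    by (rule best_sum_attained)
  \<comment> \<open>End items have weight 0 where the letters agree; dropping them changes no
    sum.\<close>
  define S' where "S' = {i \<in> S. (i = 0 \<longrightarrow> d = 1) \<and> (i = ?p - 1 \<longrightarrow> e = 1)}"
  have fin: "finite S" using S(1) finite_subset by blast
  have S': "S' \<subseteq> {..<?p}" "0 \<in> S' \<Longrightarrow> d = 1" "?p - 1 \<in> S' \<Longrightarrow> e = 1" "indep S'" "S' \<subseteq> S"
    using S indep_subset[OF S(2)] unfolding S'_def by auto
  have empty: "S' = {}" if p2: "?p < 2"
  proof -
    have "?p = 1" using p2 ne(1) by (cases xs) auto
    then show ?thesis using S'(1,2) single by auto
  qed
  have fin': "finite S'" using fin S'(5) finite_subset by blast
  \<comment> \<open>A single run is first and last at once, and the factor for the last position is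
    applied last. Parity forces \<open>e = 0\<close>, so its item has weight 0 as well.\<close>
  have e0: "e = 0" if p1: "?p = 1"
  proof -
    have "d = 0" "length ys = 1" using p1 single d le ne(2) by (cases ys; auto)+
    then show ?thesis using parity p1 e by (auto simp: le_Suc_eq)
  qed
  have "item W d e xs ys i = 0" if "i \<in> S - S'" for i
    using that d e e0 S(1) unfolding S'_def item_def Let_def by (auto simp: le_Suc_eq)
  then have sum_eq: "sum ?item S = sum ?item S'"
    using S'(5) fin by (intro sum.mono_neutral_right) auto
  have card': "card S' \<le> ?k" using card_mono[OF fin S'(5)] S(3) by simp
  have si: "sum ?item S' + (\<Sum>i\<in>S'. xs ! i) =
      card S' * W + of_bool (0 \<in> S') * hd ys + of_bool (?p - 1 \<in> S') * last ys"
    using S'(1,2,3) empty by (intro sum_items) auto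
  have "D + sum ?item S' \<le> d * hd ys + e * last ys + ?k * W"
  proof (cases "card S' = ?k")
    case False
    \<comment> \<open>A missing element leaves a whole \<open>W\<close> unspent, and
      \<open>D \<le> W\<close>.\<close>
    then obtain k' where k': "?k = Suc k'" "card S' \<le> k'" using card' by (cases ?k) auto
    have "sum ?item S' \<le> card S' * W + d * hd ys + e * last ys"
      using si S'(2,3) by (auto simp: of_bool_def split: if_splits)
    moreover have "card S' * W \<le> k' * W" using k' by simp
    ultimately show ?thesis using DW unfolding k'(1) mult_Suc by linarith
  next
    case True
    let ?f = "of_bool (0 \<in> S') :: nat" and ?l = "of_bool (?p - 1 \<in> S') :: nat"
    have fd: "?f \<le> d" "?l \<le> e" using S'(2,3) by auto
    have "warp (d = 1) xs ys ((\<Sum>i\<in>S'. xs ! i) + (e - ?l) * last ys + (d - ?f) * hd ys)"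
    proof (cases "d = 1 \<and> 0 \<in> S'")
      case True
      \<comment> \<open>The first run of \<open>xs\<close> is matched against the wrong letter. Run
        1 is then kept, so the shifted set avoids position 0 as \<open>warp_of_set\<close>
        requires.\<close>
      then have "1 \<notin> S'" using S'(4) unfolding indep_def by force
      obtain x xs' where xs: "xs = x # xs'" using ne by (cases xs) auto
      then have "xs' \<noteq> []" using single True by auto
      let ?S = "Suc -` S'"
      have cS: "card S' = Suc (card ?S)" "(\<Sum>i\<in>S'. xs ! i) = x + (\<Sum>i\<in>?S. xs' ! i)"
        using card_vimage_Suc[OF fin'] sum_vimage_Suc[OF fin'] xs True by auto
      have sub: "?S \<subseteq> {1..<length xs'}"
      proof
        fix i assume "i \<in> ?S"
        moreover from this have "i \<noteq> 0" using \<open>1 \<notin> S'\<close> by (cases i) auto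
        ultimately show "i \<in> {1..<length xs'}" using S'(1) xs by auto
      qed
      have l: "length xs' - 1 \<in> ?S \<longleftrightarrow> ?p - 1 \<in> S'" using xs \<open>xs' \<noteq> []\<close> by simp
      have "warp False xs' ys ((\<Sum>i\<in>?S. xs' ! i) + (e - ?l) * last ys)"
      proof (rule warp_of_set[OF indep_vimage_Suc[OF S'(4)] sub])
        show "length xs' + (e - ?l) + of_bool (length xs' - 1 \<in> ?S) = length ys + 2 * card ?S"
          unfolding l using excess_eq cS \<open>card S' = ?k\<close> xs True fd by auto
      qed (use e l \<open>xs' \<noteq> []\<close> in auto)
      from warp.first1[OF this, of x] show ?thesis using True xs cS by (simp add: ac_simps)
    next
      case nT: False
      then have "0 \<notin> S'" using S'(2) by auto
      then have sub: "S' \<subseteq> {1..<?p}"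
        using S'(1) by (auto simp: Suc_le_eq intro: gr0I)
      show ?thesis
      proof (cases "d = 1")
        case False
        then have "warp False xs ys ((\<Sum>i\<in>S'. xs ! i) + (e - ?l) * last ys)"
          using e ne fd d excess_eq \<open>card S' = ?k\<close> by (intro warp_of_set S' sub) auto
        then show ?thesis using False d by simp
      next
        case d1: True
        obtain y ys' where ys: "ys = y # ys'" using ne by (cases ys) auto
        have w: "warp False xs ys' ((\<Sum>i\<in>S'. xs ! i) + (e - ?l) * last ys')"
          using e ne fd d1 excess_eq \<open>card S' = ?k\<close> ys by (intro warp_of_set S' sub) auto
        then have "ys' \<noteq> []" using warp_nonempty by blast
        with warp.first2[OF w, of y] show ?thesis using d1 ys \<open>0 \<notin> S'\<close> by simp
      qed
    qed
    from D[OF this] have "D \<le> (\<Sum>i\<in>S'. xs ! i) + (e - ?l) * last ys + (d - ?f) * hd ys" .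
    moreover have "d * hd ys = (d - ?f) * hd ys + ?f * hd ys"
        "e * last ys = (e - ?l) * last ys + ?l * last ys"
      using fd by (simp_all flip: distrib_right)
    ultimately show ?thesis using si unfolding True by linarith
  qed
  then show ?thesis unfolding candidate_def S(4) sum_eq by linarith
qed

lemma candidate_le_removal:
  assumes r: "removal d e xs ys S T" and T: "T \<subseteq> {0, length ys - 1}"
  shows "candidate W d e xs ys \<le> removal_cost xs ys S T"
proof -
  let ?k = "excess d e xs ys" and ?p = "length xs" and ?q = "length ys"
  have S: "indep S" "S \<subseteq> {..<?p}" "?p < 2 \<Longrightarrow> S = {}" "T \<subseteq> {..<?q}" "?q < 2 \<Longrightarrow> T = {}"
    using r unfolding removal_def by auto
  have ends: "of_bool (0 \<in> S) + of_bool (0 \<in> T) = d"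
      "of_bool (?p - 1 \<in> S) + of_bool (?q - 1 \<in> T) = e"
    "?p + 2 * card T + of_bool (0 \<in> S) + of_bool (?p - 1 \<in> S) = ?q + 2 * card S + of_bool (0 \<in> T) +
        of_bool (?q - 1 \<in> T)"
    using r unfolding removal_def by auto
  have cT: "card T = of_bool (0 \<in> T) + of_bool (?q - 1 \<in> T) \<and>
      (\<Sum>i\<in>T. ys ! i) = of_bool (0 \<in> T) * hd ys + of_bool (?q - 1 \<in> T) * last ys"
  proof (cases "?q < 2")
    case False
    have "T = (if 0 \<in> T then {0} else {}) \<union> (if ?q - 1 \<in> T then {?q - 1} else {})" using T by auto
    then show ?thesis using False ne(2)
      by (cases "0 \<in> T"; cases "?q - 1 \<in> T") (simp_all add: hd_conv_nth last_conv_nth)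
  qed (use S(5) in simp)
  have "card S = ?k"
    using excess_eq ends cT by linarith
  then have "sum (item W d e xs ys) S \<le> best_sum (item W d e xs ys) 0 ?p ?k"
    using S by (intro best_sum_ge) auto
  moreover have "sum (item W d e xs ys) S + (\<Sum>i\<in>S. xs ! i) = card S * W + of_bool (0 \<in> S) * hd ys +
      of_bool (?p - 1 \<in> S) * last ys"
    using ends(1,2) d e S(2,3) by (intro sum_items) auto
  moreover have "d * hd ys = of_bool (0 \<in> S) * hd ys + of_bool (0 \<in> T) * hd ys"
    "e * last ys = of_bool (?p - 1 \<in> S) * last ys + of_bool (?q - 1 \<in> T) * last ys"
    unfolding ends(1,2)[symmetric] by (simp_all add: distrib_right)
  ultimately show ?thesis
    unfolding candidate_def removal_cost_def using cT \<open>card S = ?k\<close> by simp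
qed

end

text \<open>Restoring one inner run on each side takes 2 off both sides of the run-count equation
  and leaves the ends alone.\<close>

lemma removal_remove:
  assumes r: "removal d e xs ys S T" and i: "i \<in> S" "i \<noteq> 0" "i \<noteq> length xs - 1"
    and j: "j \<in> T" "j \<noteq> 0" "j \<noteq> length ys - 1"
  shows "removal d e xs ys (S - {i}) (T - {j})"
    "removal_cost xs ys (S - {i}) (T - {j}) \<le> removal_cost xs ys S T"
    "card (S - {i}) < card S"
proof -
  have fin: "finite S" "finite T" using removal_finite[OF r] by auto
  define S' T' where ST: "S' = S - {i}" "T' = T - {j}"
  have c: "card S = Suc (card S')" "card T = Suc (card T')"
    unfolding ST using card.remove[OF fin(1) i(1)] card.remove[OF fin(2) j(1)] by blast+
  show "card (S - {i}) < card S" using c(1) unfolding ST by linarith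
  have 1: "indep S'" "indep T'" using r indep_subset unfolding removal_def ST by blast+
  have 2: "S' \<subseteq> {..<length xs}" "T' \<subseteq> {..<length ys}" using r unfolding removal_def ST by auto
  have 3: "0 \<in> S' \<longleftrightarrow> 0 \<in> S" "0 \<in> T' \<longleftrightarrow> 0 \<in> T"
    "length xs - 1 \<in> S' \<longleftrightarrow> length xs - 1 \<in> S" "length ys - 1 \<in> T' \<longleftrightarrow> length ys - 1 \<in> T"
    using i j unfolding ST by auto
  have 4: "length xs < 2 \<longrightarrow> S' = {}" "length ys < 2 \<longrightarrow> T' = {}"
    using r unfolding removal_def ST by auto
  have "p + 2 * Suc t + a + b = q + 2 * Suc s + a' + b' \<Longrightarrow> p + 2 * t + a + b = q + 2 * s + a' + b'"
    for p t a b q s a' b' :: nat by simp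
  then have "removal d e xs ys S' T'"
    using r 1 2 4 unfolding removal_def 3 c by blast
  then show "removal d e xs ys (S - {i}) (T - {j})" unfolding ST .
  show "removal_cost xs ys (S - {i}) (T - {j}) \<le> removal_cost xs ys S T"
    unfolding removal_cost_def using fin by (intro add_mono sum_mono2) auto
qed

text \<open>Restoring an inner run of either string leaves a cheaper removal, so in an optimal one
  only one of the strings loses inner runs.\<close>

lemma removal_one_sided:
  assumes "removal d e xs ys S T" "removal_cost xs ys S T \<le> c"
  shows "\<exists>S T. removal d e xs ys S T \<and> removal_cost xs ys S T \<le> c \<and>
    (S \<subseteq> {0, length xs - 1} \<or> T \<subseteq> {0, length ys - 1})"
  using assms
proof (induction "card S" arbitrary: S T rule: less_induct)
  case less
  show ?case
  proof (cases "S \<subseteq> {0, length xs - 1} \<or> T \<subseteq> {0, length ys - 1}")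
    case False
    then obtain i j where "i \<in> S" "i \<noteq> 0" "i \<noteq> length xs - 1" "j \<in> T" "j \<noteq> 0" "j \<noteq> length ys - 1"
      by blast
    note rr = removal_remove[OF less.prems(1) this]
    show ?thesis using less.hyps[OF rr(3,1)] rr(2) less.prems(2) by simp
  qed (use less.prems in blast)
qed

text \<open>By one-sidedness, if \<open>ys\<close> loses an inner run, then \<open>xs\<close> loses
  only end runs, at most two. The run counts then give \<open>length xs \<le> length ys\<close>,
  hence a tie, and the removal is a candidate with the roles exchanged.\<close>

lemma candidate_le_warp:
  assumes d: "d \<le> 1" and e: "e \<le> 1" and ne: "xs \<noteq> []" "ys \<noteq> []"
    and W: "\<And>i. i < length xs \<Longrightarrow> xs ! i \<le> W" "\<And>i. i < length ys \<Longrightarrow> ys ! i \<le> W"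
    and le: "length ys \<le> length xs" and single: "\<not> (length xs = 1 \<and> d = 1)"
    and parity: "even (length xs + length ys + d + e)"
    and w: "warp (d = 1) xs ys c"
  shows "candidate W d e xs ys \<le> c \<or> length xs = length ys \<and> candidate W d e ys xs \<le> c"
proof -
  let ?p = "length xs" and ?q = "length ys"
  obtain e' S T where e': "e' \<le> 1" "removal d e' xs ys S T" "removal_cost xs ys S T = c"
    using warp_removal[OF w d] single by auto
  have "e' = e" using removal_parity[OF e'(2)] parity e e'(1) by (auto simp: le_Suc_eq)
  then obtain S T where r: "removal d e xs ys S T" "removal_cost xs ys S T \<le> c"
    "S \<subseteq> {0, ?p - 1} \<or> T \<subseteq> {0, ?q - 1}"
    using removal_one_sided[of d e xs ys S T c] e' by auto
  show ?thesis
  proof (cases "T \<subseteq> {0, ?q - 1}")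
    case True
    then show ?thesis
      using candidate_le_removal[OF d e ne W(1) le single parity r(1) True] r(2) by simp
  next
    case False
    then have S: "S \<subseteq> {0, ?p - 1}" using r(3) by blast
    obtain j where j: "j \<in> T" "j \<noteq> 0" "j \<noteq> ?q - 1" using False by blast
    have fin: "finite T" using removal_finite[OF r(1)] by simp
    have "?q \<ge> 2" using r(1) j(1) unfolding removal_def by (cases "?q < 2") auto
    have "card S \<le> of_bool (0 \<in> S) + of_bool (?p - 1 \<in> S)"
    proof -
      have "S = (if 0 \<in> S then {0} else {}) \<union> (if ?p - 1 \<in> S then {?p - 1} else {})" using S by auto
      then show ?thesis by (cases "0 \<in> S"; cases "?p - 1 \<in> S") (simp_all add: card_insert_if)
    qed
    moreover have "card T \<ge> 1 + of_bool (0 \<in> T) + of_bool (?q - 1 \<in> T)"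
    proof -
      let ?U = "{j} \<union> (if 0 \<in> T then {0} else {}) \<union> (if ?q - 1 \<in> T then {?q - 1} else {})"
      have "card ?U \<le> card T" using fin j by (intro card_mono) auto
      moreover have "card ?U = 1 + of_bool (0 \<in> T) + of_bool (?q - 1 \<in> T)"
        using j \<open>?q \<ge> 2\<close> by auto
      ultimately show ?thesis by simp
    qed
    moreover have "of_bool (0 \<in> S) + of_bool (0 \<in> T) = d"
        "of_bool (?p - 1 \<in> S) + of_bool (?q - 1 \<in> T) = e"
      "?p + 2 * card T + of_bool (0 \<in> S) + of_bool (?p - 1 \<in> S) = ?q + 2 * card S + of_bool (0 \<in> T)
          + of_bool (?q - 1 \<in> T)"
      using r(1) unfolding removal_def by auto
    ultimately have eq: "?p = ?q" using le d e by linarith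
    have "candidate W d e ys xs \<le> removal_cost ys xs T S"
      using candidate_le_removal[OF d e ne(2,1) W(2) _ _ _ removal_sym[OF r(1)] S] eq single parity
      by (simp add: add.commute)
    then show ?thesis using eq r(2) removal_cost_sym[of xs ys S T] by simp
  qed
qed

lemma snd_alt_runs: "i < length ks \<Longrightarrow> a \<le> 1 \<Longrightarrow> snd (alt_runs a ks ! i) = (if even i then a else 1 -
    a)"
  by (induction ks arbitrary: a i) (auto simp: nth_Cons split: nat.splits)

section \<open>The distance as the least admissible candidate\<close>

context
  fixes x y :: "nat list" and d e :: nat
  assumes x: "set x \<subseteq> {0, 1}" "x \<noteq> []" and y: "set y \<subseteq> {0, 1}" "y \<noteq> []"
    and d_def: "d = of_bool (snd (hd (rle x)) \<noteq> snd (hd (rle y)))"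
    and e_def: "e = of_bool (snd (last (rle x)) \<noteq> snd (last (rle y)))"
begin

text \<open>Letters alternate, so the last letter is the first one or its complement according to
  the parity of the number of runs. This gives the parity condition on \<open>d\<close> and
  \<open>e\<close>.\<close>

lemma letters:
  "snd (hd (rle x)) = hd x" "snd (hd (rle y)) = hd y"
      "even (length (rle x) + length (rle y) + d + e)"
proof -
  have h: "hd x \<in> {0, 1}" "hd y \<in> {0, 1}" using x y by (auto dest!: hd_in_set)
  have ne: "rle x \<noteq> []" "rle y \<noteq> []" using x y by simp_all
  have sx: "snd (rle x ! i) = (if even i then hd x else 1 - hd x)" if i: "i < length (rle x)" for i
  proof -
    have "snd (alt_runs (hd x) (run_lengths x) ! i) = (if even i then hd x else 1 - hd x)"
      using i h by (intro snd_alt_runs) auto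
    then show ?thesis using rle_binary[OF x(1)] by simp
  qed
  have sy: "snd (rle y ! i) = (if even i then hd y else 1 - hd y)" if i: "i < length (rle y)" for i
  proof -
    have "snd (alt_runs (hd y) (run_lengths y) ! i) = (if even i then hd y else 1 - hd y)"
      using i h by (intro snd_alt_runs) auto
    then show ?thesis using rle_binary[OF y(1)] by simp
  qed
  show hd: "snd (hd (rle x)) = hd x" "snd (hd (rle y)) = hd y"
    using sx[of 0] sy[of 0] ne by (simp_all add: hd_conv_nth)
  have last: "snd (last (rle x)) = (if odd (length (rle x)) then hd x else 1 - hd x)"
    "snd (last (rle y)) = (if odd (length (rle y)) then hd y else 1 - hd y)"
    using sx[of "length (rle x) - 1"] sy[of "length (rle y) - 1"] ne by (auto simp: last_conv_nth)
  show "even (length (rle x) + length (rle y) + d + e)"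
    unfolding d_def e_def hd last
    by (insert h, elim insertE emptyE; cases "odd (length (rle x))"; cases "odd (length (rle y))";
        simp)
qed

lemma dtw_single_runs:
  assumes "length (rle x) = 1" "length (rle y) = 1"
  shows "dtw x y = d * max (fst (hd (rle x))) (fst (hd (rle y)))"
proof -
  obtain k l where kl: "run_lengths x = [k]" "run_lengths y = [l]"
    using assms by (auto simp: length_Suc_conv)
  have "warp (hd x \<noteq> hd y) [k] [l] (d * max k l)"
    unfolding d_def letters(1,2) using warp.clash[of k l] warp.stop[of k l] by auto
  then have "dtw x y \<le> d * max k l" using dtw_le_warp[OF x y] kl by simp
  moreover obtain c where c: "c \<le> dtw x y" "warp (hd x \<noteq> hd y) [k] [l] c"
    using warp_le_dtw[OF x y] kl by auto
  have "d * max k l \<le> c"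
    using c(2) unfolding d_def letters(1,2) by (cases rule: warp.cases) (auto dest: warp_nonempty)
  moreover have "fst (hd (rle x)) = k" "fst (hd (rle y)) = l" using kl assms
    by (metis hd_map list.sel(1) list.map_disc_iff not_Cons_self2)+
  ultimately show ?thesis using c(1) by simp
qed

lemma length_eq_sum_run_lengths: "length x = sum_list (run_lengths x)"
    "length y = sum_list (run_lengths y)"
  using alt_run_lengths[OF x(1)] alt_run_lengths[OF y(1)] length_alt by metis+

text \<open>The form fits a program that takes the minimum of \<open>W\<close> and the candidates of
  all admissible orders: none falls below the distance, and one attains it.\<close>

lemma dtw_eq_candidate:
  defines "W \<equiv> length x + length y"
  assumes ns: "\<not> (length (rle x) = 1 \<and> length (rle y) = 1)"
  shows "length (rle y) \<le> length (rle x) \<Longrightarrow> dtw x y \<le> candidate W d e (run_lengths x) (run_lengths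
      y)"
    and "length (rle x) \<le> length (rle y) \<Longrightarrow> dtw x y \<le> candidate W d e (run_lengths y) (run_lengths
        x)"
    and "length (rle y) \<le> length (rle x) \<and> candidate W d e (run_lengths x) (run_lengths y) \<le> dtw x y
        \<or>
      length (rle x) \<le> length (rle y) \<and> candidate W d e (run_lengths y) (run_lengths x) \<le> dtw x y"
proof -
  let ?xs = "run_lengths x" and ?ys = "run_lengths y"
  have de: "d \<le> 1" "e \<le> 1" unfolding d_def e_def by auto
  have ne: "?xs \<noteq> []" "?ys \<noteq> []" using x y by simp_all
  have W: "?xs ! i \<le> W" if "i < length ?xs" for i
    unfolding W_def length_eq_sum_run_lengths using elem_le_sum_list[OF that] by linarith
  have W': "?ys ! i \<le> W" if "i < length ?ys" for i
    unfolding W_def length_eq_sum_run_lengths using elem_le_sum_list[OF that] by linarith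
  have d1: "d = 1 \<longleftrightarrow> hd x \<noteq> hd y" unfolding d_def letters by auto
  have par: "even (length ?xs + length ?ys + d + e)" using letters(3) by simp
  have par': "even (length ?ys + length ?xs + d + e)" using par by (simp add: add.commute)
  have lower: "dtw x y \<le> c" if "warp (d = 1) ?xs ?ys c" for c
    using dtw_le_warp[OF x y] that unfolding d1 by simp
  have DW: "dtw x y \<le> W" unfolding W_def by (rule dtw_le_length[OF x y])
  have len: "0 < length ?xs" "0 < length ?ys" using ne by (simp_all del: length_map)
  have lower': "dtw x y \<le> c" if "warp (d = 1) ?ys ?xs c" for c
    using lower warp_sym[OF that] by blast
  show "dtw x y \<le> candidate W d e ?xs ?ys" if le: "length (rle y) \<le> length (rle x)"
  proof -
    have "length ?ys \<le> length ?xs" "\<not> (length ?xs = 1 \<and> d = 1)" using le ns len unfolding length_map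
        by linarith+
    from candidate_ge[OF de ne W this par lower DW] show ?thesis by blast
  qed
  show "dtw x y \<le> candidate W d e ?ys ?xs" if le: "length (rle x) \<le> length (rle y)"
  proof -
    have "length ?xs \<le> length ?ys" "\<not> (length ?ys = 1 \<and> d = 1)" using le ns len unfolding length_map
        by linarith+
    from candidate_ge[OF de ne(2,1) W' this par' lower' DW] show ?thesis by blast
  qed
  obtain c where c: "c \<le> dtw x y" "warp (d = 1) ?xs ?ys c" using warp_le_dtw[OF x y] d1 by auto
  show "length (rle y) \<le> length (rle x) \<and> candidate W d e ?xs ?ys \<le> dtw x y \<or>
      length (rle x) \<le> length (rle y) \<and> candidate W d e ?ys ?xs \<le> dtw x y"
  proof (cases "length ?ys \<le> length ?xs")
    case True
    have "\<not> (length ?xs = 1 \<and> d = 1)" using True ns len unfolding length_map by linarith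
    from candidate_le_warp[OF de ne W W' True this par c(2)] show ?thesis using c(1) True by auto
  next
    case False
    then have le: "length ?xs \<le> length ?ys" by simp
    have "\<not> (length ?ys = 1 \<and> d = 1)" using le ns len unfolding length_map by linarith+
    from candidate_le_warp[OF de ne(2,1) W' W le this par' warp_sym[OF c(2)]] show ?thesis
        using c(1) le by auto
  qed
qed

end

section \<open>A structured language for the word RAM\<close>

datatype com =
    Skip
  | Do instr
  | Seq com com  (infixr ";;" 60)
  | Cond nat nat com com
  | While nat nat com

fun com_size :: "com \<Rightarrow> nat" where
  "com_size Skip = 0"
| "com_size (Do i) = 1"
| "com_size (c1 ;; c2) = com_size c1 + com_size c2"
| "com_size (Cond i j c1 c2) = com_size c1 + com_size c2 + 2"
| "com_size (While i j c) = com_size c + 3"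

text \<open>The else branch directly follows the test, so a true test costs one extra instruction
  and a false one two, the second being the jump over \<open>c1\<close>. Jump targets are absolute,
  hence the argument \<open>p\<close>.\<close>

fun compile :: "nat \<Rightarrow> com \<Rightarrow> program" where
  "compile p Skip = []"
| "compile p (Do i) = [i]"
| "compile p (c1 ;; c2) = compile p c1 @ compile (p + com_size c1) c2"
| "compile p (Cond i j c1 c2) =
     IfLess i j (p + com_size c2 + 2) # compile (p + 1) c2 @
     Goto (p + com_size c2 + 2 + com_size c1) # compile (p + com_size c2 + 2) c1"
| "compile p (While i j c) =
     IfLess i j (p + 2) # Goto (p + com_size c + 3) # compile (p + 2) c @ [Goto p]"

lemma length_compile [simp]: "length (compile p c) = com_size c"
  by (induction c arbitrary: p) auto

text \<open>The index counts the executed machine instructions. All numbers written stay below \<open>B\<close>.\<close>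

inductive big_step :: "nat \<Rightarrow> com \<Rightarrow> (nat \<Rightarrow> nat) \<Rightarrow> (nat \<Rightarrow> nat) \<Rightarrow> nat \<Rightarrow> (nat \<Rightarrow> nat) \<Rightarrow> (nat \<Rightarrow> nat) \<Rightarrow>
    bool"
  for B where
  Skip: "big_step B Skip r m 0 r m"
| Const: "c < B \<Longrightarrow> big_step B (Do (Const i c)) r m 1 (r(i := c)) m"
| Arith: "arith_op f (r j) (r k) < B \<Longrightarrow>
    big_step B (Do (Arith f i j k)) r m 1 (r(i := arith_op f (r j) (r k))) m"
| Load: "big_step B (Do (Load i j)) r m 1 (r(i := m (r j))) m"
| Store: "big_step B (Do (Store i j)) r m 1 r (m(r i := r j))"
| Seq: "big_step B c1 r m n1 r1 m1 \<Longrightarrow> big_step B c2 r1 m1 n2 r2 m2 \<Longrightarrow>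
    big_step B (c1 ;; c2) r m (n1 + n2) r2 m2"
| CondT: "r i < r j \<Longrightarrow> big_step B c1 r m n r' m' \<Longrightarrow> big_step B (Cond i j c1 c2) r m (n + 1) r' m'"
| CondF: "\<not> r i < r j \<Longrightarrow> big_step B c2 r m n r' m' \<Longrightarrow> big_step B (Cond i j c1 c2) r m (n + 2) r' m'"
| WhileT: "r i < r j \<Longrightarrow> big_step B c r m n1 r1 m1 \<Longrightarrow> big_step B (While i j c) r1 m1 n2 r2 m2 \<Longrightarrow>
    big_step B (While i j c) r m (n1 + n2 + 2) r2 m2"
| WhileF: "\<not> r i < r j \<Longrightarrow> big_step B (While i j c) r m 2 r m"

section \<open>Correctness of the compiler\<close>

definition runs_to :: "program \<Rightarrow> nat \<Rightarrow> config \<Rightarrow> nat \<Rightarrow> config \<Rightarrow> bool" where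
  "runs_to P w s t s' \<longleftrightarrow> (step P ^^ t) s = s' \<and> (\<forall>u\<le>t. words_fit w ((step P ^^ u) s))"

lemma runs_to_trans:
  assumes "runs_to P w s t s'" "runs_to P w s' t' s''"
  shows "runs_to P w s (t + t') s''"
proof -
  have add: "(step P ^^ (t + u)) s = (step P ^^ u) s'" for u
    using assms(1) unfolding runs_to_def by (simp add: add.commute[of t] funpow_add)
  have "words_fit w ((step P ^^ u) s)" if ut: "u \<le> t + t'" for u
  proof (cases "u \<le> t")
    case False
    then obtain v where "u = t + v" "v \<le> t'" using ut le_Suc_ex[of t u] by auto
    then show ?thesis using add assms(2) unfolding runs_to_def by simp
  qed (use assms(1) in \<open>simp add: runs_to_def\<close>)
  then show ?thesis using add assms(2) unfolding runs_to_def by simp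
qed

lemma runs_to_0: "words_fit w s \<Longrightarrow> runs_to P w s 0 s"
  unfolding runs_to_def by simp

lemma runs_to_step:
  assumes "pc s < length P" "P ! pc s = i" "exec i s = s'" "words_fit w s" "words_fit w s'"
  shows "runs_to P w s 1 s'"
  using assms unfolding runs_to_def step_def halted_def by (auto simp: le_Suc_eq)

definition code_at :: "program \<Rightarrow> nat \<Rightarrow> program \<Rightarrow> bool" where
  "code_at P p c \<longleftrightarrow> (\<exists>a b. P = a @ c @ b \<and> length a = p)"

lemma code_at_append:
  "code_at P p (c1 @ c2) \<Longrightarrow> code_at P p c1 \<and> code_at P (p + length c1) c2"
  unfolding code_at_def by (metis append.assoc length_append)

lemma code_at_Cons: "code_at P p (i # c) \<Longrightarrow> p < length P \<and> P ! p = i \<and> code_at P (p + 1) c"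
proof -
  assume "code_at P p (i # c)"
  then obtain a b where "P = a @ (i # c) @ b" "length a = p" unfolding code_at_def by blast
  moreover from this have "P = (a @ [i]) @ c @ b" "length (a @ [i]) = p + 1" by simp_all
  ultimately show ?thesis unfolding code_at_def by (metis append_Cons length_append length_Cons
      less_add_Suc1 nth_append_length add_Suc_right)
qed

abbreviation conf :: "nat \<Rightarrow> (nat \<Rightarrow> nat) \<Rightarrow> (nat \<Rightarrow> nat) \<Rightarrow> config" where
  "conf p r m \<equiv> \<lparr>pc = p, reg = r, mem = m\<rparr>"

lemma words_fit_conf: "words_fit w (conf p r m) \<longleftrightarrow> (\<forall>i. r i < 2 ^ w) \<and> (\<forall>a. m a < 2 ^ w)"
  by (simp add: words_fit_def)

text \<open>New numbers arise only in \<open>Const\<close> and \<open>Arith\<close>, whose rules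
  bound them; \<open>Load\<close> and \<open>Store\<close> copy numbers that fit already.\<close>

lemma big_step_words_fit:
  assumes "big_step (2 ^ w) c r m n r' m'" "words_fit w (conf p r m)"
  shows "words_fit w (conf p' r' m')"
  using assms by (induction arbitrary: p p' rule: big_step.induct) (auto simp: words_fit_conf)

lemma compile_correct:
  assumes "big_step (2 ^ w) c r m n r' m'" "words_fit w (conf p r m)" "code_at P p (compile p c)"
  shows "runs_to P w (conf p r m) n (conf (p + com_size c) r' m')"
  using assms
proof (induction arbitrary: p rule: big_step.induct)
  case (Skip r m)
  then show ?case by (simp add: runs_to_0)
next
  case (Seq c1 r m n1 r1 m1 c2 n2 r2 m2)
  have code: "code_at P p (compile p c1)" "code_at P (p + com_size c1) (compile (p + com_size c1)
      c2)"
    using code_at_append Seq.prems(2) by fastforce+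
  have "runs_to P w (conf p r m) n1 (conf (p + com_size c1) r1 m1)"
    using Seq.IH(1)[OF Seq.prems(1) code(1)] .
  moreover have "runs_to P w (conf (p + com_size c1) r1 m1) n2 (conf (p + com_size c1 + com_size c2)
      r2 m2)"
    using Seq.IH(2)[OF _ code(2)] big_step_words_fit[OF Seq.hyps(1) Seq.prems(1)] by blast
  ultimately show ?case using runs_to_trans by (simp add: add.assoc)
next
  case (CondT r i j c1 m n r' m' c2)
  let ?q = "p + com_size c2 + 2"
  have code: "p < length P" "P ! p = IfLess i j ?q" "code_at P ?q (compile ?q c1)"
    using CondT.prems(2) by (auto dest!: code_at_Cons code_at_append)
  have fit: "words_fit w (conf ?q r m)" using CondT.prems(1) by (simp add: words_fit_conf)
  have "runs_to P w (conf p r m) 1 (conf ?q r m)"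
    using code CondT.hyps CondT.prems(1) fit by (intro runs_to_step) auto
  from runs_to_trans[OF this CondT.IH[OF fit code(3)]] show ?case by (simp add: ac_simps)
next
  case (CondF r i j c2 m n r' m' c1)
  let ?q = "p + 1" and ?e = "p + com_size c2 + 2 + com_size c1"
  have code: "p < length P" "P ! p = IfLess i j (p + com_size c2 + 2)"
      "code_at P ?q (compile ?q c2)"
    "?q + com_size c2 < length P" "P ! (?q + com_size c2) = Goto ?e"
    using CondF.prems(2) by (auto dest!: code_at_Cons code_at_append)
  have fit: "words_fit w (conf ?q r m)" using CondF.prems(1) by (simp add: words_fit_conf)
  have "runs_to P w (conf p r m) 1 (conf ?q r m)"
    using code CondF.hyps CondF.prems(1) fit by (intro runs_to_step) auto
  note 1 = runs_to_trans[OF this CondF.IH[OF fit code(3)]]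
  have fit': "words_fit w (conf a r' m')" for a
    using big_step_words_fit[OF CondF.hyps(2) fit] .
  have "runs_to P w (conf (?q + com_size c2) r' m') 1 (conf ?e r' m')"
    using code fit' by (intro runs_to_step) auto
  from runs_to_trans[OF 1 this] show ?case by (simp add: ac_simps)
next
  case (WhileT r i j c m n1 r1 m1 n2 r2 m2)
  let ?q = "p + 2"
  have code: "p < length P" "P ! p = IfLess i j ?q" "code_at P ?q (compile ?q c)"
    "?q + com_size c < length P" "P ! (?q + com_size c) = Goto p"
    using WhileT.prems(2) by (auto dest!: code_at_Cons code_at_append)
  have fit: "words_fit w (conf ?q r m)" using WhileT.prems(1) by (simp add: words_fit_conf)
  have "runs_to P w (conf p r m) 1 (conf ?q r m)"
    using code WhileT.hyps(1) WhileT.prems(1) fit by (intro runs_to_step) auto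
  note 1 = runs_to_trans[OF this WhileT.IH(1)[OF fit code(3)]]
  have fit': "words_fit w (conf a r1 m1)" for a
    using big_step_words_fit[OF WhileT.hyps(2) fit] .
  have "runs_to P w (conf (?q + com_size c) r1 m1) 1 (conf p r1 m1)"
    using code fit' by (intro runs_to_step) auto
  from runs_to_trans[OF runs_to_trans[OF 1 this] WhileT.IH(2)[OF fit' WhileT.prems(2)]]
  show ?case by (simp add: ac_simps)
next
  case (WhileF r i j c m)
  let ?e = "p + com_size c + 3"
  have code: "p < length P" "P ! p = IfLess i j (p + 2)" "p + 1 < length P" "P ! (p + 1) = Goto ?e"
    using WhileF.prems(2) by (auto dest!: code_at_Cons)
  have fit: "words_fit w (conf a r m)" for a using WhileF.prems(1) by (simp add: words_fit_conf)
  have "runs_to P w (conf p r m) 1 (conf (p + 1) r m)"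
    using code WhileF.hyps fit by (intro runs_to_step) auto
  moreover have "runs_to P w (conf (p + 1) r m) 1 (conf ?e r m)"
    using code fit by (intro runs_to_step) auto
  ultimately have "runs_to P w (conf p r m) (1 + 1) (conf ?e r m)" by (rule runs_to_trans)
  then show ?case by (simp add: ac_simps numeral_2_eq_2)
qed (auto dest!: code_at_Cons intro!: runs_to_step[simplified] simp: words_fit_conf)

text \<open>The final configuration is a fixed point, so the exact running time may be rounded up to
  any \<open>t\<close> and the word bound persists.\<close>

lemma computes_withinI:
  assumes "big_step (2 ^ w) c r m n r' m'" "words_fit w (conf 0 r m)" "r' 0 = v" "n \<le> t"
  shows "computes_within (compile 0 c) (conf 0 r m) v t w"
proof -
  let ?P = "compile 0 c" and ?s = "conf 0 r m" and ?e = "conf (com_size c) r' m'"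
  have "code_at ?P 0 ?P" unfolding code_at_def by auto
  then have r: "runs_to ?P w ?s n ?e" using compile_correct[OF assms(1,2)] by fastforce
  have halt: "halted ?P ?e" by (simp add: halted_def)
  have fix_e: "(step ?P ^^ u) ?e = ?e" for u
    by (induction u) (use halt in \<open>auto simp: step_def\<close>)
  have late: "(step ?P ^^ u) ?s = ?e" if "n \<le> u" for u
  proof -
    obtain k where "u = k + n" using \<open>n \<le> u\<close> by (metis le_Suc_ex add.commute)
    then show ?thesis using r fix_e unfolding runs_to_def by (simp add: funpow_add)
  qed
  have "words_fit w ((step ?P ^^ u) ?s)" for u
  proof (cases "n \<le> u")
    case True
    then show ?thesis using late r unfolding runs_to_def by (metis order_refl)
  qed (use r in \<open>simp add: runs_to_def\<close>)
  then show ?thesis unfolding computes_within_def using late[OF assms(4)] halt assms(3) by simp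
qed

text \<open>A weakest precondition for total correctness. The last argument of an assertion is a
  running clock, so that costs accumulate through sequences without separate bookkeeping.\<close>

definition wp :: "nat \<Rightarrow> com \<Rightarrow> ((nat \<Rightarrow> nat) \<Rightarrow> (nat \<Rightarrow> nat) \<Rightarrow> nat \<Rightarrow> bool) \<Rightarrow>
    (nat \<Rightarrow> nat) \<Rightarrow> (nat \<Rightarrow> nat) \<Rightarrow> nat \<Rightarrow> bool" where
  "wp B c Q r m n \<longleftrightarrow> (\<exists>n' r' m'. big_step B c r m n' r' m' \<and> Q r' m' (n + n'))"

inductive_cases big_step_elims:
  "big_step B Skip r m n r' m'" "big_step B (Do (Const i c)) r m n r' m'"
  "big_step B (Do (Arith f i j k)) r m n r' m'" "big_step B (Do (Load i j)) r m n r' m'"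
  "big_step B (Do (Store i j)) r m n r' m'" "big_step B (c1 ;; c2) r m n r' m'"
  "big_step B (Cond i j c1 c2) r m n r' m'"

lemma wp_Skip: "wp B Skip Q r m n \<longleftrightarrow> Q r m n"
  unfolding wp_def by (force intro: big_step.Skip elim: big_step_elims)

lemma wp_Const: "wp B (Do (Const i c)) Q r m n \<longleftrightarrow> c < B \<and> Q (r(i := c)) m (n + 1)"
  unfolding wp_def by (force intro: big_step.Const elim: big_step_elims)

lemma wp_Arith: "wp B (Do (Arith f i j k)) Q r m n \<longleftrightarrow>
    arith_op f (r j) (r k) < B \<and> Q (r(i := arith_op f (r j) (r k))) m (n + 1)"
  unfolding wp_def by (force intro: big_step.Arith elim: big_step_elims)

lemma wp_Load: "wp B (Do (Load i j)) Q r m n \<longleftrightarrow> Q (r(i := m (r j))) m (n + 1)"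
  unfolding wp_def by (force intro: big_step.Load elim: big_step_elims)

lemma wp_Store: "wp B (Do (Store i j)) Q r m n \<longleftrightarrow> Q r (m(r i := r j)) (n + 1)"
  unfolding wp_def by (force intro: big_step.Store elim: big_step_elims)

lemma wp_Seq: "wp B (c1 ;; c2) Q r m n \<longleftrightarrow> wp B c1 (wp B c2 Q) r m n"
proof
  assume "wp B (c1 ;; c2) Q r m n"
  then show "wp B c1 (wp B c2 Q) r m n"
    unfolding wp_def by (auto elim!: big_step_elims) (metis add.assoc)
next
  assume "wp B c1 (wp B c2 Q) r m n"
  then show "wp B (c1 ;; c2) Q r m n"
    unfolding wp_def by (metis add.assoc big_step.Seq)
qed

lemma wp_Cond: "wp B (Cond i j c1 c2) Q r m n \<longleftrightarrow>
    (if r i < r j then wp B c1 Q r m (n + 1) else wp B c2 Q r m (n + 2))"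
proof (cases "r i < r j")
  case True
  have "big_step B (Cond i j c1 c2) r m n' r' m' \<longleftrightarrow> (\<exists>k. n' = k + 1 \<and> big_step B c1 r m k r' m')"
      for n' r' m'
    using True big_step.CondT[of r i j B c1] by (auto elim!: big_step_elims)
  then have "wp B (Cond i j c1 c2) Q r m n \<longleftrightarrow> (\<exists>k r' m'. big_step B c1 r m k r' m' \<and>
      Q r' m' (n + (k + 1)))"
    unfolding wp_def by metis
  then show ?thesis using True unfolding wp_def by (simp add: ac_simps)
next
  case False
  have "big_step B (Cond i j c1 c2) r m n' r' m' \<longleftrightarrow> (\<exists>k. n' = k + 2 \<and> big_step B c2 r m k r' m')"
      for n' r' m'
    using False big_step.CondF[of r i j B c2] by (auto elim!: big_step_elims)
  then have "wp B (Cond i j c1 c2) Q r m n \<longleftrightarrow> (\<exists>k r' m'. big_step B c2 r m k r' m' \<and>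
      Q r' m' (n + (k + 2)))"
    unfolding wp_def by metis
  then show ?thesis using False unfolding wp_def by (simp add: ac_simps)
qed

lemmas wp_simps = wp_Skip wp_Const wp_Arith wp_Load wp_Store wp_Seq wp_Cond

lemma wp_mono:
  assumes "wp B c Q r m n" "\<And>r m n. Q r m n \<Longrightarrow> Q' r m n"
  shows "wp B c Q' r m n"
  using assms unfolding wp_def by blast

fun written :: "com \<Rightarrow> nat set" where
  "written Skip = {}"
| "written (Do (Const i c)) = {i}"
| "written (Do (Arith f i j k)) = {i}"
| "written (Do (Load i j)) = {i}"
| "written (Do i) = {}"
| "written (c1 ;; c2) = written c1 \<union> written c2"
| "written (Cond i j c1 c2) = written c1 \<union> written c2"
| "written (While i j c) = written c"

lemma big_step_frame: "big_step B c r m n r' m' \<Longrightarrow> k \<notin> written c \<Longrightarrow> r' k = r k"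
  by (induction rule: big_step.induct) auto

lemma wp_frame:
  assumes "wp B c Q r m n"
  shows "wp B c (\<lambda>r' m' n'. Q r' m' n' \<and> (\<forall>k. k \<notin> written c \<longrightarrow> r' k = r k)) r m n"
  using assms big_step_frame unfolding wp_def by metis

text \<open>A round costs two instructions beyond its body, the test before it and the jump back
  after it; leaving the loop costs the failed test and the exit jump. The measure
  \<open>\<mu>\<close> yields termination.\<close>

lemma wp_While:
  assumes "I r m n"
    and "\<And>r m n. I r m n \<Longrightarrow> r i < r j \<Longrightarrow>
      wp B c (\<lambda>r' m' n'. I r' m' (n' + 1) \<and> \<mu> r' m' < (\<mu> r m :: nat)) r m (n + 1)"
    and "\<And>r m n. I r m n \<Longrightarrow> \<not> r i < r j \<Longrightarrow> Q r m (n + 2)"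
  shows "wp B (While i j c) Q r m n"
  using assms(1)
proof (induction "\<mu> r m" arbitrary: r m n rule: less_induct)
  case less
  show ?case
  proof (cases "r i < r j")
    case True
    from assms(2)[OF less.prems True] obtain n1 r1 m1 where
      1: "big_step B c r m n1 r1 m1" "I r1 m1 (n + 1 + n1 + 1)" "\<mu> r1 m1 < \<mu> r m"
      unfolding wp_def by auto
    from less.hyps[OF 1(3,2)] obtain n2 r2 m2 where
      2: "big_step B (While i j c) r1 m1 n2 r2 m2" "Q r2 m2 (n + 1 + n1 + 1 + n2)"
      unfolding wp_def by auto
    have "n + 1 + n1 + 1 + n2 = n + (n1 + n2 + 2)" by simp
    then show ?thesis unfolding wp_def using big_step.WhileT[OF True 1(1) 2(1)] 2(2) by metis
  next
    case False
    then show ?thesis unfolding wp_def using big_step.WhileF assms(3)[OF less.prems] by blast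
  qed
qed

lemma wp_post: "wp B c Q r m n \<Longrightarrow> \<forall>r' m' n'. Q r' m' n' \<and> (\<forall>k. k \<notin> written c \<longrightarrow> r' k = r k) \<longrightarrow>
    Q' r' m' n' \<Longrightarrow> wp B c Q' r m n"
  by (rule wp_mono[OF wp_frame]) auto

section \<open>Divide and conquer on the RAM\<close>

abbreviation "const i c \<equiv> Do (Const i c)"
abbreviation "add i j k \<equiv> Do (Arith Add i j k)"
abbreviation "sub i j k \<equiv> Do (Arith Sub i j k)"
abbreviation "mul i j k \<equiv> Do (Arith Mul i j k)"
abbreviation "quot i j k \<equiv> Do (Arith Div i j k)"
abbreviation "load i j \<equiv> Do (Load i j)"
abbreviation "store i j \<equiv> Do (Store i j)"

abbreviation (input) "rOne \<equiv> 2 :: nat"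
abbreviation (input) "rZero \<equiv> 3 :: nat"
abbreviation (input) "rS \<equiv> 20 :: nat"
abbreviation (input) "rS4 \<equiv> 21 :: nat"
abbreviation (input) "rSrc \<equiv> 22 :: nat"
abbreviation (input) "rDst \<equiv> 23 :: nat"
abbreviation (input) "rL \<equiv> 25 :: nat"
abbreviation (input) "rO \<equiv> 26 :: nat"
abbreviation (input) "rF1 \<equiv> 27 :: nat"
abbreviation (input) "rFE1 \<equiv> 28 :: nat"
abbreviation (input) "rG1 \<equiv> 29 :: nat"
abbreviation (input) "rGE1 \<equiv> 30 :: nat"
abbreviation (input) "rV1 \<equiv> 31 :: nat"
abbreviation (input) "rF2 \<equiv> 32 :: nat"
abbreviation (input) "rFE2 \<equiv> 33 :: nat"
abbreviation (input) "rG2 \<equiv> 34 :: nat"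
abbreviation (input) "rGE2 \<equiv> 35 :: nat"
abbreviation (input) "rV2 \<equiv> 36 :: nat"
abbreviation (input) "rH \<equiv> 37 :: nat"
abbreviation (input) "rDP \<equiv> 38 :: nat"
abbreviation (input) "rDE \<equiv> 39 :: nat"
abbreviation (input) "rA \<equiv> 40 :: nat"
abbreviation (input) "rB \<equiv> 41 :: nat"
abbreviation (input) "rLL \<equiv> 42 :: nat"
abbreviation (input) "rSS \<equiv> 43 :: nat"
abbreviation (input) "rC \<equiv> 44 :: nat"

text \<open>The arrays at \<open>f\<close> and \<open>g\<close> are merged in decreasing order, and \<open>v\<close> accumulates the entries.
  Beyond its end an array reads as \<open>0\<close>, so a pointer that has overshot does no harm.\<close>

definition advance :: "nat \<Rightarrow> nat \<Rightarrow> nat \<Rightarrow> nat \<Rightarrow> nat \<Rightarrow> com" where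
  "advance f fe g ge v =
     const rA 0 ;; const rB 0 ;; Cond f fe (load rA f) Skip ;; Cond g ge (load rB g) Skip ;;
     Cond rA rB (add v v rB ;; add g g rOne) (add v v rA ;; add f f rOne)"

lemma wp_advance:
  assumes "distinct [f, fe, g, ge, v, rOne, rA, rB]" "r rOne = 1" "0 < B"
    and x: "x = (if r f < r fe then m (r f) else 0)"
        and y: "y = (if r g < r ge then m (r g) else 0)"
    and "x < y \<Longrightarrow> r v + y < B \<and> r g + 1 < B" "\<not> x < y \<Longrightarrow> r v + x < B \<and> r f + 1 < B"
  shows "wp B (advance f fe g ge v) (\<lambda>r' m' n'. m' = m \<and> n' \<le> n + 10 \<and>
    r' v = r v + max x y \<and> r' f = r f + of_bool (\<not> x < y) \<and> r' g = r g + of_bool (x < y) \<and>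
    (\<forall>k. k \<notin> {f, g, v, rA, rB} \<longrightarrow> r' k = r k)) r m n"
  using assms unfolding advance_def by (auto simp: wp_simps)

text \<open>With truncated subtraction, \<open>v1 + (v2 - v1)\<close> is the maximum of the two
  accumulated values. Its increment over the previous maximum, kept in \<open>rH\<close>, is the
  next gain of the joined block.\<close>

definition merge_body :: com where
  "merge_body =
     advance rF1 rFE1 rG1 rGE1 rV1 ;; advance rF2 rFE2 rG2 rGE2 rV2 ;;
     sub rA rV2 rV1 ;; add rA rV1 rA ;; sub rB rA rH ;; store rDP rB ;;
     add rH rA rZero ;; add rDP rDP rOne"

lemma written_merge_body: "written merge_body = {rF1, rG1, rV1, rF2, rG2, rV2, rH, rDP, rA, rB}"
  unfolding merge_body_def advance_def by auto

definition reads :: "(nat \<Rightarrow> nat) \<Rightarrow> nat \<Rightarrow> nat \<Rightarrow> (nat \<Rightarrow> nat) \<Rightarrow> bool" where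
  "reads m p e f \<longleftrightarrow> (\<forall>i. (if p + i < e then m (p + i) else 0) = f i)"

text \<open>The split points are known only to be balanced; \<open>h t\<close> takes the same value
  for all such splits. A round costs 28: two advances of at most 10, six instructions, and two for
  the loop.\<close>

definition merge_inv :: "(nat \<Rightarrow> nat) \<Rightarrow> (nat \<Rightarrow> nat) \<Rightarrow> (nat \<Rightarrow> nat) \<Rightarrow> (nat \<Rightarrow> nat) \<Rightarrow> (nat \<Rightarrow> nat) \<Rightarrow>
    (nat \<Rightarrow> nat) \<Rightarrow> (nat \<Rightarrow> nat) \<Rightarrow> nat \<Rightarrow> nat \<Rightarrow> (nat \<Rightarrow> nat) \<Rightarrow> (nat \<Rightarrow> nat) \<Rightarrow> nat \<Rightarrow> bool" where
  "merge_inv f1 g1 f2 g2 h r m n t r' m' n' \<longleftrightarrow>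
     (\<exists>i1 j1 i2 j2. i1 + j1 = t \<and> i2 + j2 = t \<and> balanced f1 g1 i1 j1 \<and> balanced f2 g2 i2 j2 \<and>
       r' rF1 = r rF1 + i1 \<and> r' rG1 = r rG1 + j1 \<and> r' rV1 = (\<Sum>t<i1. f1 t) + (\<Sum>t<j1. g1 t) \<and>
       r' rF2 = r rF2 + i2 \<and> r' rG2 = r rG2 + j2 \<and> r' rV2 = (\<Sum>t<i2. f2 t) + (\<Sum>t<j2. g2 t)) \<and>
     r' rH = h t \<and> r' rDP = r rDP + t \<and> n' \<le> n + 28 * t \<and>
     m' = (\<lambda>a. if r rDP \<le> a \<and> a < r rDP + t then h (Suc (a - r rDP)) - h (a - r rDP) else m a) \<and>
     (\<forall>k. k \<notin> written merge_body \<longrightarrow> r' k = r k)"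

context
  fixes B :: nat and f1 g1 f2 g2 h r m :: "nat \<Rightarrow> nat"
  assumes anti: "antimono f1" "antimono g1" "antimono f2" "antimono g2"
    and h: "\<And>t i1 j1 i2 j2. \<lbrakk>i1 + j1 = t; i2 + j2 = t; balanced f1 g1 i1 j1; balanced f2 g2 i2 j2\<rbrakk> \<Longrightarrow>
      h t = max ((\<Sum>t<i1. f1 t) + (\<Sum>t<j1. g1 t)) ((\<Sum>t<i2. f2 t) + (\<Sum>t<j2. g2 t))"
    and hB: "\<And>t. h t < B" and one: "r rOne = 1" "r rZero = 0"
    and rd: "reads m (r rF1) (r rFE1) f1" "reads m (r rG1) (r rGE1) g1"
      "reads m (r rF2) (r rFE2) f2" "reads m (r rG2) (r rGE2) g2"
    and disj: "r rFE1 \<le> r rDP \<or> r rDE \<le> r rF1" "r rGE1 \<le> r rDP \<or> r rDE \<le> r rG1"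
      "r rFE2 \<le> r rDP \<or> r rDE \<le> r rF2" "r rGE2 \<le> r rDP \<or> r rDE \<le> r rG2"
    and bnd: "r rF1 + (r rDE - r rDP) < B" "r rG1 + (r rDE - r rDP) < B" "r rDE < B"
      "r rF2 + (r rDE - r rDP) < B" "r rG2 + (r rDE - r rDP) < B"
begin

lemma wp_merge_body:
  assumes inv: "merge_inv f1 g1 f2 g2 h r m n t r' m' n'" and t: "r rDP + t < r rDE"
  shows "wp B merge_body (\<lambda>r'' m'' n''. merge_inv f1 g1 f2 g2 h r m n (Suc t) r'' m'' (n'' + 1)) r'
      m' (n' + 1)"
proof -
  from inv obtain i1 j1 i2 j2 where
    ij: "i1 + j1 = t" "i2 + j2 = t" "balanced f1 g1 i1 j1" "balanced f2 g2 i2 j2" and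
    rr: "r' rF1 = r rF1 + i1" "r' rG1 = r rG1 + j1" "r' rV1 = (\<Sum>t<i1. f1 t) + (\<Sum>t<j1. g1 t)"
       "r' rF2 = r rF2 + i2" "r' rG2 = r rG2 + j2" "r' rV2 = (\<Sum>t<i2. f2 t) + (\<Sum>t<j2. g2 t)" and
    rest: "r' rH = h t" "r' rDP = r rDP + t" "n' \<le> n + 28 * t"
      "m' = (\<lambda>a. if r rDP \<le> a \<and> a < r rDP + t then h (Suc (a - r rDP)) - h (a - r rDP) else m a)"
      "\<forall>k. k \<notin> written merge_body \<longrightarrow> r' k = r k"
    unfolding merge_inv_def by blast
  have fr: "r' rOne = 1" "r' rZero = 0" "r' rFE1 = r rFE1" "r' rGE1 = r rGE1" "r' rFE2 = r rFE2"
    "r' rGE2 = r rGE2" "r' rDE = r rDE"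
    using rest(5) one by (auto simp: merge_body_def advance_def)
  have rd': "(if p + i < e then m' (p + i) else 0) = f i"
    if "reads m p e f" "e \<le> r rDP \<or> r rDE \<le> p" for p e f i
  proof -
    have "f i = (if p + i < e then m (p + i) else 0)" using that(1) unfolding reads_def by metis
    then show ?thesis using that(2) t unfolding rest(4) by auto
  qed
  have x1: "f1 i1 = (if r' rF1 < r' rFE1 then m' (r' rF1) else 0)"
    and y1: "g1 j1 = (if r' rG1 < r' rGE1 then m' (r' rG1) else 0)"
    and x2: "f2 i2 = (if r' rF2 < r' rFE2 then m' (r' rF2) else 0)"
    and y2: "g2 j2 = (if r' rG2 < r' rGE2 then m' (r' rG2) else 0)"
    unfolding rr fr using rd'[OF rd(1) disj(1)] rd'[OF rd(2) disj(2)] rd'[OF rd(3) disj(3)]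
        rd'[OF rd(4) disj(4)]
    by auto
  define i1' j1' where i1': "i1' = i1 + of_bool (\<not> f1 i1 < g1 j1)"
      and j1': "j1' = j1 + of_bool (f1 i1 < g1 j1)"
  define i2' j2' where i2': "i2' = i2 + of_bool (\<not> f2 i2 < g2 j2)"
      and j2': "j2' = j2 + of_bool (f2 i2 < g2 j2)"
  have bal: "balanced f1 g1 i1' j1'" "balanced f2 g2 i2' j2'"
    using balanced_step[OF anti(1,2) ij(3)] balanced_step[OF anti(3,4) ij(4)]
        unfolding i1' j1' i2' j2' by auto
  have sum': "i1' + j1' = Suc t" "i2' + j2' = Suc t" using ij unfolding i1' j1' i2' j2' by auto
  have v1: "(\<Sum>t<i1'. f1 t) + (\<Sum>t<j1'. g1 t) = r' rV1 + max (f1 i1) (g1 j1)"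
    unfolding rr i1' j1' by auto
  have v2: "(\<Sum>t<i2'. f2 t) + (\<Sum>t<j2'. g2 t) = r' rV2 + max (f2 i2) (g2 j2)"
    unfolding rr i2' j2' by auto
  have h': "h (Suc t) = max (r' rV1 + max (f1 i1) (g1 j1)) (r' rV2 + max (f2 i2) (g2 j2))"
    using h[OF sum' bal] unfolding v1 v2 .
  have hb: "r' rV1 + max (f1 i1) (g1 j1) < B" "r' rV2 + max (f2 i2) (g2 j2) < B"
    using hB[of "Suc t"] unfolding h' by auto
  have pb: "r' rF1 + 1 < B" "r' rG1 + 1 < B" "r' rF2 + 1 < B" "r' rG2 + 1 < B" "r' rDP + 1 < B"
      "0 < B"
    using bnd t ij(1,2) unfolding rr rest(2) by linarith+
  show ?thesis
    unfolding merge_body_def wp_Seq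
  proof (rule wp_mono[OF wp_advance[of rF1 rFE1 rG1 rGE1 rV1 r' B "f1 i1" m' "g1 j1" "n' + 1"]],
      goal_cases)
    case (8 ra ma na)
    then have a: "ma = m'" "na \<le> n' + 11" "ra rV1 = r' rV1 + max (f1 i1) (g1 j1)"
      "ra rF1 = r rF1 + i1'" "ra rG1 = r rG1 + j1'"
      "\<forall>k. k \<notin> {rF1, rG1, rV1, rA, rB} \<longrightarrow> ra k = r' k"
      unfolding i1' j1' by (simp_all add: rr)
    have x2': "f2 i2 = (if ra rF2 < ra rFE2 then ma (ra rF2) else 0)"
      and y2': "g2 j2 = (if ra rG2 < ra rGE2 then ma (ra rG2) else 0)"
      using x2 y2 a(1,6) by simp_all
    show ?case
    proof (rule wp_mono[OF wp_advance[of rF2 rFE2 rG2 rGE2 rV2 ra B "f2 i2" ma "g2 j2" na]],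
        goal_cases)
      case (8 rb mb nb)
      then have b: "mb = m'" "nb \<le> n' + 21" "rb rV2 = r' rV2 + max (f2 i2) (g2 j2)"
        "rb rF2 = r rF2 + i2'" "rb rG2 = r rG2 + j2'" "rb rV1 = r' rV1 + max (f1 i1) (g1 j1)"
        "rb rF1 = r rF1 + i1'" "rb rG1 = r rG1 + j1'"
        "\<forall>k. k \<notin> {rF1, rG1, rV1, rF2, rG2, rV2, rA, rB} \<longrightarrow> rb k = r' k"
        using a unfolding i2' j2' by (simp_all add: rr)
      have mx: "rb rV1 + (rb rV2 - rb rV1) = h (Suc t)" unfolding h' b by auto
      have m'': "m'(r rDP + t := h (Suc t) - h t) =
        (\<lambda>a. if r rDP \<le> a \<and> a < r rDP + Suc t then h (Suc (a - r rDP)) - h (a - r rDP) else m a)"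
        unfolding rest(4) by (auto simp: fun_eq_iff less_Suc_eq)
      have frame: "k \<notin> {rF1, rG1, rV1, rF2, rG2, rV2, rH, rDP, rA, rB} \<Longrightarrow> rb k = r k" for k
        using rest(5) b(9) unfolding written_merge_body by simp
      have "h (Suc t) - h t < B" using hB[of "Suc t"] by simp
      moreover have "rb rZero = 0" "rb rOne = 1" "rb rH = h t" "rb rDP = r rDP + t"
          "r rDP + t + 1 < B"
        using b(9) fr rest pb by simp_all
      ultimately show ?case
        using mx hB[of "Suc t"] hb(2) b(1-8) pb rest(3) sum' bal v1 v2 frame
        by (simp add: wp_simps merge_inv_def m'' written_merge_body)
    qed (use a fr hb pb x2' y2' in auto)
  qed (use fr hb pb x1 y1 in auto)
qed

lemma wp_merge_loop:
  assumes "h 0 = 0" "r rV1 = 0" "r rV2 = 0" "r rH = 0" "r rDP \<le> r rDE"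
  shows "wp B (While rDP rDE merge_body) (\<lambda>r' m' n'. n' \<le> n + 28 * (r rDE - r rDP) + 2 \<and>
    m' = (\<lambda>a. if r rDP \<le> a \<and> a < r rDE then h (Suc (a - r rDP)) - h (a - r rDP) else m a) \<and>
    (\<forall>k. k \<notin> written merge_body \<longrightarrow> r' k = r k)) r m n"
proof (rule wp_While[where I = "\<lambda>r' m' n'. \<exists>t. r rDP + t \<le> r rDE \<and>
    merge_inv f1 g1 f2 g2 h r m n t r' m' n'"
      and \<mu> = "\<lambda>r' m'. r' rDE - r' rDP"], goal_cases)
  case 1
  have "merge_inv f1 g1 f2 g2 h r m n 0 r m n"
    using assms balanced_0 by (auto simp: merge_inv_def)
  then show ?case using assms(5) by (intro exI[of _ 0]) simp
next
  case (2 r' m' n')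
  then obtain t where t: "r rDP + t \<le> r rDE" "merge_inv f1 g1 f2 g2 h r m n t r' m' n'" by blast
  have DE: "r' rDE = r rDE" "r' rDP = r rDP + t" using t(2)
      unfolding merge_inv_def written_merge_body by simp_all
  have "r rDP + t < r rDE" using 2(2) DE by simp
  from wp_frame[OF wp_merge_body[OF t(2) this]] show ?case
  proof (rule wp_mono)
    fix ra ma na
    assume a: "merge_inv f1 g1 f2 g2 h r m n (Suc t) ra ma (na + 1) \<and> (\<forall>k. k \<notin> written merge_body \<longrightarrow>
        ra k = r' k)"
    then have "ra rDP = r rDP + Suc t" "ra rDE = r rDE"
      unfolding merge_inv_def written_merge_body by simp_all
    then show "(\<exists>t. r rDP + t \<le> r rDE \<and> merge_inv f1 g1 f2 g2 h r m n t ra ma (na + 1)) \<and>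
        ra rDE - ra rDP < r' rDE - r' rDP"
      using a DE \<open>r rDP + t < r rDE\<close> by (intro conjI exI[of _ "Suc t"]) auto
  qed
next
  case (3 r' m' n')
  then obtain t where t: "r rDP + t \<le> r rDE" "merge_inv f1 g1 f2 g2 h r m n t r' m' n'" by blast
  have DE: "r' rDE = r rDE" "r' rDP = r rDP + t" using t(2)
      unfolding merge_inv_def written_merge_body by simp_all
  then have "r rDE = r rDP + t" using 3(2) t(1) by simp
  then show ?case using t(2) unfolding merge_inv_def by auto
qed

end

text \<open>Position \<open>a * (2 * s) + b * s + q\<close> of the table for block size \<open>L\<close> belongs to the block
  that contains \<open>q\<close>, with its first item excluded if \<open>a = 1\<close> and its last one excluded if \<open>b =
  1\<close>. The gains of one block are stored consecutively.\<close>

definition table :: "(nat \<Rightarrow> nat) \<Rightarrow> nat \<Rightarrow> nat \<Rightarrow> nat \<Rightarrow> nat" where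
  "table c s L z = (let q = z mod s; o' = q - q mod L in
     gain c (o' + z div (2 * s)) (o' + L - z div s mod 2) (q mod L))"

lemma table_eq:
  assumes "b \<le> 1" "o' + t < s" "t < L" "L dvd o'"
  shows "table c s L (a * (2 * s) + b * s + o' + t) = gain c (o' + a) (o' + L - b) t"
proof -
  let ?z = "a * (2 * s) + b * s + o' + t"
  have z: "?z = (2 * a + b) * s + (o' + t)" by (simp add: algebra_simps)
  have "?z mod s = o' + t" unfolding z using assms(2) by simp
  moreover have "(o' + t) mod L = t" using assms(3,4) by (metis dvd_imp_mod_0 mod_add_left_eq add_0
      mod_less)
  moreover have zs: "?z div s = 2 * a + b" unfolding z using assms(2) by simp
  moreover have "?z div (2 * s) = a"
    using zs assms(1) by (metis div_mult2_eq div_mult_self4 mult.commute add.commute div_less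
        le_imp_less_Suc numeral_2_eq_2 One_nat_def zero_neq_numeral add_0)
  moreover have "(2 * a + b) mod 2 = b" using assms(1) by (simp add: mod_less)
  ultimately show ?thesis unfolding table_def Let_def by simp
qed

text \<open>The left half may use its last item and the right half not its first one (pointers \<open>rF1\<close>,
  \<open>rG1\<close>), or vice versa (pointers \<open>rF2\<close>, \<open>rG2\<close>).\<close>

definition node_body :: com where
  "node_body =
     quot rA rO rSS ;; mul rA rA rSS ;; sub rC rO rA ;; quot rB rC rS ;; mul rB rB rS ;;
         sub rC rC rB ;;
     add rF1 rSrc rA ;; add rF1 rF1 rC ;; add rFE1 rF1 rL ;; add rF2 rF1 rS ;; add rFE2 rF2 rL ;;
     add rG2 rSrc rB ;; add rG2 rG2 rC ;; add rG2 rG2 rL ;; add rGE2 rG2 rL ;; add rG1 rG2 rSS ;;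
     add rGE1 rG1 rL ;; const rV1 0 ;; const rV2 0 ;; const rH 0 ;; add rDP rDst rO ;;
         add rDE rDP rLL ;;
     While rDP rDE merge_body ;; add rO rO rLL"

lemma written_node_body: "written node_body =
    {rO, rA, rB, rC, rF1, rFE1, rF2, rFE2, rG1, rGE1, rG2, rGE2, rV1, rV2, rH, rDP, rDE}"
  unfolding node_body_def written.simps written_merge_body by auto

context
  fixes c :: "nat \<Rightarrow> nat" and s L src dst B :: nat
  assumes L: "0 < L" and Ls: "2 * L dvd s" and s: "0 < s"
    and disj: "src + 4 * s \<le> dst \<or> dst + 4 * s \<le> src"
    and bnd: "src + 6 * s < B" "dst + 4 * s < B" "sum c {0..<s} < B"
begin

lemma wp_node_body:
  assumes reg: "r rOne = 1" "r rZero = 0" "r rS = s" "r rSS = 2 * s" "r rSrc = src" "r rDst = dst"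
      "r rL = L" "r rLL = 2 * L"
    and o: "r rO = z" "z < 4 * s" "2 * L dvd z" and tab: "\<forall>z<4 * s. m (src + z) = table c s L z"
  shows "wp B node_body (\<lambda>r' m' n'. n' \<le> n + 56 * L + 26 \<and> r' rO = z + 2 * L \<and>
    m' = (\<lambda>a. if dst + z \<le> a \<and> a < dst + z + 2 * L then table c s (2 * L) (a - dst) else m a)) r m
        n"
proof -
  \<comment> \<open>\<open>a\<close> and \<open>b\<close> are the exclusion flags of the variant,
    and \<open>p\<close> is the start of the block within its copy of size \<open>s\<close>.\<close>
  define a u where "a = z div (2 * s)" and "u = z - a * (2 * s)"
  define b p where "b = u div s" and "p = u - b * s"
  have u: "u = z mod (2 * s)" unfolding u_def a_def by (simp add: minus_div_mult_eq_mod)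
  have p: "p = u mod s" unfolding p_def b_def by (simp add: minus_div_mult_eq_mod)
  have z: "z = a * (2 * s) + u" unfolding a_def u by (rule div_mult_mod_eq[symmetric])
  have ub: "u = b * s + p" unfolding b_def p by (rule div_mult_mod_eq[symmetric])
  have a1: "a \<le> 1" unfolding a_def using o(2)
      by (simp add: less_mult_imp_div_less less_Suc_eq_le[symmetric])
  have b1: "b \<le> 1" unfolding b_def u using s
    by (metis One_nat_def less_Suc_eq_le less_mult_imp_div_less mod_less_divisor nat_0_less_mult_iff
        numeral_2_eq_2 zero_less_numeral)
  have ps: "p < s" unfolding p using s by simp
  have as: "a * (2 * s) \<le> 2 * s" "b * s \<le> s" using a1 b1 by (auto simp: le_Suc_eq)
  have "2 * L dvd u" unfolding u using o(3) Ls by (intro dvd_mod dvd_mult)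
  then have pL: "2 * L dvd p" unfolding p using Ls by (intro dvd_mod)
  have pLs: "p + 2 * L \<le> s"
  proof -
    obtain i j where "p = 2 * L * i" "s = 2 * L * j" using pL Ls by (auto elim!: dvdE)
    moreover from this have "i < j" using ps by (metis mult_less_cancel1)
    then have "2 * L * i + 2 * L * 1 \<le> 2 * L * j" by (metis Suc_leI add_mult_distrib2 mult_le_mono2
        Suc_eq_plus1)
    ultimately show ?thesis by simp
  qed
  have zb: "z + 2 * L \<le> 4 * s" using z ub as pLs by linarith
  have pL': "L dvd p" using pL by (metis dvd_mult_right)
  \<comment> \<open>The left half inherits the flag \<open>a\<close> and is read with both values of
    its last flag; the right half inherits \<open>b\<close> and is read with both values of its
    first. Reading \<open>0\<close> past the end agrees with \<open>gain_eq_0\<close>.\<close>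
  have rdF: "reads m (src + (a * (2 * s) + b' * s + p)) (src + (a * (2 * s) + b' * s + p) + L) (gain
      c (p + a) (p + L - b'))"
    if "b' \<le> 1" for b'
    unfolding reads_def
  proof
    fix i
    have "b' * s \<le> s" using that by (auto simp: le_Suc_eq)
    then have "a * (2 * s) + b' * s + p + i < 4 * s" if "i < L" using that as pLs by linarith
    then show "(if src + (a * (2 * s) + b' * s + p) + i < src + (a * (2 * s) + b' * s + p) + L
        then m (src + (a * (2 * s) + b' * s + p) + i) else 0) = gain c (p + a) (p + L - b') i"
      using tab table_eq[OF \<open>b' \<le> 1\<close>, of p i s L c a] pL' pLs gain_eq_0[of "p + L - b'" "p + a" i c]
      by (auto simp: add.assoc)
  qed
  have rdG: "reads m (src + (a' * (2 * s) + b * s + (p + L))) (src + (a' * (2 * s) + b * s + (p +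
      L)) + L) (gain c (p + L + a') (p + L + L - b))"
    if "a' \<le> 1" for a'
    unfolding reads_def
  proof
    fix i
    have "a' * (2 * s) \<le> 2 * s" using that by (auto simp: le_Suc_eq)
    then have "a' * (2 * s) + b * s + (p + L) + i < 4 * s" if "i < L" using that as pLs by linarith
    then show "(if src + (a' * (2 * s) + b * s + (p + L)) + i < src + (a' * (2 * s) + b * s + (p +
        L)) + L
        then m (src + (a' * (2 * s) + b * s + (p + L)) + i) else 0) = gain c (p + L + a') (p + L + L
            - b) i"
      using tab table_eq[OF b1, of "p + L" i s L c a'] pL' pLs
          gain_eq_0[of "p + L + L - b" "p + L + a'" i c]
      by (auto simp: add.assoc)
  qed
  define h where "h = best_sum c (p + a) (p + 2 * L - b)"
  let ?f1 = "gain c (p + a) (p + L)" and ?g1 = "gain c (Suc (p + L)) (p + 2 * L - b)"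
  let ?f2 = "gain c (p + a) (p + L - 1)" and ?g2 = "gain c (p + L) (p + 2 * L - b)"
  have h: "h t = max ((\<Sum>t<i1. ?f1 t) + (\<Sum>t<j1. ?g1 t)) ((\<Sum>t<i2. ?f2 t) + (\<Sum>t<j2. ?g2 t))"
    if "i1 + j1 = t" "i2 + j2 = t" "balanced ?f1 ?g1 i1 j1" "balanced ?f2 ?g2 i2 j2"
        for t i1 j1 i2 j2
    using best_sum_split[OF _ _ _ that(3,4,1,2)] a1 b1 L unfolding h_def
        by (simp add: best_sum_eq_gains)
  have hB: "h t < B" for t
  proof -
    have "h t \<le> sum c {p + a..<p + 2 * L - b}" unfolding h_def by (rule best_sum_le_sum)
    also have "\<dots> \<le> sum c {0..<s}" using pLs by (intro sum_mono2) auto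
    finally show ?thesis using bnd(3) by simp
  qed
  define f where "f = src + a * (2 * s) + p"
  define g where "g = src + b * s + p + L"
  have rd: "reads m f (f + L) ?f1" "reads m (f + s) (f + s + L) ?f2"
      "reads m (g + 2 * s) (g + 2 * s + L) ?g1" "reads m g (g + L) ?g2"
  proof -
    have e: "src + (a * (2 * s) + 0 * s + p) = f" "src + (a * (2 * s) + 1 * s + p) = f + s"
      "src + (1 * (2 * s) + b * s + (p + L)) = g + 2 * s"
          "src + (0 * (2 * s) + b * s + (p + L)) = g"
      "p + L + L - b = p + 2 * L - b" "p + L - 0 = p + L" "p + L + 1 = Suc (p + L)"
          "p + L + 0 = p + L"
      unfolding f_def g_def by simp_all
    show "reads m f (f + L) ?f1" "reads m (f + s) (f + s + L) ?f2"
      using rdF[of 0] rdF[of 1] unfolding e by blast+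
    show "reads m (g + 2 * s) (g + 2 * s + L) ?g1" "reads m g (g + L) ?g2"
      using rdG[of 0] rdG[of 1] unfolding e by blast+
  qed
  have fb: "f + s + L \<le> src + 4 * s" "g + 2 * s + L \<le> src + 4 * s" "src \<le> f" "src \<le> g"
      "src + (b * s + p) \<le> g" "src + a * (2 * s) \<le> f"
    unfolding f_def g_def using as pLs by linarith+
  define r1 where "r1 = r(rA := a * (2 * s), rB := b * s, rC := p, rF1 := f, rFE1 := f + L,
      rF2 := f + s, rFE2 := f + s + L,
    rG2 := g, rGE2 := g + L, rG1 := g + 2 * s, rGE1 := g + 2 * s + L, rV1 := 0, rV2 := 0, rH := 0,
    rDP := dst + z, rDE := dst + z + 2 * L)"
  have r1: "r1 rOne = 1" "r1 rZero = 0" "r1 rF1 = f" "r1 rFE1 = f + L" "r1 rF2 = f + s"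
      "r1 rFE2 = f + s + L"
    "r1 rG2 = g" "r1 rGE2 = g + L" "r1 rG1 = g + 2 * s" "r1 rGE1 = g + 2 * s + L" "r1 rV1 = 0"
        "r1 rV2 = 0" "r1 rH = 0"
    "r1 rDP = dst + z" "r1 rDE = dst + z + 2 * L" "r1 rO = z" "r1 rLL = 2 * L"
    unfolding r1_def using reg o(1) by simp_all
  have "wp B (While rDP rDE merge_body) (\<lambda>r' m' n'. n' \<le> n0 + 28 * (r1 rDE - r1 rDP) + 2 \<and>
    m' = (\<lambda>a. if r1 rDP \<le> a \<and> a < r1 rDE then h (Suc (a - r1 rDP)) - h (a - r1 rDP) else m a) \<and>
    (\<forall>k. k \<notin> written merge_body \<longrightarrow> r' k = r1 k)) r1 m n0" for n0
    by (rule wp_merge_loop[of ?f1 ?g1 ?f2 ?g2])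
      (use h hB rd fb bnd zb disj pLs s in \<open>auto simp: gain_antimono r1 h_def\<close>)
  note merge = this
  have loop: "wp B (While rDP rDE merge_body) (wp B (add rO rO rLL) (\<lambda>r' m' n'. n' \<le> n + 56 * L + 26
      \<and> r' rO = z + 2 * L \<and>
    m' = (\<lambda>a. if dst + z \<le> a \<and> a < dst + z + 2 * L then table c s (2 * L) (a - dst) else m a))) r1 m
        n0" if "n0 \<le> n + 22" for n0
  proof (rule wp_mono[OF merge], goal_cases)
    case (1 r' m' n')
    have tb: "h (Suc t) - h t = table c s (2 * L) (z + t)" if "t < 2 * L" for t
      using table_eq[OF b1, of p t s "2 * L" c a] that pLs pL unfolding z ub h_def gain_def
          by (simp add: ac_simps)
    have "m' = (\<lambda>a. if dst + z \<le> a \<and> a < dst + z + 2 * L then table c s (2 * L) (a - dst) else m a)"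
    proof
      fix a'
      show "m' a' = (if dst + z \<le> a' \<and> a' < dst + z + 2 * L then table c s (2 * L) (a' - dst) else m
          a')"
        using 1 r1 tb[of "a' - (dst + z)"] by auto
    qed
    then show ?case using 1 r1 zb bnd(2) that unfolding written_merge_body by (simp add: wp_simps)
  qed
  have bb: "a < B" "a * (2 * s) < B" "u < B" "b < B" "b * s < B" "p < B" "src + a * (2 * s) < B"
      "f < B" "f + L < B"
    "f + s < B" "f + s + L < B" "src + b * s < B" "src + b * s + p < B" "g < B" "g + L < B"
        "g + 2 * s < B"
    "g + 2 * s + L < B" "0 < B" "dst + z < B" "dst + z + 2 * L < B"
    using bnd fb zb as ps s a1 b1 ub by linarith+
  show ?thesis
    unfolding node_body_def using bb loop[unfolded r1_def]
    by (simp add: wp_simps reg o(1) flip: a_def u_def b_def p_def f_def g_def)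
qed

lemma wp_node_loop:
  assumes reg: "r rOne = 1" "r rZero = 0" "r rS = s" "r rSS = 2 * s" "r rS4 = 4 * s"
      "r rSrc = src" "r rDst = dst" "r rL = L" "r rLL = 2 * L" "r rO = 0"
    and tab: "\<forall>z<4 * s. m (src + z) = table c s L z"
  shows "wp B (While rO rS4 node_body) (\<lambda>r' m' n'. n' \<le> n + 170 * s + 2 \<and>
    m' = (\<lambda>a. if dst \<le> a \<and> a < dst + 4 * s then table c s (2 * L) (a - dst) else m a)) r m n"
proof (rule wp_While[where I = "\<lambda>r' m' n'. \<exists>j. r' rO = 2 * L * j \<and> 2 * L * j \<le> 4 * s \<and>
    n' \<le> n + (56 * L + 29) * j \<and>
    m' = (\<lambda>a. if dst \<le> a \<and> a < dst + 2 * L * j then table c s (2 * L) (a - dst) else m a) \<and>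
    (\<forall>k. k \<notin> written node_body \<longrightarrow> r' k = r k)" and \<mu> = "\<lambda>r' m'. r' rS4 - r' rO"], goal_cases)
  case 1
  show ?case using reg by (intro exI[of _ 0]) auto
next
  case (2 r' m' n')
  then obtain j where j: "r' rO = 2 * L * j" "2 * L * j \<le> 4 * s" "n' \<le> n + (56 * L + 29) * j"
    "m' = (\<lambda>a. if dst \<le> a \<and> a < dst + 2 * L * j then table c s (2 * L) (a - dst) else m a)"
    and fr: "\<forall>k. k \<notin> written node_body \<longrightarrow> r' k = r k" by blast
  have reg': "r' rOne = 1" "r' rZero = 0" "r' rS = s" "r' rSS = 2 * s" "r' rS4 = 4 * s"
      "r' rSrc = src" "r' rDst = dst" "r' rL = L" "r' rLL = 2 * L"
    using fr reg unfolding written_node_body by simp_all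
  have lt: "2 * L * j < 4 * s" using 2(2) j(1) reg' by simp
  have "2 * L dvd 4 * s" using Ls by (rule dvd_mult)
  then obtain i where i: "4 * s = 2 * L * i" unfolding dvd_def by blast
  have "j < i" using lt unfolding i by simp
  then have "2 * L * Suc j \<le> 2 * L * i" by (intro mult_le_mono) auto
  then have le: "2 * L * Suc j \<le> 4 * s" using i by simp
  have tab': "\<forall>z<4 * s. m' (src + z) = table c s L z"
    using tab disj lt unfolding j(4) by auto
  show ?case
  proof (rule wp_post[OF wp_node_body[OF reg'(1-4,6-9) j(1) lt _ tab']], goal_cases)
    case 2
    show ?case
    proof (intro allI impI, elim conjE, intro conjI exI[of _ "Suc j"], goal_cases)
      case (4 ra ma na)
      show ?case unfolding 4(4) j(4) by (auto simp: fun_eq_iff)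
    qed (use j fr le reg' L lt in \<open>auto simp: algebra_simps written_node_body\<close>)
  qed simp
next
  case (3 r' m' n')
  then obtain j where j: "r' rO = 2 * L * j" "2 * L * j \<le> 4 * s" "n' \<le> n + (56 * L + 29) * j"
    "m' = (\<lambda>a. if dst \<le> a \<and> a < dst + 2 * L * j then table c s (2 * L) (a - dst) else m a)"
    and fr: "\<forall>k. k \<notin> written node_body \<longrightarrow> r' k = r k" by blast
  have "r' rS4 = 4 * s" using fr reg unfolding written_node_body by simp
  then have eq: "2 * L * j = 4 * s" using 3(2) j(1,2) by simp
  have "j \<le> L * j" using L by simp
  moreover have "L * j = 2 * s" using eq by simp
  ultimately have "j \<le> 2 * s" by linarith
  \<comment> \<open>There are \<open>2 * s / L\<close> blocks, at most \<open>2 * s\<close>. The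
    merging takes \<open>28 * (4 * s)\<close> in total and the overhead at most
    \<open>29 * (2 * s)\<close>, whence 170.\<close>
  have "(56 * L + 29) * j = 28 * (2 * L * j) + 29 * j" by (simp add: algebra_simps)
  also have "\<dots> \<le> 28 * (4 * s) + 29 * (2 * s)" unfolding eq using \<open>j \<le> 2 * s\<close> by simp
  finally show ?case using j(3,4) unfolding eq by simp
qed

end

text \<open>Two buffers of \<open>4 * s\<close> cells exchange the roles of source and destination,
  because a block is read by several merges and must survive until the level is complete.\<close>

definition level_body :: com where
  "level_body = const rO 0 ;; add rLL rL rL ;; While rO rS4 node_body ;;
     add rC rSrc rZero ;; add rSrc rDst rZero ;; add rDst rC rZero ;; add rL rLL rZero"

lemma written_level_body: "written level_body = written node_body \<union> {rLL, rSrc, rDst, rL}"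
  unfolding level_body_def written.simps written_node_body by auto

context
  fixes c :: "nat \<Rightarrow> nat" and s b0 B h :: nat
  assumes s: "s = 2 ^ h" and bnd: "b0 + 10 * s < B" "sum c {0..<s} < B"
begin

text \<open>\<open>s = 2 ^ h\<close> allows \<open>h\<close> doublings of the block size. In the
  bound \<open>b0 + 10 * s\<close>, the source starts at most \<open>4 * s\<close> after
  \<open>b0\<close>, and \<open>6 * s\<close> leaves room for pointers that overshoot.\<close>

lemma wp_level_loop:
  assumes reg: "r rOne = 1" "r rZero = 0" "r rS = s" "r rSS = 2 * s" "r rS4 = 4 * s"
      "r rSrc = b0" "r rDst = b0 + 4 * s" "r rL = 1"
    and tab: "\<forall>z<4 * s. m (b0 + z) = table c s 1 z"
  shows "wp B (While rL rS level_body) (\<lambda>r' m' n'. n' \<le> n + (170 * s + 10) * h + 2 \<and>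
    (\<forall>z<4 * s. m' (r' rSrc + z) = table c s s z) \<and> (r' rSrc = b0 \<or> r' rSrc = b0 + 4 * s) \<and>
        (\<forall>a<b0. m' a = m a)) r m n"
proof (rule wp_While[where I = "\<lambda>r' m' n'. \<exists>j\<le>h. r' rL = 2 ^ j \<and> n' \<le> n + (170 * s + 10) * j \<and>
    (\<forall>z<4 * s. m' (r' rSrc + z) = table c s (2 ^ j) z) \<and>
    (r' rSrc = b0 \<and> r' rDst = b0 + 4 * s \<or> r' rDst = b0 \<and> r' rSrc = b0 + 4 * s) \<and>
        (\<forall>a<b0. m' a = m a) \<and>
    (\<forall>k. k \<notin> written level_body \<longrightarrow> r' k = r k)" and \<mu> = "\<lambda>r' m'. r' rS - r' rL"], goal_cases)
  case 1
  show ?case using reg tab by (intro exI[of _ 0]) auto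
next
  case (2 r' m' n')
  then obtain j where j: "j \<le> h" "r' rL = 2 ^ j" "n' \<le> n + (170 * s + 10) * j"
    "\<forall>z<4 * s. m' (r' rSrc + z) = table c s (2 ^ j) z"
    "r' rSrc = b0 \<and> r' rDst = b0 + 4 * s \<or> r' rDst = b0 \<and> r' rSrc = b0 + 4 * s" "\<forall>a<b0. m' a = m a"
    and fr: "\<forall>k. k \<notin> written level_body \<longrightarrow> r' k = r k" by blast
  have reg': "r' rOne = 1" "r' rZero = 0" "r' rS = s" "r' rSS = 2 * s" "r' rS4 = 4 * s"
    using fr reg unfolding written_level_body written_node_body by simp_all
  have "j < h" using 2(2) j(2) reg' s by simp
  then have dvd: "2 * 2 ^ j dvd s" unfolding s using le_imp_power_dvd[of "Suc j" h "2 :: nat"]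
      by simp
  have spos: "0 < s" unfolding s by simp
  have le: "2 * 2 ^ j \<le> s" using dvd spos by (rule dvd_imp_le)
  define r1 where "r1 = r'(rO := 0, rLL := 2 * 2 ^ j)"
  have r1: "r1 rOne = 1" "r1 rZero = 0" "r1 rS = s" "r1 rSS = 2 * s" "r1 rS4 = 4 * s"
      "r1 rSrc = r' rSrc" "r1 rDst = r' rDst" "r1 rL = 2 ^ j" "r1 rLL = 2 * 2 ^ j" "r1 rO = 0"
    unfolding r1_def using reg' j(2) by simp_all
  have d: "r' rSrc + 4 * s \<le> r' rDst \<or> r' rDst + 4 * s \<le> r' rSrc" "r' rSrc + 6 * s < B"
      "r' rDst + 4 * s < B"
    using j(5) bnd(1) by auto
  have loop: "wp B (While rO rS4 node_body) (\<lambda>r'' m'' n''. n'' \<le> n0 + 170 * s + 2 \<and>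
    m'' = (\<lambda>a. if r' rDst \<le> a \<and> a < r' rDst + 4 * s then table c s (2 * 2 ^ j) (a - r' rDst) else m'
        a)) r1 m' n0" for n0
    by (rule wp_node_loop[OF _ dvd spos d bnd(2) r1 j(4)]) simp
  have "wp B (While rO rS4 node_body) (wp B (add rC rSrc rZero ;; add rSrc rDst rZero ;;
      add rDst rC rZero ;; add rL rLL rZero)
    (\<lambda>r'' m'' n''. ((\<exists>j\<le>h. r'' rL = 2 ^ j \<and> n'' + 1 \<le> n + (170 * s + 10) * j \<and>
    (\<forall>z<4 * s. m'' (r'' rSrc + z) = table c s (2 ^ j) z) \<and>
    (r'' rSrc = b0 \<and> r'' rDst = b0 + 4 * s \<or> r'' rDst = b0 \<and> r'' rSrc = b0 + 4 * s) \<and>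
        (\<forall>a<b0. m'' a = m a) \<and>
    (\<forall>k. k \<notin> written level_body \<longrightarrow> r'' k = r k)) \<and> r'' rS - r'' rL < r' rS - r' rL))) r1 m' n0"
    if n0: "n0 \<le> n' + 3" for n0
  proof (rule wp_post[OF loop], intro allI impI, elim conjE, goal_cases)
    case (1 ra ma na)
    then have f: "ra rZero = 0" "ra rSrc = r' rSrc" "ra rDst = r' rDst" "ra rLL = 2 * 2 ^ j"
        "ra rS = s"
      unfolding written.simps written_node_body using r1 by simp_all
    have b: "r' rSrc < B" "r' rDst < B" "2 * 2 ^ j < B" using d le bnd by simp_all
    have frame: "ra k = r k" if "k \<notin> written level_body" for k
      using that 1(1) fr unfolding written.simps written_level_body written_node_body r1_def by simp
    have tab: "\<forall>z<4 * s. ma (r' rDst + z) = table c s (2 ^ Suc j) z" unfolding 1(3) by simp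
    have mem: "\<forall>a<b0. ma a = m a" unfolding 1(3) using j(5,6) by auto
    have time: "na + 5 \<le> n + (170 * s + 10) * Suc j" using 1(2) n0 j(3) by simp
    have "(0 :: nat) < 2 ^ j" by simp
    then have dec: "s - 2 * 2 ^ j < s - 2 ^ j" using le by linarith
    show ?case
      using dec f b frame tab mem time j(5) \<open>j < h\<close> reg'(3) j(2) le
      by (auto simp: wp_simps written_level_body written_node_body intro!: exI[of _ "Suc j"])
  qed
  note this[unfolded r1_def, simplified]
  then show ?case
    unfolding level_body_def using reg' j(2) le bnd
    by (simp add: wp_simps mult_2)
next
  case (3 r' m' n')
  then obtain j where j: "j \<le> h" "r' rL = 2 ^ j" "n' \<le> n + (170 * s + 10) * j"
    "\<forall>z<4 * s. m' (r' rSrc + z) = table c s (2 ^ j) z"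
    "r' rSrc = b0 \<and> r' rDst = b0 + 4 * s \<or> r' rDst = b0 \<and> r' rSrc = b0 + 4 * s" "\<forall>a<b0. m' a = m a"
    and fr: "\<forall>k. k \<notin> written level_body \<longrightarrow> r' k = r k" by blast
  have "r' rS = s" using fr reg unfolding written_level_body written_node_body by simp
  then have "\<not> j < h" using 3(2) j(2) s by simp
  then have "j = h" using j(1) by simp
  then show ?case using j s by auto
qed

end

section \<open>The candidate values\<close>

abbreviation (input) "rP \<equiv> 0 :: nat"
abbreviation (input) "rQ \<equiv> 1 :: nat"
abbreviation (input) "rX \<equiv> 4 :: nat"
abbreviation (input) "rY \<equiv> 5 :: nat"
abbreviation (input) "rE \<equiv> 6 :: nat"
abbreviation (input) "rW \<equiv> 7 :: nat"
abbreviation (input) "rBest \<equiv> 8 :: nat"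
abbreviation (input) "rTwo \<equiv> 10 :: nat"
abbreviation (input) "rPtr \<equiv> 11 :: nat"
abbreviation (input) "rTmp \<equiv> 12 :: nat"
abbreviation (input) "rD1 \<equiv> 14 :: nat"
abbreviation (input) "rD2 \<equiv> 15 :: nat"
abbreviation (input) "rY0 \<equiv> 16 :: nat"
abbreviation (input) "rYL \<equiv> 17 :: nat"
abbreviation (input) "rBase \<equiv> 18 :: nat"
abbreviation (input) "rK \<equiv> 19 :: nat"
abbreviation (input) "rT \<equiv> 24 :: nat"
abbreviation (input) "rSum \<equiv> 45 :: nat"

definition stored :: "(nat \<Rightarrow> nat) \<Rightarrow> nat \<Rightarrow> (nat \<times> nat) list \<Rightarrow> bool" where
  "stored m a rs \<longleftrightarrow> (\<forall>i<length rs. m (a + 2 * i) = fst (rs ! i) \<and> m (a + 2 * i + 1) = snd (rs ! i))"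

text \<open>For bits, \<open>(a - b) + (b - a)\<close> with truncated subtraction is 1 exactly if
  they differ. An encoding of \<open>p\<close> pairs ends with its last letter at offset
  \<open>2 * p - 1\<close>, preceded by the length of that run.\<close>

definition prepare :: com where
  "prepare =
     add rTmp rX rOne ;; load rA rTmp ;; add rTmp rY rOne ;; load rB rTmp ;;
     sub rC rA rB ;; sub rD1 rB rA ;; add rD1 rD1 rC ;;
     add rTmp rP rP ;; add rTmp rTmp rX ;; sub rTmp rTmp rOne ;; load rA rTmp ;;
     add rTmp rQ rQ ;; add rTmp rTmp rY ;; sub rTmp rTmp rOne ;; load rB rTmp ;;
     sub rTmp rTmp rOne ;; load rYL rTmp ;; sub rC rA rB ;; sub rD2 rB rA ;; add rD2 rD2 rC ;;
     load rY0 rY ;; mul rBase rD1 rY0 ;; mul rTmp rD2 rYL ;; add rBase rBase rTmp ;;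
     sub rK rP rQ ;; add rK rK rD1 ;; add rK rK rD2 ;; quot rK rK rTwo"

definition size_loop :: com where
  "size_loop = const rS 1 ;; While rS rP (add rS rS rS)"

definition fill_body :: com where
  "fill_body =
     const rB 0 ;; Cond rT rP (add rTmp rT rT ;; add rTmp rTmp rX ;; load rA rTmp ;;
         sub rB rW rA) Skip ;;
     add rTmp rSrc rT ;; store rTmp rB ;; add rT rT rOne"

definition patch :: "nat \<Rightarrow> nat \<Rightarrow> nat \<Rightarrow> com" where
  "patch i j k = load rA i ;; add rA rA j ;; mul rA rA k ;; store i rA"

text \<open>The patches follow the order of the factors in \<open>item\<close>, which matters when a
  single run is both first and last.\<close>

definition fill :: com where
  "fill = add rSS rS rS ;; add rS4 rSS rSS ;; add rSrc rE rZero ;; add rDst rE rS4 ;;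
     const rT 0 ;; While rT rS4 fill_body ;;
     patch rSrc rY0 rD1 ;; add rTmp rSrc rP ;; sub rTmp rTmp rOne ;; patch rTmp rYL rD2"

definition sum_loop :: com where
  "sum_loop = const rSum 0 ;; const rT 0 ;;
     While rT rK (add rTmp rSrc rT ;; load rA rTmp ;; add rSum rSum rA ;; add rT rT rOne)"

text \<open>Lowers register \<open>rBest\<close> to the candidate in which the longer encoding is the one at \<open>rX\<close>.\<close>

definition pass :: com where
  "pass = prepare ;; size_loop ;; fill ;; const rL 1 ;; While rL rS level_body ;; sum_loop ;;
     mul rA rK rW ;; add rA rA rBase ;; sub rA rA rSum ;; Cond rA rBest (add rBest rA rZero) Skip"

lemma wp_size_loop:
  assumes "0 < r rP" "2 * r rP < B"
  shows "wp B size_loop (\<lambda>r' m' n'. m' = m \<and>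
    (\<exists>h. r' rS = 2 ^ h \<and> r rP \<le> 2 ^ h \<and> 2 ^ h < 2 * r rP \<and> n' \<le> n + 3 * h + 3)) r m n"
proof -
  have "wp B (While rS rP (add rS rS rS)) (\<lambda>r' m' n'. m' = m \<and>
    (\<exists>h. r' rS = 2 ^ h \<and> r rP \<le> 2 ^ h \<and> 2 ^ h < 2 * r rP \<and> n' \<le> n + 3 * h + 3)) (r(rS := 1)) m (Suc
        n)"
  proof (rule wp_While[where I = "\<lambda>r' m' n'. m' = m \<and> r' rP = r rP \<and>
      (\<exists>h. r' rS = 2 ^ h \<and> 2 ^ h < 2 * r rP \<and> n' \<le> n + 3 * h + 1)" and \<mu> = "\<lambda>r' m'. 2 * r' rP - r'
          rS"], goal_cases)
    case 1
    then show ?case using assms by (auto intro!: exI[of _ 0])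
  next
    case (2 r' m' n')
    then obtain h where "m' = m" "r' rP = r rP" "r' rS = 2 ^ h" "2 ^ h < 2 * r rP"
        "n' \<le> n + 3 * h + 1" by blast
    moreover have "(0 :: nat) < 2 ^ h" by simp
    moreover from calculation have "2 * r rP - (2 ^ h + 2 ^ h) < 2 * r rP - 2 ^ h" using 2(2)
        by linarith
    ultimately show ?case using 2(2) assms by (auto simp: wp_simps intro!: exI[of _ "Suc h"])
  qed auto
  then show ?thesis using assms unfolding size_loop_def by (simp add: wp_simps)
qed

lemma wp_sum_loop:
  assumes reg: "r rOne = 1" "r rSrc = src" "r rK = k" and g: "\<forall>t<k. m (src + t) = g t"
    and b: "src + k < B" "(\<Sum>t<k. g t) < B"
  shows "wp B sum_loop (\<lambda>r' m' n'. m' = m \<and> r' rSum = (\<Sum>t<k. g t) \<and> n' \<le> n + 6 * k + 4) r m n"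
proof -
  have loop: "wp B (While rT rK (add rTmp rSrc rT ;; load rA rTmp ;; add rSum rSum rA ;;
      add rT rT rOne))
      (\<lambda>r' m' n'. m' = m \<and> r' rSum = (\<Sum>t<k. g t) \<and> n' \<le> n + 6 * k + 4) (r(rSum := 0, rT := 0)) m n0"
    if n0: "n0 \<le> n + 2" for n0
  proof (rule wp_While[where I = "\<lambda>r' m' n'. m' = m \<and> r' rT \<le> k \<and> r' rSum = (\<Sum>t<r' rT. g t) \<and>
      n' \<le> n + 2 + 6 * r' rT \<and>
      r' rOne = 1 \<and> r' rSrc = src \<and> r' rK = k" and \<mu> = "\<lambda>r' m'. k - r' rT"], goal_cases)
    case (2 r' m' n')
    then have I: "m' = m" "r' rSum = (\<Sum>t<r' rT. g t)" "n' \<le> n + 2 + 6 * r' rT" "r' rOne = 1"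
        "r' rSrc = src" "r' rK = k"
      and t: "r' rT < k" by auto
    have "(\<Sum>t<Suc (r' rT). g t) \<le> (\<Sum>t<k. g t)" using t by (intro sum_mono2) auto
    then have "(\<Sum>t<r' rT. g t) + g (r' rT) < B" using b(2) by simp
    then show ?case using I t g b(1) by (simp add: wp_simps)
  qed (use n0 reg in auto)
  show ?thesis unfolding sum_loop_def using b loop by (simp add: wp_simps)
qed

lemma best_sum_extend:
  assumes "\<And>i. p \<le> i \<Longrightarrow> c i = 0" "p \<le> s"
  shows "best_sum c 0 s k = best_sum c 0 p k"
proof (rule antisym)
  show "best_sum c 0 s k \<le> best_sum c 0 p k"
  proof (rule best_sum_leI)
    fix S assume S: "S \<subseteq> {0..<s}" "indep S" "card S \<le> k"
    have fin: "finite S" using S(1) finite_subset by blast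
    have "sum c S = sum c (S \<inter> {..<p})" using fin assms(1)[OF leI]
        by (intro sum.mono_neutral_right) auto
    also have "\<dots> \<le> best_sum c 0 p k"
      using S indep_subset[OF S(2)] card_mono[OF fin, of "S \<inter> {..<p}"] by (intro best_sum_ge) auto
    finally show "sum c S \<le> best_sum c 0 p k" .
  qed
  show "best_sum c 0 p k \<le> best_sum c 0 s k"
    by (rule best_sum_leI) (use assms(2) in \<open>auto intro!: best_sum_ge\<close>)
qed

lemma gain_single: "gain c q (Suc q) 0 = c q"
proof -
  have "best_sum c q (Suc q) (Suc 0) = c q"
  proof (rule antisym)
    show "c q \<le> best_sum c q (Suc q) (Suc 0)"
      using best_sum_ge[of "{q}" q "Suc q" "Suc 0" c] by (simp add: indep_def)
    show "best_sum c q (Suc q) (Suc 0) \<le> c q"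
    proof (rule best_sum_leI)
      fix S assume "S \<subseteq> {q..<Suc q}"
      then have "S = {} \<or> S = {q}" by auto
      then show "sum c S \<le> c q" by auto
    qed
  qed
  then show ?thesis by (simp add: gain_def)
qed

text \<open>A block of one item becomes empty as soon as either end is excluded, so only the first
  of the four copies is nonzero.\<close>

lemma table_leaf:
  assumes "0 < s"
  shows "table c s 1 z = (if z < s then c z else 0)"
proof (cases "z < s")
  case True
  then show ?thesis by (simp add: table_def gain_single)
next
  case False
  have "1 \<le> z div (2 * s) \<or> z div s mod 2 = 1"
  proof (cases "z < 2 * s")
    case True
    then have "z div s = 1" using False by (simp add: div_nat_eqI)
    then show ?thesis by simp
  next
    case False
    then show ?thesis using assms by (simp add: Suc_le_eq div_greater_zero_iff)
  qed
  then show ?thesis using False unfolding table_def Let_def by (auto intro!: gain_eq_0)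
qed

lemma table_root: "t < s \<Longrightarrow> table c s s t = gain c 0 s t"
  by (simp add: table_def)

context
  fixes rs ts :: "(nat \<times> nat) list" and W X Y b0 B d e :: nat and m0 :: "nat \<Rightarrow> nat"
      and xs ys :: "nat list"
  assumes d_def: "d = of_bool (snd (hd rs) \<noteq> snd (hd ts))"
      and e_def: "e = of_bool (snd (last rs) \<noteq> snd (last ts))"
    and xs_def: "xs = map fst rs" and ys_def: "ys = map fst ts"
    and ne: "rs \<noteq> []" "ts \<noteq> []" and bin: "\<And>i. i < length rs \<Longrightarrow> snd (rs ! i) \<le> 1" "\<And>i. i < length ts \<Longrightarrow>
        snd (ts ! i) \<le> 1"
    and le: "length ts \<le> length rs" and W: "\<And>i. i < length rs \<Longrightarrow> fst (rs ! i) \<le> W"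
        "\<And>i. i < length ts \<Longrightarrow> fst (ts ! i) \<le> W"
    and lenW: "length rs \<le> W"
    and xy: "X + 2 * length rs \<le> b0" "Y + 2 * length ts \<le> b0" "b0 \<le> 2 * W"
    and B: "30 * (W * W) + 30 * W < B"
    and st: "stored m0 X rs" "stored m0 Y ts"
begin

lemma de: "d \<le> 1" "e \<le> 1"
  unfolding d_def e_def by auto

text \<open>\<open>30 * W\<close> covers the addresses: the input ends by \<open>2 * W\<close>, and
  \<open>10 * s\<close> is below \<open>20 * W\<close> because \<open>s < 2 * length rs\<close>. The
  quadratic term covers totals of items, each at most \<open>3 * W\<close>, and the product of
  \<open>excess\<close> and \<open>W\<close>.\<close>

lemma W_pos: "0 < W" "30 * W < B"
proof -
  show "0 < W" using ne(1) lenW by (cases rs) auto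
  then show "30 * W < B" using B by simp
qed

lemma ys_le: "hd ys \<le> W" "last ys \<le> W"
  unfolding ys_def using W(2)[of 0] W(2)[of "length ts - 1"] ne(2)
      by (simp_all add: hd_map last_map hd_conv_nth last_conv_nth)

lemma wp_prepare:
  assumes reg: "r rOne = 1" "r rTwo = 2" "r rP = length rs" "r rQ = length ts" "r rX = X" "r rY = Y"
    and m: "\<forall>a<b0. m a = m0 a"
  shows "wp B prepare (\<lambda>r' m' n'. m' = m \<and> n' \<le> n + 28 \<and> r' rD1 = d \<and> r' rD2 = e \<and> r' rY0 = hd ys \<and>
      r' rYL = last ys \<and>
    r' rBase = d * hd ys + e * last ys \<and> r' rK = excess d e xs ys) r m n"
proof -
  have p: "0 < length rs" "0 < length ts" using ne by auto
  have mm: "m a = m0 a" if "a < b0" for a using m that by blast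
  have s1: "m (X + 1) = snd (hd rs)" "m (Y + 1) = snd (hd ts)" "m Y = hd ys"
  proof -
    have "X + 1 < b0" "Y + 1 < b0" "Y < b0" using xy p by linarith+
    then show "m (X + 1) = snd (hd rs)" "m (Y + 1) = snd (hd ts)" "m Y = hd ys"
      using mm st(1)[unfolded stored_def, rule_format, OF p(1)] st(2)[unfolded stored_def,
          rule_format, OF p(2)] ne
      by (simp_all add: hd_conv_nth hd_map ys_def)
  qed
  have lst: "m (length rs + length rs + X - 1) = snd (last rs)"
  proof -
    have i: "length rs - 1 < length rs" using p by simp
    have "length rs + length rs + X - 1 = X + 2 * (length rs - 1) + 1" using p(1) by linarith
    then show ?thesis using st(1) i mm[of "length rs + length rs + X - 1"] xy(1) p ne
        unfolding stored_def
      by (simp add: last_conv_nth)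
  qed
  have lst': "m (length ts + length ts + Y - 1) = snd (last ts)"
      "m (length ts + length ts + Y - 1 - 1) = last ys"
  proof -
    have i: "length ts - 1 < length ts" using p by simp
    have e: "length ts + length ts + Y - 1 = Y + 2 * (length ts - 1) + 1"
        "length ts + length ts + Y - 1 - 1 = Y + 2 * (length ts - 1)"
      using p(2) by linarith+
    have "Y + 2 * (length ts - 1) + 1 < b0" "Y + 2 * (length ts - 1) < b0" using xy(2) p(2)
        by linarith+
    then show "m (length ts + length ts + Y - 1) = snd (last ts)"
        "m (length ts + length ts + Y - 1 - 1) = last ys"
      using st(2) i mm[of "Y + 2 * (length ts - 1)"] mm[of "Y + 2 * (length ts - 1) + 1"] ne
          unfolding stored_def e
      by (simp_all add: last_conv_nth last_map ys_def)
  qed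
  have bits: "snd (hd rs) \<le> 1" "snd (hd ts) \<le> 1" "snd (last rs) \<le> 1" "snd (last ts) \<le> 1"
    using bin(1)[of 0] bin(2)[of 0] bin(1)[of "length rs - 1"] bin(2)[of "length ts - 1"] p ne
    by (simp_all add: hd_conv_nth last_conv_nth)
  have dd: "snd (hd ts) - snd (hd rs) + (snd (hd rs) - snd (hd ts)) = d"
    "snd (last ts) - snd (last rs) + (snd (last rs) - snd (last ts)) = e"
    using bits unfolding d_def e_def by (auto simp: le_Suc_eq)
  have dy: "d * hd ys \<le> W" "e * last ys \<le> W" using de ys_le by (auto simp: le_Suc_eq)
  define ax ay az where "ax = length rs + length rs + X - 1"
      and "ay = length ts + length ts + Y - 1" and "az = ay - 1"
  define c1 c2 c3 c4 where "c1 = snd (hd rs) - snd (hd ts)" and "c2 = snd (hd ts) - snd (hd rs)"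
    and "c3 = snd (last rs) - snd (last ts)" and "c4 = snd (last ts) - snd (last rs)"
  define k where "k = length rs - length ts"
  note abs = ax_def[symmetric] ay_def[symmetric] az_def[symmetric] c1_def[symmetric]
      c2_def[symmetric]
    c3_def[symmetric] c4_def[symmetric] k_def[symmetric]
  have loads: "m ax = snd (last rs)" "m ay = snd (last ts)" "m az = last ys"
    unfolding az_def unfolding ax_def ay_def using lst lst' by simp_all
  have bb: "X + 1 < B" "Y + 1 < B" "length rs + length rs + X < B" "length ts + length ts + Y < B"
    "length rs + length rs < B" "length ts + length ts < B" "d < B" "e < B"
    "d * hd ys < B" "e * last ys < B" "d * hd ys + e * last ys < B"
    "k + d < B" "k + d + e < B" "k < B" "ax < B" "ay < B" "az < B" "c1 < B" "c2 < B" "c3 < B"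
        "c4 < B"
    "excess d e xs ys < B"
  proof -
    have up: "ax \<le> length rs + length rs + X" "ay \<le> length ts + length ts + Y" "az \<le> ay"
        "c1 \<le> snd (hd rs)"
      "c2 \<le> snd (hd ts)" "c3 \<le> snd (last rs)" "c4 \<le> snd (last ts)" "k \<le> length rs"
          "excess d e xs ys \<le> k + d + e"
      unfolding ax_def ay_def az_def c1_def c2_def c3_def c4_def k_def excess_def xs_def ys_def
          by simp_all
    show "X + 1 < B" "Y + 1 < B" "length rs + length rs + X < B" "length ts + length ts + Y < B"
      "length rs + length rs < B" "length ts + length ts < B" "d < B" "e < B"
      "d * hd ys < B" "e * last ys < B" "d * hd ys + e * last ys < B"
      "k + d < B" "k + d + e < B" "k < B" "ax < B" "ay < B" "az < B" "c1 < B" "c2 < B" "c3 < B"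
          "c4 < B"
      "excess d e xs ys < B"
      using up xy W_pos lenW de dy p le bits by linarith+
  qed
  have ex: "(k + d + e) div 2 = excess d e xs ys" unfolding excess_def k_def xs_def ys_def by simp
  have dd': "c2 + c1 = d" "c4 + c3 = e" using dd unfolding c1_def c2_def c3_def c4_def by simp_all
  have n: "r (Suc 0) = length ts" "m (Suc X) = snd (hd rs)" "m (Suc Y) = snd (hd ts)" "Suc X < B"
      "Suc Y < B"
    "length rs + length rs + X - Suc 0 = ax" "length ts + length ts + Y - Suc 0 = ay"
        "length ts + length ts + Y - Suc (Suc 0) = az"
    "ay - Suc 0 = az"
    using reg s1 bb(1,2) unfolding az_def unfolding ax_def ay_def by simp_all
  show ?thesis
    unfolding prepare_def by (simp add: wp_simps reg bb s1 loads dd' ex n abs)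
qed

lemma wp_fill_loop:
  assumes reg: "r rOne = 1" "r rP = length rs" "r rX = X" "r rW = W" "r rSrc = b0" "r rS4 = s4"
      "r rT = 0"
    and m: "\<forall>a<b0. m a = m0 a" and s4: "b0 + s4 < B"
  shows "wp B (While rT rS4 fill_body) (\<lambda>r' m' n'. n' \<le> n + 12 * s4 + 2 \<and>
    m' = (\<lambda>a. if b0 \<le> a \<and> a < b0 + s4 then (if a - b0 < length rs then W - xs ! (a - b0) else 0)
        else m a)) r m n"
proof (rule wp_While[where I = "\<lambda>r' m' n'. r' rT \<le> s4 \<and> n' \<le> n + 12 * r' rT \<and>
    m' = (\<lambda>a. if b0 \<le> a \<and> a < b0 + r' rT then (if a - b0 < length rs then W - xs ! (a - b0) else 0)
        else m a) \<and>
    (\<forall>k. k \<notin> {rT, rA, rB, rTmp} \<longrightarrow> r' k = r k)" and \<mu> = "\<lambda>r' m'. s4 - r' rT"], goal_cases)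
  case 1
  then show ?case using reg by auto
next
  case (2 r' m' n')
  then have I: "n' \<le> n + 12 * r' rT" "\<forall>k. k \<notin> {rT, rA, rB, rTmp} \<longrightarrow> r' k = r k" and
    m': "m' = (\<lambda>a. if b0 \<le> a \<and> a < b0 + r' rT then (if a - b0 < length rs then W - xs ! (a - b0)
        else 0) else m a)" by auto
  have reg': "r' rOne = 1" "r' rP = length rs" "r' rX = X" "r' rW = W" "r' rSrc = b0" "r' rS4 = s4"
    using I(2) reg by simp_all
  have t: "r' rT < s4" using 2(2) reg' by simp
  let ?v = "if r' rT < length rs then W - xs ! r' rT else 0"
  have ld: "m' (r' rT + r' rT + X) = xs ! r' rT \<and> r' rT + r' rT + X < B" if "r' rT < length rs"
  proof -
    have "r' rT + r' rT + X < b0" using xy(1) that by linarith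
    then have "m' (r' rT + r' rT + X) = m0 (X + 2 * r' rT)" unfolding m' using m
        by (simp add: add.commute mult_2)
    then show ?thesis using st(1) that \<open>r' rT + r' rT + X < b0\<close> s4 unfolding stored_def xs_def
        by simp
  qed
  have m'': "m'(b0 + r' rT := ?v) = (\<lambda>a. if b0 \<le> a \<and> a < b0 + Suc (r' rT) then (if a - b0 < length
      rs then W - xs ! (a - b0) else 0) else m a)"
    unfolding m' by (auto simp: fun_eq_iff less_Suc_eq)
  have WB: "W < B" "0 < B" "X < B" using W_pos xy by simp_all
  show ?case
  proof (cases "r' rT < length rs")
    case True
    then show ?thesis unfolding fill_body_def using t I reg' ld m'' s4 WB
      by (simp add: wp_simps less_imp_diff_less)
  next
    case False
    then show ?thesis unfolding fill_body_def using t I reg' m'' s4 WB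
      by (simp add: wp_simps)
  qed
next
  case (3 r' m' n')
  then have "r' rT = s4" using reg by simp
  then show ?case using 3 by auto
qed

lemma wp_fill:
  assumes reg: "r rOne = 1" "r rZero = 0" "r rP = length rs" "r rX = X" "r rW = W" "r rE = b0"
      "r rS = s"
      "r rY0 = hd ys" "r rYL = last ys" "r rD1 = d" "r rD2 = e"
    and m: "\<forall>a<b0. m a = m0 a" and s: "length rs \<le> s" "s < 2 * length rs"
  shows "wp B fill (\<lambda>r' m' n'. n' \<le> n + 48 * s + 17 \<and> r' rSS = 2 * s \<and> r' rS4 = 4 * s \<and>
      r' rSrc = b0 \<and>
    r' rDst = b0 + 4 * s \<and> (\<forall>a<b0. m' a = m0 a) \<and> (\<forall>z<4 * s. m' (b0 + z) = (if z < s then item W d e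
        xs ys z else 0))) r m n"
proof -
  define r1 where "r1 = r(rSS := 2 * s, rS4 := 4 * s, rSrc := b0, rDst := b0 + 4 * s, rT := 0)"
  have r1: "r1 rOne = 1" "r1 rP = length rs" "r1 rX = X" "r1 rW = W" "r1 rSrc = b0" "r1 rS4 = 4 * s"
      "r1 rT = 0"
    unfolding r1_def using reg by simp_all
  have p: "0 < length rs" using ne by simp
  have b: "b0 + 4 * s < B" "b0 + length rs < B" using xy(3) s lenW W_pos by linarith+
  define m1 where "m1 = (\<lambda>a. if b0 \<le> a \<and> a < b0 + 4 * s then (if a - b0 < length rs then W - xs ! (a
      - b0) else 0) else m a)"
  define m2 where "m2 = m1(b0 := (m1 b0 + hd ys) * d)"
  define l where "l = b0 + length rs - 1"
  define m3 where "m3 = m2(l := (m2 l + last ys) * e)"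
  have l: "b0 \<le> l" "l < b0 + 4 * s" unfolding l_def using p s by linarith+
  have v1: "m1 b0 \<le> W" unfolding m1_def using l by auto
  then have v1': "(m1 b0 + hd ys) * d \<le> 2 * W" using de(1) ys_le(1) by (auto simp: le_Suc_eq)
  have "m1 l \<le> W" unfolding m1_def using l by auto
  then have v2: "m2 l \<le> 2 * W" unfolding m2_def using v1' by simp
  then have v2': "(m2 l + last ys) * e \<le> 3 * W" using de(2) ys_le(2) by (auto simp: le_Suc_eq)
  have vb: "m1 b0 + hd ys < B" "(m1 b0 + hd ys) * d < B" "m2 l + last ys < B"
      "(m2 l + last ys) * e < B"
    using v1 v1' v2 v2' ys_le W_pos by linarith+
  have m3: "m3 (b0 + z) = (if z < s then item W d e xs ys z else 0)" if "z < 4 * s" for z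
  proof -
    have "b0 + z = l \<longleftrightarrow> z = length xs - 1" unfolding l_def xs_def length_map using p by arith
    then show ?thesis
      using that s l(1) unfolding m3_def m2_def m1_def item_def Let_def xs_def by auto
  qed
  have low: "m3 a = m0 a" if "a < b0" for a using that m l unfolding m3_def m2_def m1_def by auto
  define Q where "Q = (\<lambda>r' m' n'. n' \<le> n + 48 * s + 17 \<and> r' rSS = 2 * s \<and> r' rS4 = 4 * s \<and>
      r' rSrc = b0 \<and>
    r' rDst = b0 + 4 * s \<and> (\<forall>a<b0. m' a = m0 a) \<and> (\<forall>z<4 * s. m' (b0 + z) = (if z < s then item W d e
        xs ys z else 0)))"
  have loop: "wp B (While rT rS4 fill_body) (\<lambda>r' m' n'. n' \<le> n0 + 12 * (4 * s) + 2 \<and>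
      m' = m1) r1 m n0" for n0
    unfolding m1_def by (rule wp_fill_loop[OF r1 m b(1)])
  have fix2: "wp B (add rTmp rSrc rP ;; sub rTmp rTmp rOne ;; patch rTmp rYL rD2) Q ra m2 na"
    if "ra rSrc = b0" "ra rP = length rs" "ra rOne = 1" "ra rYL = last ys" "ra rD2 = e"
      "ra rSS = 2 * s" "ra rS4 = 4 * s" "ra rDst = b0 + 4 * s" "na \<le> n + 48 * s + 11" for ra na
  proof -
    have "b0 + length rs - Suc 0 = l" "l < B" unfolding l_def using b by simp_all
    then show ?thesis unfolding patch_def wp_simps using that b vb m3 low
      by (simp add: m3_def[symmetric] Q_def)
  qed
  have fix1: "wp B (patch rSrc rY0 rD1) (wp B (add rTmp rSrc rP ;; sub rTmp rTmp rOne ;;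
      patch rTmp rYL rD2) Q) ra m1 na"
    if "ra rSrc = b0" "ra rP = length rs" "ra rOne = 1" "ra rYL = last ys" "ra rD2 = e"
        "ra rY0 = hd ys" "ra rD1 = d"
      "ra rSS = 2 * s" "ra rS4 = 4 * s" "ra rDst = b0 + 4 * s" "na \<le> n + 48 * s + 7" for ra na
  proof -
    have "wp B (patch rSrc rY0 rD1) (\<lambda>r' m' n'. m' = m2 \<and> n' \<le> na + 4) ra m1 na"
      unfolding patch_def wp_simps using that vb by (simp add: m2_def)
    then show ?thesis
    proof (rule wp_post, intro allI impI, elim conjE, goal_cases)
      case (1 rb mb nb)
      have "wp B (add rTmp rSrc rP ;; sub rTmp rTmp rOne ;; patch rTmp rYL rD2) Q rb m2 nb"
        by (rule fix2) (use 1 that in \<open>simp_all add: patch_def\<close>)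
      then show ?case using 1 by simp
    qed
  qed
  have fin: "wp B (While rT rS4 fill_body)
      (wp B (patch rSrc rY0 rD1 ;; add rTmp rSrc rP ;; sub rTmp rTmp rOne ;;
          patch rTmp rYL rD2) Q) r1 m n0"
    if n0: "n0 \<le> n + 5" for n0
  proof (rule wp_post[OF loop], intro allI impI, elim conjE, goal_cases)
    case (1 ra ma na)
    then have fr: "\<forall>k. k \<notin> {rT, rA, rB, rTmp} \<longrightarrow> ra k = r1 k" by (simp add: fill_body_def)
    have "wp B (patch rSrc rY0 rD1) (wp B (add rTmp rSrc rP ;; sub rTmp rTmp rOne ;;
        patch rTmp rYL rD2) Q) ra m1 na"
      by (rule fix1) (use fr reg 1(2) n0 in \<open>simp_all add: r1_def\<close>)
    then show ?case using 1 unfolding wp_Seq[of B "patch rSrc rY0 rD1"] by simp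
  qed
  have ss: "s + s = 2 * s" "2 * s + 2 * s = 4 * s" by simp_all
  show ?thesis
    unfolding fill_def Q_def[symmetric] using b reg fin[unfolded r1_def] by (simp add: wp_simps ss)
qed

lemma item_le: "item W d e xs ys i \<le> 3 * W"
proof -
  define v where "v = (if i < length xs then W - xs ! i else 0)"
  have v: "v \<le> W" unfolding v_def by simp
  have v1: "(v + hd ys) * d \<le> 2 * W" using v de(1) ys_le(1) by (auto simp: le_Suc_eq)
  have v2: "(v' + last ys) * e \<le> 3 * W" if "v' \<le> 2 * W" for v'
    using that de(2) ys_le(2) by (auto simp: le_Suc_eq)
  show ?thesis unfolding item_def Let_def v_def[symmetric]
      using v v1 v2[of v] v2[of "(v + hd ys) * d"] by auto
qed

lemma item_eq_0: "length rs \<le> i \<Longrightarrow> item W d e xs ys i = 0"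
  using ne(1) unfolding item_def Let_def xs_def by (cases rs) auto

lemma sum_item_less: "sum (item W d e xs ys) {0..<s} < B"
proof -
  have "sum (item W d e xs ys) {0..<s} \<le> sum (item W d e xs ys) {0..<max s (length rs)}"
    by (intro sum_mono2) auto
  also have "\<dots> = sum (item W d e xs ys) {0..<length rs}"
    using item_eq_0 by (intro sum.mono_neutral_right) auto
  also have "\<dots> \<le> (\<Sum>i\<in>{0..<length rs}. 3 * W)" by (intro sum_mono item_le)
  also have "\<dots> = 3 * (length rs * W)" by simp
  also have "length rs * W \<le> W * W" using lenW by simp
  finally show ?thesis using B by linarith
qed

lemma excess_le: "excess d e xs ys \<le> length rs"
proof -
  have "0 < length ts" "0 < length rs" using ne by simp_all
  then have "length xs - length ys + d + e \<le> length rs + 1" using de le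
      unfolding xs_def ys_def length_map by linarith
  then show ?thesis using \<open>0 < length rs\<close> unfolding excess_def by linarith
qed

text \<open>With \<open>s = 2 ^ h\<close>, the levels take \<open>(170 * s + 10) * h\<close>,
  finding \<open>s\<close> takes \<open>3 * h\<close>, filling \<open>48 * s\<close> and summing at
  most \<open>6 * s\<close>, up to constants that \<open>s \<ge> 1\<close> absorbs.\<close>

lemma wp_pass:
  assumes reg: "r rOne = 1" "r rZero = 0" "r rTwo = 2" "r rP = length rs" "r rQ = length ts"
      "r rX = X" "r rY = Y" "r rE = b0" "r rW = W"
    and m: "\<forall>a<b0. m a = m0 a"
  shows "wp B pass (\<lambda>r' m' n'. r' rBest = min (r rBest) (candidate W d e xs ys) \<and>
      (\<forall>a<b0. m' a = m0 a) \<and>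
    (\<exists>h. 2 ^ h < 2 * length rs \<and> n' \<le> n + 183 * (2 ^ h * h) + 120 * 2 ^ h)) r m n"
proof -
  let ?k = "excess d e xs ys" and ?c = "item W d e xs ys"
  define Q where "Q = (\<lambda>r' m' n'. r' rBest = min (r rBest) (candidate W d e xs ys) \<and>
      (\<forall>a<b0. m' a = m0 a) \<and>
    (\<exists>h. 2 ^ h < 2 * length rs \<and> n' \<le> n + 183 * (2 ^ h * h) + 120 * 2 ^ h))"
  define tl4 where "tl4 = (mul rA rK rW ;; add rA rA rBase ;; sub rA rA rSum ;;
      Cond rA rBest (add rBest rA rZero) Skip)"
  define tl3 where "tl3 = (sum_loop ;; tl4)"
  define tl2 where "tl2 = (const rL 1 ;; While rL rS level_body ;; tl3)"
  define tl1 where "tl1 = (fill ;; tl2)"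
  have prog: "pass = (prepare ;; size_loop ;; tl1)" unfolding pass_def tl1_def tl2_def tl3_def
      tl4_def ..
  have p0: "0 < length rs" using ne by simp
  have base: "d * hd ys + e * last ys \<le> 2 * W" using de ys_le by (auto simp: le_Suc_eq)
  have kW: "?k * W \<le> W * W" using excess_le lenW by simp
  have s4: "wp B tl4 Q ra ma na"
    if "ra rK = ?k" "ra rW = W" "ra rBase = d * hd ys + e * last ys"
        "ra rSum = best_sum ?c 0 (length xs) ?k" "ra rBest = r rBest" "ra rZero = 0"
      "\<forall>a<b0. ma a = m0 a" "2 ^ h < 2 * length rs" "na + 6 \<le> n + 183 * (2 ^ h * h) + 120 * 2 ^ h"
          for ra ma na h
  proof -
    have c: "?k * W + (d * hd ys + e * last ys) - best_sum ?c 0 (length xs) ?k = candidate W d e xs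
        ys"
      unfolding candidate_def by simp
    have "candidate W d e xs ys \<le> W * W + 2 * W" unfolding c[symmetric] using base kW by linarith
    then have bb: "?k * W < B" "?k * W + (d * hd ys + e * last ys) < B" "candidate W d e xs ys < B"
      using base kW B W_pos by linarith+
    show ?thesis unfolding tl4_def Q_def using that bb c
      by (auto simp: wp_simps intro!: exI[of _ h])
  qed
  have s3: "wp B tl3 Q ra ma na"
    if reg3: "ra rK = ?k" "ra rW = W" "ra rBase = d * hd ys + e * last ys" "ra rBest = r rBest"
        "ra rZero = 0" "ra rOne = 1"
      and src: "ra rSrc \<le> b0 + 4 * 2 ^ h" and tab:
          "\<forall>z<4 * 2 ^ h. ma (ra rSrc + z) = table ?c (2 ^ h) (2 ^ h) z"
      and mem: "\<forall>a<b0. ma a = m0 a" and h: "length rs \<le> 2 ^ h" "2 ^ h < 2 * length rs"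
      and na: "na + 6 * 2 ^ h + 10 \<le> n + 183 * (2 ^ h * h) + 120 * 2 ^ h" for ra ma na h
  proof -
    have kh: "?k \<le> 2 ^ h" using excess_le h by simp
    have g: "\<forall>t<?k. ma (ra rSrc + t) = gain ?c 0 (2 ^ h) t" using tab kh by (simp add: table_root)
    have eq: "(\<Sum>t<?k. gain ?c 0 (2 ^ h) t) = best_sum ?c 0 (length xs) ?k"
      using best_sum_extend[of "length xs" ?c "2 ^ h" ?k] item_eq_0 h(1)
          by (simp add: best_sum_eq_gains xs_def)
    have b: "ra rSrc + ?k < B" using src kh h(2) xy(3) lenW W_pos by linarith
    have b': "(\<Sum>t<?k. gain ?c 0 (2 ^ h) t) < B"
      unfolding best_sum_eq_gains[symmetric] using best_sum_le_sum[of ?c 0 "2 ^ h" ?k]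
          sum_item_less[of "2 ^ h"] by linarith
    show ?thesis
      unfolding tl3_def wp_Seq
    proof (rule wp_post[OF wp_sum_loop[OF reg3(6) refl reg3(1) g b b']], intro allI impI,
        elim conjE, goal_cases)
      case (1 rb mb nb)
      have fr: "k \<notin> {rSum, rT, rTmp, rA} \<Longrightarrow> rb k = ra k" for k using 1(1) by (simp add: sum_loop_def)
      show ?case
        by (rule s4[where h = h]) (use 1(2-) fr reg3 mem h na kh eq in \<open>auto\<close>)
    qed
  qed
  have s2: "wp B tl2 Q ra ma na"
    if reg2: "ra rK = ?k" "ra rW = W" "ra rBase = d * hd ys + e * last ys" "ra rBest = r rBest"
        "ra rZero = 0" "ra rOne = 1"
      "ra rS = 2 ^ h" "ra rSS = 2 * 2 ^ h" "ra rS4 = 4 * 2 ^ h" "ra rSrc = b0"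
          "ra rDst = b0 + 4 * 2 ^ h"
      and tab: "\<forall>z<4 * 2 ^ h. ma (b0 + z) = (if z < 2 ^ h then ?c z else 0)"
      and mem: "\<forall>a<b0. ma a = m0 a" and h: "length rs \<le> 2 ^ h" "2 ^ h < 2 * length rs"
      and na: "na \<le> n + 3 * h + 48 * 2 ^ h + 50" for ra ma na h
  proof -
    define rb where "rb = ra(rL := 1)"
    have rb: "rb rOne = 1" "rb rZero = 0" "rb rS = 2 ^ h" "rb rSS = 2 * 2 ^ h" "rb rS4 = 4 * 2 ^ h"
      "rb rSrc = b0" "rb rDst = b0 + 4 * 2 ^ h" "rb rL = 1"
      unfolding rb_def using reg2 by simp_all
    have tab': "\<forall>z<4 * 2 ^ h. ma (b0 + z) = table ?c (2 ^ h) 1 z" using tab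
        by (simp add: table_leaf[unfolded One_nat_def])
    have bB: "b0 + 10 * 2 ^ h < B" using h(2) xy(3) lenW W_pos by linarith
    have "wp B (While rL rS level_body) (wp B tl3 Q) rb ma (na + 1)"
    proof (rule wp_post[OF wp_level_loop[OF refl bB sum_item_less rb tab']], intro allI impI,
        elim conjE, goal_cases)
      case (1 rc mc nc)
      have fr: "k \<notin> written level_body \<Longrightarrow> rc k = rb k" for k using 1(1) by simp
      have one: "(1 :: nat) \<le> 2 ^ h" by simp
      have hh: "h \<le> 2 ^ h * h" by simp
      have e: "(170 * 2 ^ h + 10) * h = 170 * (2 ^ h * h) + 10 * h" by (simp add: algebra_simps)
      have "nc \<le> na + 1 + (170 * (2 ^ h * h) + 10 * h) + 2" using 1(2) unfolding e .
      then have time: "nc + 6 * 2 ^ h + 10 \<le> n + 183 * (2 ^ h * h) + 120 * 2 ^ h"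
        using na one hh by linarith
      show ?case
        by (rule s3[where h = h]) (use 1(3-) fr reg2 mem h time
            in \<open>auto simp: rb_def written_level_body written_node_body\<close>)
    qed
    then show ?thesis unfolding tl2_def using W_pos by (simp add: wp_simps rb_def)
  qed
  have s1: "wp B tl1 Q ra ma na"
    if reg1: "ra rK = ?k" "ra rW = W" "ra rBase = d * hd ys + e * last ys" "ra rBest = r rBest"
        "ra rZero = 0" "ra rOne = 1"
      "ra rS = 2 ^ h" "ra rP = length rs" "ra rX = X" "ra rE = b0" "ra rY0 = hd ys"
          "ra rYL = last ys" "ra rD1 = d" "ra rD2 = e"
      and mem: "\<forall>a<b0. ma a = m0 a" and h: "length rs \<le> 2 ^ h" "2 ^ h < 2 * length rs"
      and na: "na \<le> n + 3 * h + 33" for ra ma na h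
    unfolding tl1_def wp_Seq
  proof (rule wp_post[OF wp_fill[OF reg1(6,5,8,9,2,10,7,11,12,13,14) mem h]], intro allI impI,
      elim conjE, goal_cases)
    case (1 rb mb nb)
    have fr: "k \<notin> {rSS, rS4, rSrc, rDst, rT, rA, rB, rTmp} \<Longrightarrow> rb k = ra k" for k
      using 1(1) by (simp add: fill_def fill_body_def patch_def)
    show ?case
      by (rule s2[where h = h]) (use 1(2-) fr reg1 h na in \<open>auto\<close>)
  qed
  have s0: "wp B size_loop (wp B tl1 Q) ra ma na"
    if reg0: "ra rK = ?k" "ra rW = W" "ra rBase = d * hd ys + e * last ys" "ra rBest = r rBest"
        "ra rZero = 0" "ra rOne = 1"
      "ra rP = length rs" "ra rX = X" "ra rE = b0" "ra rY0 = hd ys" "ra rYL = last ys" "ra rD1 = d"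
          "ra rD2 = e"
      and mem: "\<forall>a<b0. ma a = m0 a" and na: "na \<le> n + 30" for ra ma na
  proof -
    have pos: "0 < ra rP" "2 * ra rP < B" using reg0(7) p0 lenW W_pos by linarith+
    show ?thesis
    proof (rule wp_post[OF wp_size_loop[of ra B ma na, OF pos]], intro allI impI, elim conjE exE,
        goal_cases)
      case (1 rb mb nb h)
      have fr: "k \<noteq> rS \<Longrightarrow> rb k = ra k" for k using 1(1) by (simp add: size_loop_def)
      show ?case
        by (rule s1[where h = h]) (use 1(2-) fr reg0 mem na in \<open>auto\<close>)
    qed
  qed
  have "wp B prepare (wp B (size_loop ;; tl1) Q) r m n"
  proof (rule wp_post[OF wp_prepare[OF reg(1,3,4,5,6,7) m]], intro allI impI, elim conjE,
      goal_cases)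
    case (1 rb mb nb)
    have fr: "k \<notin> {rTmp, rA, rB, rC, rD1, rD2, rYL, rY0, rBase, rK} \<Longrightarrow> rb k = r k" for k
      using 1(1) by (simp add: prepare_def)
    show ?case unfolding wp_Seq
      by (rule s0) (use 1(2-) fr reg m in \<open>auto\<close>)
  qed
  then show ?thesis unfolding prog wp_Seq Q_def .
qed

end

section \<open>The complete program\<close>

text \<open>The pass is left out if the first encoding is shorter, and the roles are then exchanged.
  Two sweeps thus run the one admissible order, or both in a tie, and restore the roles.\<close>

definition sweep :: com where
  "sweep = Cond rP rQ Skip pass ;; add rA rP rZero ;; add rP rQ rZero ;; add rQ rA rZero ;;
     add rA rX rZero ;; add rX rY rZero ;; add rY rA rZero"

lemma wp_sweep:
  assumes d: "d = of_bool (snd (hd rs) \<noteq> snd (hd ts))"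
      and e: "e = of_bool (snd (last rs) \<noteq> snd (last ts))"
    and ne: "rs \<noteq> []" "ts \<noteq> []"
    and bin: "\<And>i. i < length rs \<Longrightarrow> snd (rs ! i) \<le> 1" "\<And>i. i < length ts \<Longrightarrow> snd (ts ! i) \<le> 1"
    and W: "\<And>i. i < length rs \<Longrightarrow> fst (rs ! i) \<le> W" "\<And>i. i < length ts \<Longrightarrow> fst (ts ! i) \<le> W"
    and lenW: "length rs \<le> W" "length ts \<le> W"
    and xy: "X + 2 * length rs \<le> b0" "Y + 2 * length ts \<le> b0" "b0 \<le> 2 * W"
    and B: "30 * (W * W) + 30 * W < B"
    and st: "stored m0 X rs" "stored m0 Y ts"
    and reg: "r rOne = 1" "r rZero = 0" "r rTwo = 2" "r rP = length rs" "r rQ = length ts"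
        "r rX = X" "r rY = Y" "r rE = b0" "r rW = W"
    and m: "\<forall>a<b0. m a = m0 a"
  shows "wp B sweep (\<lambda>r' m' n'. r' rBest = (if length rs < length ts then r rBest else
      min (r rBest) (candidate W d e (map fst rs) (map fst ts))) \<and> (\<forall>a<b0. m' a = m0 a) \<and>
      r' rP = length ts \<and> r' rQ = length rs \<and> r' rX = Y \<and> r' rY = X \<and>
    (\<exists>h. 2 ^ h < 2 * length rs \<and> n' \<le> n + 183 * (2 ^ h * h) + 130 * 2 ^ h)) r m n"
proof -
  have b: "length rs < B" "length ts < B" "X < B" "Y < B" using lenW xy B by linarith+
  have "0 < length rs" using ne by simp
  then have p0: "Suc 0 < 2 * length rs" by linarith
  show ?thesis
  proof (cases "length rs < length ts")
    case True
    then show ?thesis unfolding sweep_def using b reg m p0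
      by (auto simp: wp_simps reg(5)[unfolded One_nat_def] intro!: exI[of _ 0])
  next
    case False
    then have le: "length ts \<le> length rs" by simp
    have swap: "wp B (add rA rP rZero ;; add rP rQ rZero ;; add rQ rA rZero ;; add rA rX rZero ;;
        add rX rY rZero ;; add rY rA rZero)
      (\<lambda>r' m' n'. m' = ma \<and> n' = na + 6 \<and> r' rBest = ra rBest \<and> r' rP = length ts \<and>
          r' rQ = length rs \<and> r' rX = Y \<and> r' rY = X) ra ma na"
      if "ra rP = length rs" "ra rQ = length ts" "ra rX = X" "ra rY = Y" "ra rZero = 0" for ra ma na
      using that b by (simp add: wp_simps)
    have "wp B pass (wp B (add rA rP rZero ;; add rP rQ rZero ;; add rQ rA rZero ;;
        add rA rX rZero ;; add rX rY rZero ;; add rY rA rZero)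
      (\<lambda>r' m' n'. r' rBest = min (r rBest) (candidate W d e (map fst rs) (map fst ts)) \<and>
          (\<forall>a<b0. m' a = m0 a) \<and>
      r' rP = length ts \<and> r' rQ = length rs \<and> r' rX = Y \<and> r' rY = X \<and>
      (\<exists>h. 2 ^ h < 2 * length rs \<and> n' \<le> n + 183 * (2 ^ h * h) + 130 * 2 ^ h))) r m n0" if n0: "n0 \<le>
          n + 2" for n0
    proof (rule wp_post[OF wp_pass[where r = r and m = m and n = n0,
        OF d e refl refl ne bin le W lenW(1) xy B st reg m]], assumption+, intro allI impI,
        elim conjE exE, goal_cases)
      case (1 ra ma na h)
      have fr: "ra rP = length rs" "ra rQ = length ts" "ra rX = X" "ra rY = Y" "ra rZero = 0"
        using 1(1) reg
        by (simp_all add: pass_def prepare_def size_loop_def fill_def fill_body_def patch_def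
            written_level_body
            written_node_body sum_loop_def)
      have "(1 :: nat) \<le> 2 ^ h" by simp
      then have time: "na + 6 \<le> n + 183 * (2 ^ h * h) + 130 * 2 ^ h" using 1(5) n0 by linarith
      show ?case by (rule wp_mono[OF swap[OF fr]]) (use 1(2-4) time in \<open>auto intro!: exI[of _ h]\<close>)
    qed
    then show ?thesis unfolding sweep_def using False reg
        by (simp add: wp_Seq wp_Cond reg(5)[unfolded One_nat_def])
  qed
qed

text \<open>With one run each, the lengths lie in cells 0 and 2 and the letters in cells 1 and 3;
  the registers holding constants double as addresses.\<close>

definition single_runs :: com where
  "single_runs = load rA rOne ;; const rTmp 3 ;; load rB rTmp ;; sub rC rA rB ;; sub rD1 rB rA ;;
      add rD1 rD1 rC ;;
     load rA rZero ;; load rB rTwo ;; sub rB rB rA ;; add rA rA rB ;; mul rP rD1 rA"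

definition weight_body :: com where
  "weight_body = load rA rPtr ;; add rW rW rA ;; add rPtr rPtr rTwo"

text \<open>\<open>rE\<close> holds \<open>2 * (p + q)\<close>, the first cell after the input; for
  nonempty strings it is below 5 exactly if both have a single run. \<open>rZero\<close>,
  \<open>rX\<close>, \<open>rW\<close> and \<open>rPtr\<close> rely on the registers being 0
  initially.\<close>

definition dtw_program :: com where
  "dtw_program = const rOne 1 ;; const rTwo 2 ;; add rY rP rP ;; add rE rQ rQ ;; add rE rE rY ;;
     While rPtr rE weight_body ;; add rBest rW rZero ;; const rA 5 ;;
     Cond rE rA single_runs (sweep ;; sweep ;; add rP rBest rZero)"

lemma wp_weight_loop:
  assumes reg: "r rTwo = 2" "r rPtr = 0" "r rW = 0" "r rE = 2 * k"
    and b: "2 * k < B" "(\<Sum>i<k. m (2 * i)) < B"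
  shows "wp B (While rPtr rE weight_body) (\<lambda>r' m' n'. m' = m \<and> r' rW = (\<Sum>i<k. m (2 * i)) \<and>
      n' \<le> n + 5 * k + 2) r m n"
proof (rule wp_While[where I = "\<lambda>r' m' n'. m' = m \<and> r' rTwo = 2 \<and> r' rE = 2 * k \<and>
    (\<exists>j\<le>k. r' rPtr = 2 * j \<and> r' rW = (\<Sum>i<j. m (2 * i)) \<and> n' \<le> n + 5 * j)" and \<mu> = "\<lambda>r' m'. 2 * k -
        r' rPtr"], goal_cases)
  case 1
  show ?case using reg by (auto intro!: exI[of _ 0])
next
  case (2 r' m' n')
  then obtain j where j: "m' = m" "r' rTwo = 2" "r' rE = 2 * k" "r' rPtr = 2 * j"
      "r' rW = (\<Sum>i<j. m (2 * i))"
    "n' \<le> n + 5 * j" "j < k" by auto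
  have "(\<Sum>i<Suc j. m (2 * i)) \<le> (\<Sum>i<k. m (2 * i))" using j(7) by (intro sum_mono2) auto
  then have s: "(\<Sum>i<j. m (2 * i)) + m (2 * j) < B" using b(2) by simp
  show ?case unfolding weight_body_def using j s b(1)
    by (auto simp: wp_simps intro!: exI[of _ "Suc j"])
next
  case (3 r' m' n')
  then obtain j where "m' = m" "r' rE = 2 * k" "r' rPtr = 2 * j" "r' rW = (\<Sum>i<j. m (2 * i))"
      "n' \<le> n + 5 * j" "j \<le> k" by blast
  moreover from this have "j = k" using 3(2) by simp
  ultimately show ?case by simp
qed

lemma length_cells: "length (concat (map (\<lambda>(i, a). [i, a]) rs)) = 2 * length rs"
  by (induction rs) auto

lemma nth_cells:
  "k < length rs \<Longrightarrow> concat (map (\<lambda>(i, a). [i, a]) rs) ! (2 * k) = fst (rs ! k) \<and>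
    concat (map (\<lambda>(i, a). [i, a]) rs) ! Suc (2 * k) = snd (rs ! k)"
proof (induction rs arbitrary: k)
  case (Cons p rs)
  then show ?case by (cases p; cases k) auto
qed simp

lemma rle_letter: "(i, a) \<in> set (rle x) \<Longrightarrow> a \<in> set x"
  by (induction x arbitrary: i a) (auto split: list.splits if_splits)

lemma rle_run_le: "(i, a) \<in> set (rle x) \<Longrightarrow> i \<le> length x"
  by (induction x arbitrary: i a) (fastforce split: list.splits if_splits)+

lemma length_rle_le: "length (rle x) \<le> length x"
  by (induction x) (auto split: list.splits)

context
  fixes x y :: "nat list" and B W :: nat
  assumes x: "set x \<subseteq> {0, 1}" "x \<noteq> []" and y: "set y \<subseteq> {0, 1}" "y \<noteq> []"
    and W_def: "W = length x + length y" and B: "30 * (W * W) + 30 * W < B"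
begin

text \<open>Summing the lengths costs 5 per run and the two sweeps account for
  \<open>366 = 2 * 183\<close>; of \<open>300\<close>, they take \<open>2 * 130\<close> and the rest
  absorbs constants. The larger of their two exponents serves as \<open>h\<close>.\<close>

lemma wp_dtw_program:
  shows "wp B dtw_program (\<lambda>r' m' n'. r' 0 = dtw x y \<and>
    (\<exists>h. 2 ^ h < 2 * (length (rle x) + length (rle y)) \<and> n' \<le> 5 * (length (rle x) + length (rle y))
        + 366 * (2 ^ h * h) + 300 * 2 ^ h))
    (reg (rle_input (rle x) (rle y))) (mem (rle_input (rle x) (rle y))) 0"
proof -
  let ?rs = "rle x" and ?ts = "rle y"
  define p q where "p = length ?rs" and "q = length ?ts"
  define m0 where "m0 = mem (rle_input ?rs ?ts)"
  define r0 where "r0 = reg (rle_input ?rs ?ts)"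
  have r0: "r0 rP = p" "r0 (Suc 0) = q" "\<And>k. 1 < k \<Longrightarrow> r0 k = 0"
    unfolding r0_def rle_input_def p_def q_def Let_def by simp_all
  have cell: "m0 (2 * i) = fst ((?rs @ ?ts) ! i)" "m0 (Suc (2 * i)) = snd ((?rs @ ?ts) ! i)"
      if "i < p + q" for i
    using that nth_cells[of i "?rs @ ?ts"] length_cells[of "?rs @ ?ts"]
    unfolding m0_def rle_input_def p_def q_def Let_def by auto
  have st: "stored m0 0 ?rs" "stored m0 (2 * p) ?ts"
  proof -
    show "stored m0 0 ?rs" unfolding stored_def using cell by (auto simp: p_def nth_append)
    have "m0 (2 * p + 2 * i) = fst (?ts ! i) \<and> m0 (2 * p + 2 * i + 1) = snd (?ts ! i)" if "i < q"
        for i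
    proof -
      have "2 * p + 2 * i = 2 * (p + i)" by simp
      moreover have "(?rs @ ?ts) ! (p + i) = ?ts ! i" unfolding p_def
          by (rule nth_append_length_plus)
      ultimately show ?thesis using cell[of "p + i"] that by simp
    qed
    then show "stored m0 (2 * p) ?ts" unfolding stored_def q_def by blast
  qed
  have pq: "0 < p" "0 < q" "p \<le> length x" "q \<le> length y"
    using x y length_rle_le unfolding p_def q_def by auto
  have Wsum: "(\<Sum>i<p + q. m0 (2 * i)) = W"
  proof -
    have "(\<Sum>i<p + q. m0 (2 * i)) = (\<Sum>i<p + q. map fst (?rs @ ?ts) ! i)"
      using cell by (intro sum.cong) (auto simp: p_def q_def simp del: map_append)
    also have "\<dots> = sum_list (map fst (?rs @ ?ts))"
      by (subst sum_list_sum_nth) (simp add: p_def q_def atLeast0LessThan)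
    finally show ?thesis unfolding W_def using length_eq_sum_run_lengths[OF x y refl refl] by simp
  qed
  have fW: "fst (?rs ! i) \<le> W" if "i < length ?rs" for i
    using elem_le_sum_list[of i "run_lengths x"] that
        unfolding W_def length_eq_sum_run_lengths[OF x y refl refl] by simp
  have fW': "fst (?ts ! i) \<le> W" if "i < length ?ts" for i
    using elem_le_sum_list[of i "run_lengths y"] that
        unfolding W_def length_eq_sum_run_lengths[OF x y refl refl] by simp
  have bin: "snd (?rs ! i) \<le> 1" if "i < length ?rs" for i
    using rle_letter[of _ "snd (?rs ! i)" x] nth_mem[OF that] x(1) by (cases "?rs ! i") auto
  have bin': "snd (?ts ! i) \<le> 1" if "i < length ?ts" for i
    using rle_letter[of _ "snd (?ts ! i)" y] nth_mem[OF that] y(1) by (cases "?ts ! i") auto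
  have ne: "?rs \<noteq> []" "?ts \<noteq> []" using x y by simp_all
  define d e where d: "d = (of_bool (snd (hd ?rs) \<noteq> snd (hd ?ts)) :: nat)"
    and e: "e = (of_bool (snd (last ?rs) \<noteq> snd (last ?ts)) :: nat)"
  have d': "d = of_bool (snd (hd ?ts) \<noteq> snd (hd ?rs))"
      and e': "e = of_bool (snd (last ?ts) \<noteq> snd (last ?rs))"
    unfolding d e by auto
  have W0: "p + q \<le> W" "2 \<le> W" using pq unfolding W_def by linarith+
  have "30 * W < B" using B by simp
  then have bB: "2 * (p + q) < B" "W < B" "30 * W < B"
    using W0 by simp_all
  let ?b0 = "2 * (p + q)"
  define Q where "Q = (\<lambda>(r' :: nat \<Rightarrow> nat) (m' :: nat \<Rightarrow> nat) (n' :: nat). r' rP = dtw x y \<and>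
    (\<exists>h. 2 ^ h < 2 * (p + q) \<and> n' \<le> 5 * (p + q) + 366 * (2 ^ h * h) + 300 * 2 ^ h))"
  have main: "wp B (Cond rE rA single_runs (sweep ;; sweep ;; add rP rBest rZero)) Q r m0 n"
    if reg: "r rOne = 1" "r rZero = 0" "r rTwo = 2" "r rP = p" "r rQ = q" "r rX = 0" "r rY = 2 * p"
        "r rE = ?b0" "r rW = W"
      "r rBest = W" "r rA = 5" and n: "n \<le> 5 * (p + q) + 10" for r n
  proof (cases "?b0 < 5")
    case True
    then have pq1: "p = 1" "q = 1" using pq by auto
    have one: "length ?rs = 1" "length ?ts = 1" using pq1 unfolding p_def q_def by auto
    have c: "m0 0 = fst (hd ?rs)" "m0 (Suc 0) = snd (hd ?rs)" "m0 2 = fst (hd ?ts)"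
        "m0 3 = snd (hd ?ts)"
      using cell[of 0] cell[of 1] pq1 one ne by (auto simp: hd_conv_nth nth_append numeral_eq_Suc)
    have bits: "snd (hd ?rs) \<le> 1" "snd (hd ?ts) \<le> 1"
      using bin[of 0] bin'[of 0] ne by (simp_all add: hd_conv_nth)
    have dd: "snd (hd ?ts) - snd (hd ?rs) + (snd (hd ?rs) - snd (hd ?ts)) = d"
      using bits unfolding d by (auto simp: le_Suc_eq)
    have mx: "fst (hd ?rs) + (fst (hd ?ts) - fst (hd ?rs)) = max (fst (hd ?rs)) (fst (hd ?ts))"
        by simp
    have dtw: "dtw x y = d * max (fst (hd ?rs)) (fst (hd ?ts))"
      by (rule dtw_single_runs[OF x y d e one])
    have f: "fst (hd ?rs) \<le> W" "fst (hd ?ts) \<le> W" using fW[of 0] fW'[of 0] ne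
        by (simp_all add: hd_conv_nth)
    have d1: "d \<le> 1" unfolding d by simp
    define c1 c2 c3 where "c1 = snd (hd ?ts) - snd (hd ?rs)" and "c2 = snd (hd ?rs) - snd (hd ?ts)"
        and "c3 = fst (hd ?ts) - fst (hd ?rs)"
    have dB: "c1 < B" "c2 < B" "c3 < B" "max (fst (hd ?rs)) (fst (hd ?ts)) < B" "dtw x y < B"
        "d < B" "fst (hd ?rs) < B" "fst (hd ?ts) < B"
    proof -
      show "dtw x y < B" using dtw_le_length[OF x y] bB W_def by simp
    qed (use f bits d1 W0 bB in \<open>auto simp: c1_def c2_def c3_def\<close>)
    have b3: "3 < B" using bB W0 by linarith
    have abs: "snd (hd ?ts) - snd (hd ?rs) = c1" "snd (hd ?rs) - snd (hd ?ts) = c2"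
        "fst (hd ?ts) - fst (hd ?rs) = c3"
      "c1 + c2 = d" "fst (hd ?rs) + c3 = max (fst (hd ?rs)) (fst (hd ?ts))"
          "d * max (fst (hd ?rs)) (fst (hd ?ts)) = dtw x y"
      using dd mx dtw unfolding c1_def c2_def c3_def by simp_all
    have "wp B single_runs Q r m0 (n + 1)"
      unfolding single_runs_def
      by (simp add: wp_simps reg reg(1)[unfolded One_nat_def] c abs dB b3 Q_def)
        (use n pq1 in \<open>auto intro!: exI[of _ 0]\<close>)
    then show ?thesis using True reg by (simp add: wp_Cond)
  next
    case False
    then have ns: "\<not> (length ?rs = 1 \<and> length ?ts = 1)" unfolding p_def q_def by auto
    note cand = dtw_eq_candidate[OF x y d e ns, folded W_def]
    have xy1: "0 + 2 * length ?rs \<le> ?b0" "2 * p + 2 * length ?ts \<le> ?b0" "?b0 \<le> 2 * W"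
      using W0 unfolding p_def q_def by simp_all
    have xy2: "2 * p + 2 * length ?ts \<le> ?b0" "0 + 2 * length ?rs \<le> ?b0" "?b0 \<le> 2 * W"
      using xy1 by simp_all
    have lens: "length ?rs \<le> W" "length ?ts \<le> W" using W0 unfolding p_def q_def by simp_all
    have reg1: "r rP = length ?rs" "r rQ = length ?ts" using reg unfolding p_def q_def by simp_all
    let ?b1 = "if p < q then W else min W (candidate W d e (run_lengths x) (run_lengths y))"
    let ?b2 = "if q < p then ?b1 else min ?b1 (candidate W d e (run_lengths y) (run_lengths x))"
    \<comment> \<open>Each sweep contributes its candidate only in an admissible order; the initial
      value \<open>W\<close> is harmless because it bounds the distance.\<close>
    have fin: "?b2 = dtw x y"
    proof -
      have "dtw x y \<le> W" using dtw_le_length[OF x y] W_def by simp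
      then show ?thesis using cand unfolding p_def[symmetric] q_def[symmetric] by auto
    qed
    have dB: "dtw x y < B" using dtw_le_length[OF x y] bB W_def by simp
    define e1 where "e1 = (add rP rBest rZero)"
    have fr: "written sweep \<inter> {rOne, rZero, rTwo, rE, rW} = {}"
      by (simp add: sweep_def pass_def prepare_def size_loop_def fill_def fill_body_def patch_def
          written_level_body
            written_node_body sum_loop_def)
    have "wp B sweep (wp B (sweep ;; e1) Q) r m0 (n + 2)"
    proof (rule wp_post[OF wp_sweep[where r = r and m = m0 and n = "n + 2",
        OF d e ne bin bin' fW fW' lens xy1 B st reg(1-3) reg1 reg(6-9)]],
        assumption+, simp, intro allI impI, elim conjE exE, goal_cases)
      case (1 ra ma na h1)
      have fra: "ra k = r k" if "k \<in> {rOne, rZero, rTwo, rE, rW}" for k using 1(1) fr that by blast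
      have na: "na \<le> n + 2 + 183 * (2 ^ h1 * h1) + 130 * 2 ^ h1" and pow1: "2 ^ h1 < 2 * length ?rs"
          using 1 by auto
      have ba: "ra rBest = ?b1" using 1(2) reg(10) unfolding p_def q_def by simp
      have "wp B sweep (wp B e1 Q) ra ma na"
      proof (rule wp_post[OF wp_sweep[where r = ra and m = ma and n = na,
          OF d' e' ne(2,1) bin' bin fW' fW lens(2,1) xy2 B st(2,1)]], assumption+, goal_cases)
        case 11
        show ?case
        proof (intro allI impI, elim conjE exE, goal_cases)
          case (1 rb mb nb h2)
          have frb: "rb k = ra k" if "k \<in> {rOne, rZero, rTwo, rE, rW}" for k using 1(1) fr that
              by blast
          have bb: "rb rBest = dtw x y" using 1(2) unfolding p_def[symmetric] q_def[symmetric]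
              unfolding ba unfolding fin .
          define h where "h = max h1 h2"
          have z: "rb rZero = 0" using frb[of rZero] fra[of rZero] reg(2) by simp
          have h: "(2 :: nat) ^ h1 \<le> 2 ^ h" "(2 :: nat) ^ h2 \<le> 2 ^ h" "2 ^ h1 * h1 \<le> 2 ^ h * h"
              "2 ^ h2 * h2 \<le> 2 ^ h * h" "(1 :: nat) \<le> 2 ^ h"
            unfolding h_def by (auto intro!: mult_le_mono power_increasing)
          have hl: "2 ^ h < 2 * (p + q)"
            using pow1 1(8) unfolding h_def max_def p_def q_def by auto
          have "nb + 1 \<le> 5 * (p + q) + 366 * (2 ^ h * h) + 300 * 2 ^ h"
            using 1(9) na n h by linarith
          then show ?case unfolding e1_def Q_def using z bb dB hl
              by (auto simp: wp_simps intro!: exI[of _ h])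
        qed
      qed (use 1 fra reg in \<open>auto\<close>)
      then show ?case by (simp add: wp_Seq)
    qed
    then show ?thesis using False reg unfolding e1_def by (simp add: wp_Cond wp_Seq)
  qed
  have loop: "wp B (While rPtr rE weight_body) (wp B (add rBest rW rZero ;; const rA 5 ;;
      Cond rE rA single_runs (sweep ;; sweep ;; add rP rBest rZero)) Q) r m0 n0"
    if n0: "n0 \<le> 5" and reg: "r rOne = 1" "r rZero = 0" "r rTwo = 2" "r rP = p" "r rQ = q"
        "r rX = 0" "r rY = 2 * p" "r rE = ?b0" "r rW = 0" "r rPtr = 0" for r n0
  proof (rule wp_post[OF wp_weight_loop[OF reg(3,10,9,8) bB(1)]], goal_cases)
    case 2
    show ?case
    proof (intro allI impI, elim conjE, goal_cases)
      case (1 ra ma na)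
      have fr: "ra k = r k" if "k \<notin> {rA, rW, rPtr}" for k using 1(1) that
          by (simp add: weight_body_def)
      have "wp B (Cond rE rA single_runs (sweep ;; sweep ;; add rP rBest rZero)) Q (ra(rBest := W,
          rA := 5)) m0 (na + 2)"
        by (rule main) (use 1 fr reg Wsum n0 in \<open>auto\<close>)
      then show ?case using 1 fr reg Wsum bB W0 by (simp add: wp_simps(1-6))
    qed
  qed (use Wsum bB in simp)
  have "wp B dtw_program Q r0 m0 0"
    unfolding dtw_program_def
    using loop[where r = "r0(rOne := 1, rTwo := 2, rY := 2 * p, rE := ?b0)"] r0 bB W0
    by (simp add: wp_simps(1-6) mult_2 add.commute add.left_commute)
  then show ?thesis unfolding r0_def m0_def Q_def p_def q_def .
qed

end

section \<open>Time bound and word length\<close>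

lemma words_fit_rle_input:
  assumes "length x + length y < 2 ^ w" "set x \<subseteq> {0, 1}" "set y \<subseteq> {0, 1}" "0 < w"
  shows "words_fit w (rle_input (rle x) (rle y))"
proof -
  have len: "length (rle x) < 2 ^ w" "length (rle y) < 2 ^ w"
    using assms(1) length_rle_le[of x] length_rle_le[of y] by linarith+
  have fit: "i < 2 ^ w \<and> a < 2 ^ w" if mem: "(i, a) \<in> set (rle x) \<union> set (rle y)" for i a
  proof -
    obtain z where z: "(i, a) \<in> set (rle z)" "z = x \<or> z = y" using mem by blast
    have "a \<in> set z" "i \<le> length z" using rle_letter[OF z(1)] rle_run_le[OF z(1)] by auto
    then have "a \<le> 1" using z(2) assms(2,3) by auto
    moreover have "(1 :: nat) < 2 ^ w" using one_less_power[of "2 :: nat" w] assms(4) by simp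
    ultimately show ?thesis using \<open>i \<le> length z\<close> z(2) assms(1) by auto
  qed
  let ?cells = "concat (map (\<lambda>(i, a). [i, a]) (rle x @ rle y))"
  have "?cells ! j < 2 ^ w" if "j < length ?cells" for j
  proof -
    have "?cells ! j \<in> set ?cells" using that by (rule nth_mem)
    then show ?thesis using fit by auto
  qed
  then show ?thesis using len unfolding words_fit_def rle_input_def Let_def by auto
qed

text \<open>From \<open>2 ^ h < 2 * l\<close> follows that \<open>h\<close> exceeds the rounded
  logarithm by at most 1. The leading coefficient becomes \<open>2 * 366 = 732\<close>; 1100 and the
  summand 2 absorb the linear terms.\<close>

definition time_bound :: "nat \<Rightarrow> nat" where
  "time_bound l = 1100 * l * (nat \<lfloor>log 2 (real l)\<rfloor> + 2)"

text \<open>The factor 2 accounts for the square of \<open>N\<close>, and \<open>2 ^ 6 = 64\<close>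
  exceeds \<open>30 + 30\<close>.\<close>

definition word_length :: "nat \<Rightarrow> nat" where
  "word_length N = 2 * nat \<lceil>log 2 (real N)\<rceil> + 6"

lemma time_bound_bigo: "(\<lambda>l. real (time_bound l)) \<in> O(\<lambda>l. real l * ln (real l))"
proof (rule bigoI[where c = "3300 / ln 2"], rule eventually_sequentiallyI[of 2])
  fix l :: nat assume l: "2 \<le> l"
  have log: "1 \<le> log 2 (real l)" using l by (simp add: le_log_iff)
  define k where "k = nat \<lfloor>log 2 (real l)\<rfloor>"
  have "real k \<le> log 2 (real l)" unfolding k_def using log by simp
  \<comment> \<open>As the logarithm is at least 1 from \<open>l = 2\<close> on, it absorbs the
    summand 2; this is the origin of \<open>3300 = 3 * 1100\<close>.\<close>
  then have "real k + 2 \<le> 3 * log 2 (real l)" using log by linarith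
  then have "1100 * real l * (real k + 2) \<le> 1100 * real l * (3 * log 2 (real l))"
    by (intro mult_left_mono) auto
  also have "\<dots> = 3300 / ln 2 * (real l * ln (real l))" by (simp add: log_def)
  finally show "norm (real (time_bound l)) \<le> 3300 / ln 2 * norm (real l * ln (real l))"
    using l unfolding time_bound_def k_def[symmetric] by (simp add: abs_mult algebra_simps)
qed

lemma word_length_bigo: "(\<lambda>N. real (word_length N)) \<in> O(\<lambda>N. ln (real N))"
proof (rule bigoI[where c = "10 / ln 2"], rule eventually_sequentiallyI[of 2])
  fix N :: nat assume N: "2 \<le> N"
  have log: "1 \<le> log 2 (real N)" using N by (simp add: le_log_iff)
  define k where "k = nat \<lceil>log 2 (real N)\<rceil>"
  have "real k \<le> log 2 (real N) + 1" unfolding k_def using log by linarith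
  then have "real (word_length N) \<le> 10 * log 2 (real N)" unfolding word_length_def k_def[symmetric]
      using log by simp
  also have "\<dots> = 10 / ln 2 * ln (real N)" by (simp add: log_def)
  finally show "norm (real (word_length N)) \<le> 10 / ln 2 * norm (ln (real N))" using N by simp
qed

lemma word_length_suffices:
  assumes "2 \<le> N"
  shows "30 * (N * N) + 30 * N < 2 ^ word_length N" "N < 2 ^ word_length N"
proof -
  define k where "k = nat \<lceil>log 2 (real N)\<rceil>"
  have "log 2 (real N) \<le> real k" unfolding k_def by linarith
  then have "real N \<le> 2 powr real k" using assms by (simp add: log_le_iff)
  then have "real N \<le> real (2 ^ k)" by (simp add: powr_realpow)
  then have "N \<le> 2 ^ k" by (simp only: of_nat_le_iff)
  then have "N * N \<le> 2 ^ k * 2 ^ k" by (intro mult_le_mono)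
  also have "\<dots> = 2 ^ (2 * k)" by (simp add: power_add[symmetric] mult_2)
  finally have "64 * (N * N) \<le> 2 ^ word_length N" unfolding word_length_def k_def[symmetric]
      by (simp add: power_add)
  moreover have "N \<le> N * N" "0 < N" using assms by auto
  ultimately show "30 * (N * N) + 30 * N < 2 ^ word_length N" "N < 2 ^ word_length N" by linarith+
qed

lemma time_bound_suffices:
  assumes "2 ^ h < 2 * l" "n \<le> 5 * l + 366 * (2 ^ h * h) + 300 * 2 ^ h"
  shows "n \<le> time_bound l"
proof -
  let ?k = "nat \<lfloor>log 2 (real l)\<rfloor>"
  have l: "0 < l" using assms(1) by (cases l) auto
  have "real (2 ^ h) < real (2 * l)" using assms(1) by (simp only: of_nat_less_iff)
  then have "2 powr real h < 2 * real l" by (simp add: powr_realpow)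
  then have "real h < log 2 (2 * real l)" using l by (simp add: less_log_iff)
  also have "\<dots> = 1 + log 2 (real l)" using l by (simp add: log_mult)
  finally have h: "h \<le> ?k + 1" by linarith
  have "2 ^ h * h \<le> 2 * l * (?k + 1)" using assms(1) h by (intro mult_le_mono) auto
  then have "n \<le> 5 * l + 366 * (2 * l * (?k + 1)) + 300 * (2 * l)" using assms by linarith
  also have "\<dots> \<le> time_bound l" unfolding time_bound_def by (simp add: algebra_simps)
  finally show ?thesis .
qed

theorem theorem2:
  "\<exists>(P :: program) (T :: nat \<Rightarrow> nat) (w :: nat \<Rightarrow> nat).
     (\<lambda>l. real (T l)) \<in> O(\<lambda>l. real l * ln (real l)) \<and>
     (\<lambda>N. real (w N)) \<in> O(\<lambda>N. ln (real N)) \<and>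
     (\<forall>(n::nat) (m::nat) (l::nat) (x :: nat list) (y :: nat list).
        0 < n \<and> 0 < m \<and>
        length x = n \<and> set x \<subseteq> {0, 1} \<and>
        length y = m \<and> set y \<subseteq> {0, 1} \<and>
        length (rle x) + length (rle y) = l \<longrightarrow>
        computes_within P (rle_input (rle x) (rle y)) (dtw x y) (T l) (w (n + m)))"
proof (intro exI conjI allI impI)
  show "(\<lambda>l. real (time_bound l)) \<in> O(\<lambda>l. real l * ln (real l))" by (rule time_bound_bigo)
  show "(\<lambda>N. real (word_length N)) \<in> O(\<lambda>N. ln (real N))" by (rule word_length_bigo)
  fix n m l :: nat and x y :: "nat list"
  assume a: "0 < n \<and> 0 < m \<and> length x = n \<and> set x \<subseteq> {0, 1} \<and> length y = m \<and> set y \<subseteq> {0, 1} \<and>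
    length (rle x) + length (rle y) = l"
  then have x: "set x \<subseteq> {0, 1}" "x \<noteq> []" and y: "set y \<subseteq> {0, 1}" "y \<noteq> []" by auto
  let ?w = "word_length (n + m)" and ?s = "rle_input (rle x) (rle y)"
  have W: "n + m = length x + length y" "2 \<le> n + m" using a by auto
  obtain n' r' m' h where run: "big_step (2 ^ ?w) dtw_program (reg ?s) (mem ?s) n' r' m'"
      "r' 0 = dtw x y"
    and h: "2 ^ h < 2 * l" "n' \<le> 5 * l + 366 * (2 ^ h * h) + 300 * 2 ^ h"
    using wp_dtw_program[OF x y W(1) word_length_suffices(1)[OF W(2)]] a unfolding wp_def by auto
  have s: "conf 0 (reg ?s) (mem ?s) = ?s" by (simp add: rle_input_def Let_def)
  have "words_fit ?w ?s"
    using words_fit_rle_input[OF _ x(1) y(1), of ?w] word_length_suffices(2)[OF W(2)] W(1)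
    by (simp add: word_length_def)
  then show "computes_within (compile 0 dtw_program) ?s (dtw x y) (time_bound l) ?w"
    using computes_withinI[OF run(1) _ run(2) time_bound_suffices[OF h]] unfolding s by blast
qed

end
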